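(* For every $x\in\mathbb{R}$ the limit $\lim_{n\to\infty}R_n(x)$ exists and $$\lim_{n\to\infty}R_n(x)=\begin{cases} e^{-x} & \text{if } x>0,\\ \pi\lim_{n\to\infty}\mathbb{D}_{p_n}(1) & \text{if } x=0,\\ 0 & \text{if } x<0,\end{cases}$$ where $\lim_{n\to\infty}\mathbb{D}_{p_n}(1)=\frac{1-e^{-1}}{\pi}+\frac1\pi\int_0^1 e^{-(s-s\log s)}\,ds$.
   Context: Let $a_0,a_1,a_2,\dots$ be i.i.d. complex random variables with density $\frac1\pi e^{-|z|^2}$ with respect to Lebesgue measure on $\mathbb{C}$. For an integer $n\ge 2$, the Gaussian $SU(2)$ random polynomial is $p_n(z)=\sum_{j=0}^n a_j\sqrt{\binom nj}\,z^j$, $z\in\mathbb{C}$. The expected density of critical values of $p_n$ is the (continuous) function $\mathbb{D}_{p_n}$ on $\mathbb{C}$ such that for every smooth compactly supported $\phi$ on $\mathbb{C}\cong\mathbb{R}^2$, $$\mathbb{E}\sum_{z\in\mathbb{C}:\,p_n'(z)=0}\phi(p_n(z))=\int_{\mathbb{C}}\phi(x)\,\mathbb{D}_{p_n}(x)\,d\ell_x,$$ with $d\ell_x$ Lebesgue measure on $\mathbb{C}$. The expected density of the nonvanishing critical values of $|p_n|$ is the (continuous) function $\mathbb{D}_{|p_n|}$ on $\mathbb{R}_+=[0,\infty)$ such that for every $\phi\in C_c^\infty(\mathbb{R}_+)$, $$\mathbb{E}\sum_{z\in\mathbb{C}:\,p_n'(z)=0}\phi(|p_n(z)|)=\int_0^\infty\phi(x)\,\mathbb{D}_{|p_n|}(x)\,dx.$$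 $F_n$ denotes the distribution function of the probability density $\frac{\mathbb{D}_{|p_n|}}{n-1}$, i.e. $F_n(x)=\frac1{n-1}\int_0^x\mathbb{D}_{|p_n|}(y)\,dy$ for $x\ge0$. The rescaled probability density on $\mathbb{R}$ is $R_n(x)=\frac{d}{dx}\left[F_n\!\left(e^{\frac{nx}{2}}\right)\right]$, $x\in\mathbb{R}$. *)

theory Defs
  imports "HOL-Probability.Probability" "HOL-Computational_Algebra.Polynomial"
begin

text \<open>
  The derivatives are taken within \<open>S\<close>, so on \<open>{0..}\<close> they are one-sided at the origin.
  The definition is meant for sets on which such a derivative is unique, as it is
  on \<open>UNIV\<close> and on \<open>{0..}\<close>.
\<close>

primrec Ck_on :: "nat \<Rightarrow> 'a::real_normed_vector set \<Rightarrow> ('a \<Rightarrow> real) \<Rightarrow> bool" where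
  "Ck_on 0 S f \<longleftrightarrow> continuous_on S f"
| "Ck_on (Suc k) S f \<longleftrightarrow> (\<forall>x\<in>S. f differentiable (at x within S)) \<and>
     (\<forall>v. Ck_on k S (\<lambda>x. frechet_derivative f (at x within S) v))"

definition smooth_on :: "'a::real_normed_vector set \<Rightarrow> ('a \<Rightarrow> real) \<Rightarrow> bool" where
  "smooth_on S f \<longleftrightarrow> (\<forall>k. Ck_on k S f)"

text \<open>
  Smooth functions on the closed set \<open>S\<close> with compact support in \<open>S\<close>; their values
  outside \<open>S\<close> are irrelevant. On \<open>complex\<close>, differentiability is real
  (Frechet) differentiability, i.e. \<open>complex\<close> is treated as the plane.
\<close>

definition test_fun_on :: "'a::real_normed_vector set \<Rightarrow> ('a \<Rightarrow> real) \<Rightarrow> bool" where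
  "test_fun_on S \<phi> \<longleftrightarrow> smooth_on S \<phi> \<and> compact (closure {x \<in> S. \<phi> x \<noteq> 0})"

definition SU2_poly :: "(nat \<Rightarrow> 'w \<Rightarrow> complex) \<Rightarrow> nat \<Rightarrow> 'w \<Rightarrow> complex poly" where
  "SU2_poly a n \<omega> = (\<Sum>j\<le>n. monom (a j \<omega> * of_real (sqrt (real (n choose j)))) j)"

definition crit_points :: "complex poly \<Rightarrow> complex set" where
  "crit_points p = {z. poly (pderiv p) z = 0}"

definition is_crit_density ::
    "'w measure \<Rightarrow> (nat \<Rightarrow> 'w \<Rightarrow> complex) \<Rightarrow> nat \<Rightarrow> (complex \<Rightarrow> real) \<Rightarrow> bool" where
  "is_crit_density M a n D \<longleftrightarrow> continuous_on UNIV D \<and>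
     (\<forall>\<phi>. test_fun_on UNIV \<phi> \<longrightarrow>
        prob_space.expectation M
          (\<lambda>\<omega>. \<Sum>z\<in>crit_points (SU2_poly a n \<omega>). \<phi> (poly (SU2_poly a n \<omega>) z))
        = (LINT x|lborel. \<phi> x * D x))"

definition crit_density ::
    "'w measure \<Rightarrow> (nat \<Rightarrow> 'w \<Rightarrow> complex) \<Rightarrow> nat \<Rightarrow> complex \<Rightarrow> real" where
  "crit_density M a n = (THE D. is_crit_density M a n D)"

text \<open>
  The density of the critical values of the modulus lives on \<open>{0..}\<close>; it is extended
  by \<open>0\<close> to negative arguments only to make it unique as a function on \<open>real\<close>.
\<close>

definition is_abs_crit_density ::
    "'w measure \<Rightarrow> (nat \<Rightarrow> 'w \<Rightarrow> complex) \<Rightarrow> nat \<Rightarrow> (real \<Rightarrow> real) \<Rightarrow> bool" where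
  "is_abs_crit_density M a n D \<longleftrightarrow> continuous_on {0..} D \<and> (\<forall>x<0. D x = 0) \<and>
     (\<forall>\<phi>. test_fun_on {0..} \<phi> \<longrightarrow>
        prob_space.expectation M
          (\<lambda>\<omega>. \<Sum>z\<in>crit_points (SU2_poly a n \<omega>). \<phi> (cmod (poly (SU2_poly a n \<omega>) z)))
        = (LINT x:{0..}|lborel. \<phi> x * D x))"

definition abs_crit_density ::
    "'w measure \<Rightarrow> (nat \<Rightarrow> 'w \<Rightarrow> complex) \<Rightarrow> nat \<Rightarrow> real \<Rightarrow> real" where
  "abs_crit_density M a n = (THE D. is_abs_crit_density M a n D)"

definition abs_crit_cdf ::
    "'w measure \<Rightarrow> (nat \<Rightarrow> 'w \<Rightarrow> complex) \<Rightarrow> nat \<Rightarrow> real \<Rightarrow> real" where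
  "abs_crit_cdf M a n x = 1 / (real n - 1) * (LINT y:{0..x}|lborel. abs_crit_density M a n y)"

definition rescaled_density ::
    "'w measure \<Rightarrow> (nat \<Rightarrow> 'w \<Rightarrow> complex) \<Rightarrow> nat \<Rightarrow> real \<Rightarrow> real" where
  "rescaled_density M a n x = deriv (\<lambda>t. abs_crit_cdf M a n (exp (real n * t / 2))) x"

end

theory Submission
  imports Defs "HOL-Complex_Analysis.Complex_Analysis" "HOL-Real_Asymp.Real_Asymp"
begin

text \<open>
  The critical points of \<open>p\<close> do not depend on \<open>a\<^sub>0\<close>, and \<open>p'(z) = 0\<close> says that \<open>a\<^sub>1\<close> equals a polynomial
  \<open>h(z)\<close> whose coefficients come from \<open>a\<^sub>2, ..., a\<^sub>n\<close>. Integrating over \<open>a\<^sub>1\<close> first, the area formula for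
  \<open>h\<close> turns the expected sum over critical points into an integral over \<open>z\<close> of a Gaussian expectation of
  three linear functionals. Givens rotations reduce that expectation to its Gram matrix, and an
  integration by parts gives the density of critical values at \<open>w\<close>,
  \<open>(n - 1) / \<pi>\<close> times the integral over \<open>r \<ge> 0\<close> of
  \<open>exp (- \<bar>w\<bar>\<^sup>2 A) A / (1 + r)\<^sup>2\<close> with \<open>A = (1 + n r) / (1 + r)\<^sup>n\<close>.
  Here \<open>\<bar>w\<bar> = 1\<close> is handled by dominated convergence after \<open>r = s / n\<close>. For \<open>\<bar>w\<bar>\<^sup>2 = exp (n x)\<close> with
  \<open>x > 0\<close> the mass of the integral concentrates at \<open>1 + r = exp x\<close>.
\<close>

subsection \<open>The area formula for complex polynomials\<close>

text \<open>The coefficient of \<open>z\<close> is singled out because it enters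
  \<open>p'(z)\<close> with a factor that does not depend on \<open>z\<close>: with the others
  fixed, the critical points for the value \<open>y\<close> are exactly the fibre of one polynomial
  over \<open>y\<close>, and the area formula is a statement about fibres. No joint density of the
  three functionals is written down, so linearly dependent ones need no separate treatment. The
  function \<open>A\<close> is the reciprocal of the conditional variance of \<open>p(z)\<close>
  given \<open>p'(z) = 0\<close>, with \<open>r = |z|^2\<close>; this is why it stands in the
  exponent next to \<open>|w|^2\<close>. Up to the expectation formula every integral is nonnegative
  and orders of integration are exchanged freely; integrability enters with functions of bounded
  support. The densities are given by definite descriptions, so smooth bump functions must be built
  to separate continuous densities. The threshold \<open>1 + r = exp x\<close> comes from
  \<open>exp (n x) A = (1 + n r) (exp x / (1 + r))^n\<close>, which is exponentially large below it
  and small above it.\<close>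

definition plane_complex :: "real^2 \<Rightarrow> complex" where
  "plane_complex v = Complex (v$1) (v$2)"

definition complex_plane :: "complex \<Rightarrow> real^2" where
  "complex_plane z = (\<chi> i. if i = 1 then Re z else Im z)"

lemma plane_complex_inverse [simp]: "complex_plane (plane_complex v) = v"
  by (simp add: complex_plane_def plane_complex_def vec_eq_iff forall_2)

lemma complex_plane_inverse [simp]: "plane_complex (complex_plane z) = z"
  by (simp add: complex_plane_def plane_complex_def)

lemma linear_plane_complex: "linear plane_complex"
  by (rule linearI) (auto simp: plane_complex_def complex_eq_iff)

lemma linear_complex_plane: "linear complex_plane"
  by (rule linearI) (auto simp: complex_plane_def vec_eq_iff)

lemma bounded_linear_plane_complex: "bounded_linear plane_complex"
  using linear_plane_complex linear_conv_bounded_linear by blast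

lemma bounded_linear_complex_plane: "bounded_linear complex_plane"
  using linear_complex_plane linear_conv_bounded_linear by blast

lemma measurable_plane_complex [measurable]: "plane_complex \<in> borel_measurable borel"
  by (intro borel_measurable_continuous_onI linear_continuous_on bounded_linear_plane_complex)

text \<open>Boxes go to boxes with the same side lengths, and Lebesgue measure is determined by its
  values on boxes. This transports the change of variables with a Jacobian determinant from
  \<open>real^2\<close> to the complex plane.\<close>

lemma lborel_plane_complex: "lborel = distr lborel borel plane_complex"
proof (rule lborel_eqI)
  fix l u :: complex
  assume le: "\<And>b. b \<in> Basis \<Longrightarrow> l \<bullet> b \<le> u \<bullet> b"
  have le': "Re l \<le> Re u" "Im l \<le> Im u"
    using le[of 1] le[of \<i>] by (auto simp: Basis_complex_def)
  have "plane_complex -` box l u = box (complex_plane l) (complex_plane u)"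
    by (auto simp: mem_box Basis_complex_def plane_complex_def complex_plane_def
        Basis_vec_def inner_axis forall_2 axis_eq_axis)
  moreover have "emeasure lborel (box (complex_plane l) (complex_plane u)) =
      (\<Prod>b\<in>Basis. (complex_plane u - complex_plane l) \<bullet> b)"
    by (rule emeasure_lborel_box)
      (use le' in \<open>auto simp: Basis_vec_def inner_axis complex_plane_def\<close>)
  moreover have "(\<Prod>b\<in>Basis. (complex_plane u - complex_plane l) \<bullet> b) = (Re u - Re l) * (Im u - Im l)"
  proof -
    have B: "(Basis :: (real^2) set) = {axis 1 1, axis 2 1}"
      by (auto simp: Basis_vec_def UNIV_2)
    show ?thesis by (simp add: B axis_eq_axis inner_axis complex_plane_def)
  qed
  ultimately show "emeasure (distr lborel borel plane_complex) (box l u) = (\<Prod>b\<in>Basis. (u - l) \<bullet> b)"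
    by (simp add: emeasure_distr Basis_complex_def)
qed simp

text \<open>Multiplication by \<open>h' z\<close> is, as a real 2 by 2 matrix, a rotation times a
  dilation, so the Jacobian determinant of a holomorphic map is the squared modulus of its
  derivative.\<close>

lemma emeasure_holomorphic_image:
  assumes A: "A \<in> sets borel" and hA: "h ` A \<in> sets borel"
    and der: "\<And>z. z \<in> A \<Longrightarrow> (h has_field_derivative h' z) (at z)"
    and inj: "inj_on h A"
    and h': "h' \<in> borel_measurable borel"
    and int: "integrable lborel (\<lambda>z. indicator A z * (cmod (h' z))\<^sup>2)"
  shows "emeasure lborel (h ` A) = (\<integral>\<^sup>+z. indicator A z * ennreal ((cmod (h' z))\<^sup>2) \<partial>lborel)"
proof -
  note [measurable] = A hA h'
  define S where "S = complex_plane ` A"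
  define g where "g = complex_plane \<circ> h \<circ> plane_complex"
  define g' where "g' v = (\<lambda>w. complex_plane (h' (plane_complex v) * plane_complex w))" for v
  have S_eq: "S = plane_complex -` A"
    unfolding S_def by (metis (no_types, opaque_lifting) complex_plane_inverse image_eqI
        plane_complex_inverse subsetI subset_antisym vimageE image_subset_iff vimageI2)
  have gS: "g ` S = plane_complex -` (h ` A)"
  proof -
    have "g ` S = complex_plane ` (h ` A)"
      by (auto simp: g_def S_def image_image)
    also have "\<dots> = plane_complex -` (h ` A)"
      by (metis (no_types, opaque_lifting) complex_plane_inverse image_eqI
        plane_complex_inverse subsetI subset_antisym vimageE image_subset_iff vimageI2)
    finally show ?thesis .
  qed
  have Sb[measurable]: "S \<in> sets borel" unfolding S_eq using measurable_sets_borel[OF measurable_plane_complex A] by simp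
  have gSb: "g ` S \<in> sets borel" unfolding gS using measurable_sets_borel[OF measurable_plane_complex hA] by simp
  have derg: "(g has_derivative g' v) (at v within S)" if "v \<in> S" for v
  proof -
    have "plane_complex v \<in> A" using that by (simp add: S_eq)
    then have "(h has_derivative (\<lambda>w. h' (plane_complex v) * w)) (at (plane_complex v))"
      using der by (simp add: has_field_derivative_def)
    moreover have "(plane_complex has_derivative plane_complex) (at v)"
      by (rule bounded_linear_imp_has_derivative[OF bounded_linear_plane_complex])
    moreover have "(complex_plane has_derivative complex_plane) (at (h (plane_complex v)))"
      by (rule bounded_linear_imp_has_derivative[OF bounded_linear_complex_plane])
    ultimately have "(g has_derivative complex_plane \<circ> ((\<lambda>w. h' (plane_complex v) * w) \<circ> plane_complex)) (at v)"
      unfolding g_def comp_assoc by (intro diff_chain_at) (auto simp: o_def)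
    then show ?thesis
      by (auto simp: g'_def o_def intro: has_derivative_at_withinI)
  qed
  have injg: "inj_on g S"
    using inj unfolding inj_on_def g_def S_eq
    by (metis comp_apply complex_plane_inverse plane_complex_inverse vimage_eq)
  have det: "\<bar>det (matrix (g' v))\<bar> = (cmod (h' (plane_complex v)))\<^sup>2" for v
    by (simp add: det_2 matrix_def g'_def complex_plane_def plane_complex_def axis_def cmod_power2)
      (simp add: power2_eq_square)
  have int2: "integrable lborel (\<lambda>v. indicator S v * (cmod (h' (plane_complex v)))\<^sup>2)"
  proof -
    have "integrable (distr lborel borel plane_complex) (\<lambda>z. indicator A z * (cmod (h' z))\<^sup>2)"
      using int lborel_plane_complex by simp
    then show ?thesis
      by (subst (asm) integrable_distr_eq) (auto simp: S_eq indicator_def)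
  qed
  \<comment> \<open>The theorem on measures of differentiable images speaks of the gauge integral,
    so the Bochner integral is converted here.\<close>
  then have hi: "((\<lambda>v. (cmod (h' (plane_complex v)))\<^sup>2) has_integral
      (LINT v|lborel. indicator S v * (cmod (h' (plane_complex v)))\<^sup>2)) S"
  proof -
    have "(\<lambda>v. indicator S v * (cmod (h' (plane_complex v)))\<^sup>2) =
        (\<lambda>v. if v \<in> S then (cmod (h' (plane_complex v)))\<^sup>2 else 0)"
      by (auto simp: indicator_def)
    then show ?thesis
      using has_integral_integral_lborel[OF int2]
      by (simp only: has_integral_restrict_UNIV)
  qed
  have *: "g ` S \<in> lmeasurable \<and> measure lebesgue (g ` S) =
      (LINT v|lborel. indicator S v * (cmod (h' (plane_complex v)))\<^sup>2)"
    using has_measure_differentiable_image[of S g g' "LINT v|lborel. indicator S v * (cmod (h' (plane_complex v)))\<^sup>2"]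
      derg injg hi by (simp add: det)
  have "emeasure lborel (h ` A) = emeasure lborel (g ` S)"
    by (subst lborel_plane_complex) (simp add: emeasure_distr gS)
  also have "\<dots> = ennreal (measure lebesgue (g ` S))"
  proof -
    have "emeasure lebesgue (g ` S) = emeasure lborel (g ` S)"
      using gSb by (simp add: emeasure_completion)
    moreover have "emeasure lebesgue (g ` S) = ennreal (measure lebesgue (g ` S))"
      by (rule emeasure_eq_measure2[OF conjunct1[OF *]])
    ultimately show ?thesis by (rule subst)
  qed
  also have "\<dots> = ennreal (LINT v|lborel. indicator S v * (cmod (h' (plane_complex v)))\<^sup>2)"
    using * by simp
  also have "\<dots> = (\<integral>\<^sup>+v. ennreal (indicator S v * (cmod (h' (plane_complex v)))\<^sup>2) \<partial>lborel)"
    by (rule nn_integral_eq_integral[symmetric, OF int2]) simp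
  also have "\<dots> = (\<integral>\<^sup>+v. indicator A (plane_complex v) * ennreal ((cmod (h' (plane_complex v)))\<^sup>2) \<partial>lborel)"
    by (intro nn_integral_cong) (auto simp: S_eq indicator_def)
  also have "\<dots> = (\<integral>\<^sup>+z. indicator A z * ennreal ((cmod (h' z))\<^sup>2) \<partial>distr lborel borel plane_complex)"
    by (subst nn_integral_distr) auto
  finally show ?thesis using lborel_plane_complex by simp
qed

text \<open>Knowing the measure of the image of every Borel subset amounts to an equality of two
  measures, hence of the integrals of every nonnegative function. The inverse \<open>G\<close> moves
  \<open>F\<close> from the domain to the image; boundedness of \<open>D\<close> keeps the weight
  integrable.\<close>

lemma nn_integral_injective_holomorphic:
  fixes h :: "complex \<Rightarrow> complex"
  assumes B: "open B" and hol: "h holomorphic_on UNIV" and inj: "inj_on h B"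
    and D: "D \<in> sets borel" "D \<subseteq> B" "bounded D"
  obtains G where "G \<in> borel_measurable borel" and "h ` D \<in> sets borel"
    and "\<And>z. z \<in> D \<Longrightarrow> G (h z) = z"
    and "\<And>F. F \<in> borel_measurable borel \<Longrightarrow>
      (\<integral>\<^sup>+z. indicator D z * (F z * ennreal ((cmod (deriv h z))\<^sup>2)) \<partial>lborel) =
      (\<integral>\<^sup>+w. indicator (h ` D) w * (F (G w) :: ennreal) \<partial>lborel)"
proof -
  note [measurable] = D(1)
  have holB: "h holomorphic_on B" using hol holomorphic_on_subset by blast
  obtain g where g: "g holomorphic_on h ` B" "\<And>z. z \<in> B \<Longrightarrow> g (h z) = z"
    using holomorphic_has_inverse[OF holB B inj] by metis
  have der: "(h has_field_derivative deriv h z) (at z)" for z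
    using holomorphic_derivI[OF hol open_UNIV] by simp
  have conth: "continuous_on UNIV h" by (rule holomorphic_on_imp_continuous_on[OF hol])
  have contd: "continuous_on UNIV (deriv h)"
    using holomorphic_deriv[OF hol open_UNIV] holomorphic_on_imp_continuous_on by blast
  have [measurable]: "h \<in> borel_measurable borel" "deriv h \<in> borel_measurable borel"
    using borel_measurable_continuous_onI conth contd by auto
  have ohB: "open (h ` B)" by (rule open_mapping_thm3[OF holB B inj])
  then have [measurable]: "h ` B \<in> sets borel" by simp
  \<comment> \<open>Outside the open image of \<open>B\<close> the inverse is set to zero, which
    makes \<open>G\<close> Borel on the whole plane.\<close>
  define G where "G = (\<lambda>w. indicator (h ` B) w *\<^sub>R g w)"
  have G[measurable]: "G \<in> borel_measurable borel"
    unfolding G_def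
    by (intro borel_measurable_continuous_on_indicator holomorphic_on_imp_continuous_on g) auto
  have Gh: "G (h z) = z" if "z \<in> B" for z using g(2) that by (simp add: G_def)
  \<comment> \<open>Images of Borel sets are Borel because they are preimages under the measurable
    inverse.\<close>
  have img: "h ` E \<in> sets borel" if E: "E \<in> sets borel" "E \<subseteq> B" for E
  proof -
    have "h ` E = h ` B \<inter> G -` E" using Gh E by force
    moreover have "G -` E \<in> sets borel" using measurable_sets_borel[OF G E(1)] by simp
    ultimately show ?thesis by auto
  qed
  obtain a r where Dr: "D \<subseteq> cball a r" using D(3) bounded_subset_cball by blast
  have ib: "integrable lborel (\<lambda>z. indicator E z * (cmod (deriv h z))\<^sup>2)"
    if E[measurable]: "E \<in> sets borel" "E \<subseteq> D" for E
  proof (rule Bochner_Integration.integrable_bound)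
    have "integrable lborel (\<lambda>z. indicator (cball a r) z *\<^sub>R (cmod (deriv h z))\<^sup>2)"
      by (intro borel_integrable_compact continuous_intros continuous_on_subset[OF contd]) auto
    then show "integrable lborel (\<lambda>z. indicator (cball a r) z * (cmod (deriv h z))\<^sup>2)"
      by simp
    show "(\<lambda>z. indicator E z * (cmod (deriv h z))\<^sup>2) \<in> borel_measurable lborel" by measurable
    show "AE z in lborel. norm (indicator E z * (cmod (deriv h z))\<^sup>2) \<le>
        norm (indicator (cball a r) z * (cmod (deriv h z))\<^sup>2)"
      using Dr E by (intro AE_I2) (auto simp: indicator_def)
  qed
  have hD[measurable]: "h ` D \<in> sets borel" using img D by blast
  define \<mu> where "\<mu> = density lborel (\<lambda>z. indicator D z * ennreal ((cmod (deriv h z))\<^sup>2))"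
  \<comment> \<open>The push-forward of the Jacobian weight on \<open>D\<close> is Lebesgue measure
    on the image of \<open>D\<close>.\<close>
  have distr_eq: "distr \<mu> borel h = density lborel (indicator (h ` D))"
  proof (rule measure_eqI)
    fix X assume "X \<in> sets (distr \<mu> borel h)"
    then have X[measurable]: "X \<in> sets borel" by simp
    have E[measurable]: "D \<inter> h -` X \<in> sets borel"
      using measurable_sets_borel[of h borel, OF _ X] by simp
    have "emeasure (distr \<mu> borel h) X = emeasure \<mu> (h -` X)"
      by (subst emeasure_distr) (auto simp: \<mu>_def)
    also have "\<dots> = (\<integral>\<^sup>+z. (indicator D z * ennreal ((cmod (deriv h z))\<^sup>2)) * indicator (h -` X) z \<partial>lborel)"
      unfolding \<mu>_def using measurable_sets_borel[of h borel, OF _ X] by (subst emeasure_density) auto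
    also have "\<dots> = (\<integral>\<^sup>+z. indicator (D \<inter> h -` X) z * ennreal ((cmod (deriv h z))\<^sup>2) \<partial>lborel)"
      by (intro nn_integral_cong) (auto simp: indicator_def)
    also have "\<dots> = emeasure lborel (h ` (D \<inter> h -` X))"
      by (rule emeasure_holomorphic_image[symmetric])
        (use E D der inj in \<open>auto intro!: ib img intro: inj_on_subset\<close>)
    also have "h ` (D \<inter> h -` X) = h ` D \<inter> X" by auto
    also have "emeasure lborel (h ` D \<inter> X) = emeasure (density lborel (indicator (h ` D))) X"
      by (subst emeasure_density) (auto simp: indicator_inter_arith[symmetric] nn_integral_indicator)
    finally show "emeasure (distr \<mu> borel h) X = emeasure (density lborel (indicator (h ` D))) X" .
  qed simp
  show ?thesis
  proof (rule that[OF G hD])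
    show "G (h z) = z" if "z \<in> D" for z using Gh D that by auto
    fix F :: "complex \<Rightarrow> ennreal" assume F[measurable]: "F \<in> borel_measurable borel"
    have "(\<integral>\<^sup>+z. indicator D z * (F z * ennreal ((cmod (deriv h z))\<^sup>2)) \<partial>lborel) =
      (\<integral>\<^sup>+z. (indicator D z * ennreal ((cmod (deriv h z))\<^sup>2)) * F (G (h z)) \<partial>lborel)"
      using Gh D by (intro nn_integral_cong) (auto simp: indicator_def mult.commute)
    also have "\<dots> = (\<integral>\<^sup>+z. F (G (h z)) \<partial>\<mu>)"
      unfolding \<mu>_def by (subst nn_integral_density) auto
    also have "\<dots> = (\<integral>\<^sup>+w. F (G w) \<partial>distr \<mu> borel h)"
      by (subst nn_integral_distr) (auto simp: \<mu>_def)
    also have "\<dots> = (\<integral>\<^sup>+w. indicator (h ` D) w * F (G w) \<partial>lborel)"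
      unfolding distr_eq by (subst nn_integral_density) auto
    finally show "(\<integral>\<^sup>+z. indicator D z * (F z * ennreal ((cmod (deriv h z))\<^sup>2)) \<partial>lborel) =
      (\<integral>\<^sup>+w. indicator (h ` D) w * (F (G w) :: ennreal) \<partial>lborel)" .
  qed
qed

lemma measurable_poly_complex [measurable]: "poly (p :: complex poly) \<in> borel_measurable borel"
  by (intro borel_measurable_continuous_onI continuous_intros)

text \<open>Away from the finitely many zeros of the derivative the polynomial is locally injective.
  Countably many balls of injectivity, made disjoint, cut the plane into pieces to which the
  injective case applies; the zeros and their images are null sets.\<close>

theorem area_formula_poly:
  fixes h :: "complex poly" and F :: "complex \<Rightarrow> ennreal"
  assumes F[measurable]: "F \<in> borel_measurable borel"
  shows "(\<integral>\<^sup>+w. (\<Sum>z | poly h z = w. F z) \<partial>lborel) =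
    (\<integral>\<^sup>+z. F z * ennreal ((cmod (poly (pderiv h) z))\<^sup>2) \<partial>lborel)"
proof (cases "pderiv h = 0")
  case True
  \<comment> \<open>A constant polynomial has an empty fibre over every other value, so the left
    side vanishes almost everywhere, as does the Jacobian.\<close>
  then obtain c where h: "h = [:c:]" by (metis pderiv_eq_0_iff degree_eq_zeroE)
  have "AE w in lborel. w \<noteq> c" by (rule AE_lborel_singleton)
  then have "(\<integral>\<^sup>+w. (\<Sum>z | poly h z = w. F z) \<partial>lborel) = (\<integral>\<^sup>+w. 0 \<partial>(lborel :: complex measure))"
    by (intro nn_integral_cong_AE) (auto elim!: eventually_mono simp: h infinite_UNIV_char_0)
  then show ?thesis by (simp add: True)
next
  case False
  define C where "C = {z. poly (pderiv h) z = 0}"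
  have finC: "finite C" unfolding C_def by (rule poly_roots_finite[OF False])
  have hol: "poly h holomorphic_on UNIV"
    unfolding holomorphic_on_def field_differentiable_def
    using poly_DERIV has_field_derivative_at_within by blast
  have der: "deriv (poly h) z = poly (pderiv h) z" for z
    by (rule DERIV_imp_deriv[OF poly_DERIV])
  define \<B> where "\<B> = {B. (\<exists>z r. B = ball z r) \<and> inj_on (poly h) B}"
  have "\<And>B. B \<in> \<B> \<Longrightarrow> open B" by (auto simp: \<B>_def)
  then obtain \<B>' where B': "\<B>' \<subseteq> \<B>" "countable \<B>'" "\<Union>\<B>' = \<Union>\<B>"
    using Lindelof[of \<B>] by metis
  have cover: "- C \<subseteq> \<Union>\<B>"
  proof
    fix z assume "z \<in> - C"
    then have "deriv (poly h) z \<noteq> 0" by (simp add: der C_def)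
    then obtain r where "r > 0" "inj_on (poly h) (ball z r)"
      using has_complex_derivative_locally_injective[OF hol UNIV_I open_UNIV] by metis
    then show "z \<in> \<Union>\<B>" unfolding \<B>_def by (auto intro!: exI[of _ "ball z r"])
  qed
  \<comment> \<open>The empty set is a ball of radius zero; it keeps the sequence \<open>B\<close>
    inside the family when the countable subfamily is empty.\<close>
  have "{} \<in> \<B>" by (auto simp: \<B>_def intro!: exI[of _ 0] exI[of _ "0::real"])
  define B where "B = (if \<B>' = {} then (\<lambda>_. {}) else from_nat_into \<B>')"
  have BB: "B k \<in> \<B>" for k
    using B' \<open>{} \<in> \<B>\<close> from_nat_into[of \<B>' k] by (auto simp: B_def)
  have UB: "(\<Union>k. B k) = \<Union>\<B>"
    using B' by (auto simp: B_def range_from_nat_into)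
  define D where "D k = disjointed B k \<inter> - C" for k
  have DB: "D k \<subseteq> B k" for k using disjointed_subset[of B k] by (auto simp: D_def)
  have Bo: "open (B k)" "bounded (B k)" "inj_on (poly h) (B k)" for k
    using BB[of k] by (auto simp: \<B>_def)
  have [measurable]: "B k \<in> sets borel" for k using Bo(1) by simp
  have [measurable]: "C \<in> sets borel" using finC by (simp add: finite_imp_closed)
  have Dm[measurable]: "D k \<in> sets borel" for k
    unfolding D_def disjointed_def by measurable
  have disj: "disjoint_family D"
    using disjoint_family_disjointed[of B] by (auto simp: D_def disjoint_family_on_def)
  have UD: "(\<Union>k. D k) = - C"
    using UN_disjointed_eq[of B] UB cover by (auto simp: D_def)
  define P where "P k G \<longleftrightarrow> G \<in> borel_measurable borel \<and> poly h ` D k \<in> sets borel \<and>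
    (\<forall>z\<in>D k. G (poly h z) = z) \<and>
    (\<forall>F. F \<in> borel_measurable borel \<longrightarrow>
      (\<integral>\<^sup>+z. indicator (D k) z * (F z * ennreal ((cmod (deriv (poly h) z))\<^sup>2)) \<partial>lborel) =
      (\<integral>\<^sup>+w. indicator (poly h ` D k) w * (F (G w) :: ennreal) \<partial>lborel))" for k G
  have "\<exists>G. P k G" for k
    unfolding P_def
    by (rule nn_integral_injective_holomorphic[OF Bo(1)[of k] hol Bo(3)[of k] Dm[of k] DB[of k]
        bounded_subset[OF Bo(2)[of k] DB[of k]]]) (rule exI, intro conjI ballI allI impI)
  then obtain G where G: "\<And>k. P k (G k)" using choice[of P] by blast
  have Gm[measurable]: "G k \<in> borel_measurable borel" for k using G[of k] by (simp add: P_def)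
  have hDm[measurable]: "poly h ` D k \<in> sets borel" for k using G[of k] by (simp add: P_def)
  have Gh: "G k (poly h z) = z" if "z \<in> D k" for k z using G[of k] that by (simp add: P_def)
  have Geq: "(\<integral>\<^sup>+z. indicator (D k) z * (F z * ennreal ((cmod (deriv (poly h) z))\<^sup>2)) \<partial>lborel) =
      (\<integral>\<^sup>+w. indicator (poly h ` D k) w * F (G k w) \<partial>lborel)"
    if "F \<in> borel_measurable borel" for k and F :: "complex \<Rightarrow> ennreal"
    using G[of k] that by (simp add: P_def)
  \<comment> \<open>Outside the critical values every fibre point lies in exactly one piece
    \<open>D k\<close>, and every piece meets the fibre in at most one point.\<close>
  have pre: "(\<Sum>z | poly h z = w. F z) = (\<Sum>k. indicator (poly h ` D k) w * F (G k w))"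
    if w: "w \<notin> poly h ` C" for w
  proof -
    let ?Z = "{z. poly h z = w}"
    have "h - [:w:] \<noteq> 0"
    proof
      assume "h - [:w:] = 0"
      then have "h = [:w:]" by simp
      then show False using False by (simp add: pderiv_pCons)
    qed
    from poly_roots_finite[OF this] have fin: "finite ?Z" by simp
    have ZC: "?Z \<subseteq> - C" using w by auto
    have "(\<Sum>z\<in>?Z. F z) = (\<Sum>z\<in>?Z. \<Sum>k. F z * indicator (D k) z)"
    proof (intro sum.cong refl)
      fix z assume "z \<in> ?Z"
      then obtain k where "z \<in> D k" using ZC UD by auto
      from suminf_cmult_indicator[OF disj this, of "\<lambda>_. F z"]
      show "F z = (\<Sum>k. F z * indicator (D k) z)" by simp
    qed
    also have "\<dots> = (\<Sum>k. \<Sum>z\<in>?Z. F z * indicator (D k) z)"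
      by (rule suminf_sum[symmetric]) simp
    also have "\<dots> = (\<Sum>k. indicator (poly h ` D k) w * F (G k w))"
    proof (intro suminf_cong)
      fix k
      show "(\<Sum>z\<in>?Z. F z * indicator (D k) z) = indicator (poly h ` D k) w * F (G k w)"
      proof (cases "w \<in> poly h ` D k")
        case True
        then obtain z0 where z0: "z0 \<in> D k" "w = poly h z0" by auto
        have "(\<Sum>z\<in>?Z. F z * indicator (D k) z) = (\<Sum>z\<in>{z0}. F z * indicator (D k) z)"
        proof (rule sum.mono_neutral_right[OF fin])
          show "{z0} \<subseteq> ?Z" using z0 by simp
          show "\<forall>z\<in>?Z - {z0}. F z * indicator (D k) z = 0"
          proof
            fix z assume z: "z \<in> ?Z - {z0}"
            have "z \<notin> D k"
            proof
              assume "z \<in> D k"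
              then have "G k (poly h z) = z" by (rule Gh)
              moreover have "poly h z = poly h z0" using z z0(2) by simp
              ultimately have "z = z0" using Gh[OF z0(1)] by argo
              then show False using z by simp
            qed
            then show "F z * indicator (D k) z = 0" by simp
          qed
        qed
        moreover have "G k w = z0" unfolding z0(2) by (rule Gh[OF z0(1)])
        ultimately show ?thesis using True z0(1) by simp
      next
        case False
        then show ?thesis by (auto intro!: sum.neutral simp: indicator_def)
      qed
    qed
    finally show ?thesis .
  qed
  have "finite (poly h ` C)" using finC by simp
  then have AEh: "AE w in lborel. w \<notin> poly h ` C"
    by (intro AE_not_in) (simp add: finite_imp_null_set_lborel)
  have AEC: "AE z in lborel. z \<notin> C"
    by (intro AE_not_in) (simp add: finite_imp_null_set_lborel finC)
  have "(\<integral>\<^sup>+w. (\<Sum>z | poly h z = w. F z) \<partial>lborel) =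
    (\<integral>\<^sup>+w. (\<Sum>k. indicator (poly h ` D k) w * F (G k w)) \<partial>lborel)"
    using AEh by (intro nn_integral_cong_AE) (auto elim!: eventually_mono simp: pre)
  also have "\<dots> = (\<Sum>k. \<integral>\<^sup>+w. indicator (poly h ` D k) w * F (G k w) \<partial>lborel)"
    by (rule nn_integral_suminf) measurable
  also have "\<dots> = (\<Sum>k. \<integral>\<^sup>+z. indicator (D k) z * (F z * ennreal ((cmod (deriv (poly h) z))\<^sup>2)) \<partial>lborel)"
    by (simp add: Geq)
  also have "\<dots> = (\<integral>\<^sup>+z. (\<Sum>k. indicator (D k) z * (F z * ennreal ((cmod (deriv (poly h) z))\<^sup>2))) \<partial>lborel)"
    unfolding der by (rule nn_integral_suminf[symmetric]) measurable
  also have "\<dots> = (\<integral>\<^sup>+z. F z * ennreal ((cmod (poly (pderiv h) z))\<^sup>2) \<partial>lborel)"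
    using AEC
  proof (intro nn_integral_cong_AE, elim eventually_mono)
    fix z assume "z \<notin> C"
    then obtain k where "z \<in> D k" using UD by auto
    from suminf_cmult_indicator[OF disj this, of "\<lambda>_. F z * ennreal ((cmod (deriv (poly h) z))\<^sup>2)"]
    show "(\<Sum>k. indicator (D k) z * (F z * ennreal ((cmod (deriv (poly h) z))\<^sup>2))) =
        F z * ennreal ((cmod (poly (pderiv h) z))\<^sup>2)"
      by (simp add: der mult_ac)
  qed
  finally show ?thesis .
qed

subsection \<open>The standard complex Gaussian\<close>

text \<open>The area formula for a polynomial of degree one, whose fibres are single points.\<close>

lemma nn_integral_complex_affine:
  fixes F :: "complex \<Rightarrow> ennreal"
  assumes [measurable]: "F \<in> borel_measurable borel" and "k \<noteq> 0"
  shows "(\<integral>\<^sup>+w. F w \<partial>lborel) = ennreal ((cmod k)\<^sup>2) * (\<integral>\<^sup>+z. F (c + k * z) \<partial>lborel)"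
proof -
  have "(\<integral>\<^sup>+w. F w \<partial>lborel) = (\<integral>\<^sup>+w. (\<Sum>z | poly [:c, k:] z = w. F (c + k * z)) \<partial>lborel)"
  proof (intro nn_integral_cong)
    fix w
    have "{z. poly [:c, k:] z = w} = {(w - c) / k}"
      using \<open>k \<noteq> 0\<close> by (auto simp: field_simps)
    then show "F w = (\<Sum>z | poly [:c, k:] z = w. F (c + k * z))"
      using \<open>k \<noteq> 0\<close> by simp
  qed
  also have "\<dots> = (\<integral>\<^sup>+z. F (c + k * z) * ennreal ((cmod k)\<^sup>2) \<partial>lborel)"
    by (subst area_formula_poly) (auto simp: pderiv_pCons)
  finally show ?thesis
    by (simp add: nn_integral_multc mult.commute)
qed

lemma emeasure_disc_complex:
  "0 \<le> a \<Longrightarrow> emeasure lborel {z::complex. cmod z \<le> a} = ennreal (pi * a\<^sup>2)"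
  using emeasure_cball[of a "0::complex"]
  by (simp add: cball_def unit_ball_vol_2 ennreal_mult)

text \<open>Discs of squared radius \<open>a\<close> have area \<open>pi * a\<close>, so in the
  variable \<open>|z|^2\<close> polar coordinates have no weight. Half-lines \<open>{..a}\<close>
  are stable under intersection and suffice to compare the two measures.\<close>

lemma nn_integral_cmod_square:
  fixes f :: "real \<Rightarrow> ennreal"
  assumes [measurable]: "f \<in> borel_measurable borel"
  shows "(\<integral>\<^sup>+z. f ((cmod z)\<^sup>2) \<partial>lborel) = ennreal pi * (\<integral>\<^sup>+r. indicator {0..} r * f r \<partial>lborel)"
proof -
  have "distr lborel borel (\<lambda>z. (cmod z)\<^sup>2) = density lborel (\<lambda>r. ennreal pi * indicator {0..} r)"
  proof (rule measure_eqI_generator_eq[where \<Omega>=UNIV and E="range (\<lambda>a::real. {..a})" and A="\<lambda>i. {..real i}"])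
    show "Int_stable (range (\<lambda>a::real. {..a}))"
      by (auto simp: Int_stable_def)
    show "(\<Union>i. {..real i}) = UNIV" using real_arch_simple by auto
    have disc: "emeasure (distr lborel borel (\<lambda>z. (cmod z)\<^sup>2)) {..a} = ennreal (pi * max 0 a)" for a
    proof (cases "a < 0")
      case True
      have "\<not> (cmod z)\<^sup>2 \<le> a" for z
        using True zero_le_power2[of "cmod z"] by linarith
      then have "(\<lambda>z. (cmod z)\<^sup>2) -` {..a} = {}" by auto
      then show ?thesis using True by (simp add: emeasure_distr)
    next
      case False
      then have "(\<lambda>z. (cmod z)\<^sup>2) -` {..a} = {z. cmod z \<le> sqrt a}"
      proof -
        have "(cmod z)\<^sup>2 \<le> a \<longleftrightarrow> cmod z \<le> sqrt a" for z
          using real_sqrt_le_iff[of "(cmod z)\<^sup>2" a] by simp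
        then show ?thesis by auto
      qed
      then show ?thesis using False emeasure_disc_complex[of "sqrt a"] by (simp add: emeasure_distr)
    qed
    show "emeasure (distr lborel borel (\<lambda>z. (cmod z)\<^sup>2)) X =
        emeasure (density lborel (\<lambda>r. ennreal pi * indicator {0..} r)) X"
      if X_range: "X \<in> range (\<lambda>a::real. {..a})" for X
    proof -
      obtain a where X: "X = {..a}" using X_range by auto
      have "emeasure (density lborel (\<lambda>r. ennreal pi * indicator {0..} r)) {..a} =
          (\<integral>\<^sup>+r. ennreal pi * indicator {0..a} r \<partial>lborel)"
        by (subst emeasure_density) (auto intro!: nn_integral_cong simp: indicator_def)
      also have "\<dots> = ennreal (pi * max 0 a)"
        by (subst nn_integral_cmult_indicator) (auto simp: ennreal_mult max_def)
      finally show ?thesis using disc X by simp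
    qed
    show "emeasure (distr lborel borel (\<lambda>z. (cmod z)\<^sup>2)) {..real i} \<noteq> \<infinity>" for i
      by (simp add: disc)
    show "sets (distr lborel borel (\<lambda>z. (cmod z)\<^sup>2)) = sigma_sets UNIV (range (\<lambda>a::real. {..a}))"
      by (simp add: borel_eq_atMost)
    show "sets (density lborel (\<lambda>r. ennreal pi * indicator {0..} r)) = sigma_sets UNIV (range (\<lambda>a::real. {..a}))"
      by (simp add: borel_eq_atMost)
  qed auto
  then have "(\<integral>\<^sup>+z. f ((cmod z)\<^sup>2) \<partial>lborel) = (\<integral>\<^sup>+r. f r \<partial>density lborel (\<lambda>r. ennreal pi * indicator {0..} r))"
    by (subst (asm) eq_commute) (simp add: nn_integral_distr)
  also have "\<dots> = ennreal pi * (\<integral>\<^sup>+r. indicator {0..} r * f r \<partial>lborel)"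
    by (subst nn_integral_density) (auto simp: mult.assoc nn_integral_cmult)
  finally show ?thesis .
qed

definition cgauss :: "complex measure" where
  "cgauss = density lborel (\<lambda>z. ennreal (exp (- (cmod z)\<^sup>2) / pi))"

lemma space_cgauss [simp]: "space cgauss = UNIV"
  and sets_cgauss [simp, measurable_cong]: "sets cgauss = sets borel"
  by (simp_all add: cgauss_def)

lemma nn_integral_cgauss:
  "F \<in> borel_measurable borel \<Longrightarrow>
    (\<integral>\<^sup>+z. F z \<partial>cgauss) = (\<integral>\<^sup>+z. ennreal (exp (- (cmod z)\<^sup>2) / pi) * F z \<partial>lborel)"
  by (simp add: cgauss_def nn_integral_density)

text \<open>The squared modulus of a standard complex Gaussian has the exponential law of mean one;
  the factor \<open>pi\<close> from polar coordinates cancels the normalization.\<close>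

lemma nn_integral_cgauss_radial:
  assumes [measurable]: "f \<in> borel_measurable borel"
  shows "(\<integral>\<^sup>+z. f ((cmod z)\<^sup>2) \<partial>cgauss) = (\<integral>\<^sup>+r. indicator {0..} r * (ennreal (exp (- r)) * f r) \<partial>lborel)"
proof -
  have "(\<integral>\<^sup>+z. f ((cmod z)\<^sup>2) \<partial>cgauss) = ennreal pi *
      (\<integral>\<^sup>+r. indicator {0..} r * (ennreal (exp (- r) / pi) * f r) \<partial>lborel)"
    by (subst nn_integral_cgauss) (auto simp: nn_integral_cmod_square[of "\<lambda>r. ennreal (exp (- r) / pi) * f r"])
  also have "\<dots> = (\<integral>\<^sup>+r. ennreal pi * (indicator {0..} r * (ennreal (exp (- r) / pi) * f r)) \<partial>lborel)"
    by (rule nn_integral_cmult[symmetric]) measurable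
  also have "\<dots> = (\<integral>\<^sup>+r. indicator {0..} r * (ennreal (exp (- r)) * f r) \<partial>lborel)"
  proof (intro nn_integral_cong)
    fix r :: real
    have "ennreal (exp (- r)) = ennreal pi * ennreal (exp (- r) / pi)"
      by (simp add: ennreal_mult[symmetric])
    then show "ennreal pi * (indicator {0..} r * (ennreal (exp (- r) / pi) * f r)) =
        indicator {0..} r * (ennreal (exp (- r)) * f r)"
      by (simp add: mult_ac)
  qed
  finally show ?thesis .
qed

lemma prob_space_cgauss: "prob_space cgauss"
proof
  have "emeasure cgauss (space cgauss) = (\<integral>\<^sup>+z. 1 \<partial>cgauss)" by simp
  also have "\<dots> = (\<integral>\<^sup>+r. indicator {0..} r * (ennreal (exp (- r)) * 1) \<partial>lborel)"
    using nn_integral_cgauss_radial[of "\<lambda>_. 1"] by simp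
  also have "\<dots> = 1"
    using nn_intergal_power_times_exp_Ici[of 0] by (simp add: mult.commute)
  finally show "emeasure cgauss (space cgauss) = 1" .
qed

interpretation cgauss: prob_space cgauss by (rule prob_space_cgauss)
interpretation cgauss2: pair_sigma_finite cgauss cgauss ..

text \<open>Replacing \<open>z\<close> by its negative leaves the Gaussian unchanged, and the
  parallelogram law removes the cross term from the sum of the two integrals. The computation thus
  stays within nonnegative integrals.\<close>

lemma cgauss_second_moment: "(\<integral>\<^sup>+z. ennreal ((cmod (m + k * z))\<^sup>2) \<partial>cgauss) = ennreal ((cmod m)\<^sup>2 + (cmod k)\<^sup>2)"
proof -
  let ?I = "\<lambda>k. \<integral>\<^sup>+z. ennreal ((cmod (m + k * z))\<^sup>2) \<partial>cgauss"
  have sym: "?I (- k) = ?I k"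
    using nn_integral_complex_affine[of "\<lambda>z. ennreal (exp (- (cmod z)\<^sup>2) / pi) * ennreal ((cmod (m + k * z))\<^sup>2)" "- 1" 0]
    by (simp add: nn_integral_cgauss)
  have one: "(\<integral>\<^sup>+z. ennreal ((cmod z)\<^sup>2) \<partial>cgauss) = 1"
  proof -
    have "(\<integral>\<^sup>+z. ennreal ((cmod z)\<^sup>2) \<partial>cgauss) =
        (\<integral>\<^sup>+r. indicator {0..} r * (ennreal (exp (- r)) * ennreal r) \<partial>lborel)"
      by (rule nn_integral_cgauss_radial) measurable
    also have "\<dots> = (\<integral>\<^sup>+r. ennreal (r ^ 1 * exp (- r)) * indicator {0..} r \<partial>lborel)"
      by (intro nn_integral_cong) (auto simp: indicator_def ennreal_mult mult_ac)
    also have "\<dots> = 1" using nn_intergal_power_times_exp_Ici[of 1] by simp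
    finally show ?thesis .
  qed
  have "?I k + ?I (- k) = (\<integral>\<^sup>+z. ennreal ((cmod (m + k * z))\<^sup>2) + ennreal ((cmod (m + (- k) * z))\<^sup>2) \<partial>cgauss)"
    by (rule nn_integral_add[symmetric]) measurable
  also have "\<dots> = (\<integral>\<^sup>+z. ennreal (2 * (cmod m)\<^sup>2) + ennreal (2 * (cmod k)\<^sup>2) * ennreal ((cmod z)\<^sup>2) \<partial>cgauss)"
  proof (intro nn_integral_cong)
    fix z
    have par: "(cmod (m + w))\<^sup>2 + (cmod (m - w))\<^sup>2 = 2 * (cmod m)\<^sup>2 + 2 * (cmod w)\<^sup>2" for w
      unfolding cmod_power2 by (simp add: power2_eq_square algebra_simps)
    have "(cmod (m + k * z))\<^sup>2 + (cmod (m + (- k) * z))\<^sup>2 = 2 * (cmod m)\<^sup>2 + 2 * (cmod k)\<^sup>2 * (cmod z)\<^sup>2"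
      using par[of "k * z"] by (simp add: norm_mult power_mult_distrib)
    then have "ennreal ((cmod (m + k * z))\<^sup>2 + (cmod (m + (- k) * z))\<^sup>2) =
        ennreal (2 * (cmod m)\<^sup>2 + 2 * (cmod k)\<^sup>2 * (cmod z)\<^sup>2)" by (rule arg_cong)
    then show "ennreal ((cmod (m + k * z))\<^sup>2) + ennreal ((cmod (m + (- k) * z))\<^sup>2) =
       ennreal (2 * (cmod m)\<^sup>2) + ennreal (2 * (cmod k)\<^sup>2) * ennreal ((cmod z)\<^sup>2)"
      unfolding ennreal_mult[OF mult_nonneg_nonneg[OF zero_le_numeral zero_le_power2] zero_le_power2, symmetric]
      by (subst (1 2) ennreal_plus[symmetric]) auto
  qed
  also have "\<dots> = ennreal (2 * (cmod m)\<^sup>2) + ennreal (2 * (cmod k)\<^sup>2)"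
    by (subst nn_integral_add) (auto simp: nn_integral_cmult one cgauss.emeasure_space_1[simplified])
  also have "\<dots> = ennreal (2 * (cmod m)\<^sup>2 + 2 * (cmod k)\<^sup>2)"
    by (rule ennreal_plus[symmetric]) auto
  finally have *: "?I k + ?I k = ennreal (2 * (cmod m)\<^sup>2 + 2 * (cmod k)\<^sup>2)"
    unfolding sym .
  show ?thesis
  proof (cases "?I k")
    case (real r)
    then have "ennreal (r + r) = ennreal (2 * (cmod m)\<^sup>2 + 2 * (cmod k)\<^sup>2)"
      using * by (metis ennreal_plus)
    then have "r + r = 2 * (cmod m)\<^sup>2 + 2 * (cmod k)\<^sup>2"
      using real by (subst (asm) ennreal_inj) auto
    then have "r = (cmod m)\<^sup>2 + (cmod k)\<^sup>2" by simp
    then show ?thesis using real by (simp only:)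
  next
    case top
    then have "ennreal (2 * (cmod m)\<^sup>2 + 2 * (cmod k)\<^sup>2) = \<top>" using * by simp
    then show ?thesis using ennreal_neq_top by blast
  qed
qed

section \<open>Unitary rotations and the triangular form of Gaussian functionals\<close>

text \<open>The map is unitary, so it preserves both Lebesgue measure on pairs and the sum of
  squared moduli on which the Gaussian weight depends.\<close>

lemma cgauss_rotate:
  fixes f :: "complex \<times> complex \<Rightarrow> ennreal"
  assumes f[measurable]: "f \<in> borel_measurable borel"
    and cs: "(cmod c)\<^sup>2 + (cmod s)\<^sup>2 = 1"
  shows "(\<integral>\<^sup>+a. \<integral>\<^sup>+b. f (c * b - cnj s * a, s * b + cnj c * a) \<partial>cgauss \<partial>cgauss) =
    (\<integral>\<^sup>+a. \<integral>\<^sup>+b. f (b, a) \<partial>cgauss \<partial>cgauss)"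
proof -
  have f'[measurable]: "f \<in> borel_measurable (borel \<Otimes>\<^sub>M borel)" using f by (simp add: borel_prod)
  \<comment> \<open>Lebesgue invariance comes from one affine substitution in each variable. The
    first divides by \<open>c\<close>, so \<open>c = 0\<close>, where the map is a swap with
    rotations, is treated apart.\<close>
  have leb: "(\<integral>\<^sup>+a. \<integral>\<^sup>+b. g (c * b - cnj s * a, s * b + cnj c * a) \<partial>lborel \<partial>lborel) =
      (\<integral>\<^sup>+a. \<integral>\<^sup>+b. g (b, a) \<partial>lborel \<partial>lborel)"
    if g[measurable]: "g \<in> borel_measurable (borel \<Otimes>\<^sub>M borel)" for g :: "complex \<times> complex \<Rightarrow> ennreal"
  proof (cases "c = 0")
    case True
    then have s: "cmod s = 1" using cs by (simp add: power2_eq_1_iff) (smt (verit) norm_ge_zero)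
    then have s0: "s \<noteq> 0" by auto
    have "(\<integral>\<^sup>+a. \<integral>\<^sup>+b. g (c * b - cnj s * a, s * b + cnj c * a) \<partial>lborel \<partial>lborel) =
        (\<integral>\<^sup>+a. \<integral>\<^sup>+b. g (- cnj s * a, b) \<partial>lborel \<partial>lborel)"
    proof (rule nn_integral_cong)
      fix a
      show "(\<integral>\<^sup>+b. g (c * b - cnj s * a, s * b + cnj c * a) \<partial>lborel) = (\<integral>\<^sup>+b. g (- cnj s * a, b) \<partial>lborel)"
        using nn_integral_complex_affine[of "\<lambda>b. g (- cnj s * a, b)" s 0] s s0 True by simp
    qed
    also have "\<dots> = (\<integral>\<^sup>+b. \<integral>\<^sup>+a. g (- cnj s * a, b) \<partial>lborel \<partial>lborel)"
      by (rule lborel_pair.Fubini') measurable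
    also have "\<dots> = (\<integral>\<^sup>+b. \<integral>\<^sup>+a. g (a, b) \<partial>lborel \<partial>lborel)"
    proof (rule nn_integral_cong)
      fix b
      show "(\<integral>\<^sup>+a. g (- cnj s * a, b) \<partial>lborel) = (\<integral>\<^sup>+a. g (a, b) \<partial>lborel)"
        using nn_integral_complex_affine[of "\<lambda>a. g (a, b)" "- cnj s" 0] s s0 by simp
    qed
    finally show ?thesis .
  next
    case False
    have c0: "ennreal ((cmod c)\<^sup>2) \<noteq> 0" "ennreal ((cmod c)\<^sup>2) \<noteq> \<top>"
      using False by (simp_all add: ennreal_eq_0_iff)
    have cc: "c * cnj c + s * cnj s = 1"
      using arg_cong[OF cs, of complex_of_real] by (simp only: of_real_add complex_norm_square of_real_1)
    \<comment> \<open>The factor \<open>|c|^2\<close> is put in front to be used up by the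
      substitution in \<open>b\<close>; the substitution in \<open>a\<close> returns it, and it
      cancels.\<close>
    have "ennreal ((cmod c)\<^sup>2) * (\<integral>\<^sup>+a. \<integral>\<^sup>+b. g (c * b - cnj s * a, s * b + cnj c * a) \<partial>lborel \<partial>lborel) =
        (\<integral>\<^sup>+a. ennreal ((cmod c)\<^sup>2) * (\<integral>\<^sup>+b. g (c * b - cnj s * a, s * b + cnj c * a) \<partial>lborel) \<partial>lborel)"
      by (rule nn_integral_cmult[symmetric]) measurable
    also have "\<dots> = (\<integral>\<^sup>+a. \<integral>\<^sup>+b. g (b, (s * b + a) / c) \<partial>lborel \<partial>lborel)"
    proof (rule nn_integral_cong)
      fix a
      have "(s * (c * b - cnj s * a) + a) / c = s * b + cnj c * a" for b
      proof -
        have "s * (c * b - cnj s * a) + a = c * (s * b) + (1 - s * cnj s) * a" by (simp add: algebra_simps)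
        also have "1 - s * cnj s = c * cnj c" using cc by (simp add: algebra_simps)
        finally show ?thesis using False by (simp add: field_simps)
      qed
      then show "ennreal ((cmod c)\<^sup>2) * (\<integral>\<^sup>+b. g (c * b - cnj s * a, s * b + cnj c * a) \<partial>lborel) =
          (\<integral>\<^sup>+b. g (b, (s * b + a) / c) \<partial>lborel)"
        using nn_integral_complex_affine[of "\<lambda>b. g (b, (s * b + a) / c)" c "- cnj s * a"] False
        by (simp add: add.commute)
    qed
    also have "\<dots> = (\<integral>\<^sup>+b. \<integral>\<^sup>+a. g (b, (s * b + a) / c) \<partial>lborel \<partial>lborel)"
      by (rule lborel_pair.Fubini') measurable
    also have "\<dots> = (\<integral>\<^sup>+b. ennreal ((cmod c)\<^sup>2) * (\<integral>\<^sup>+a. g (b, a) \<partial>lborel) \<partial>lborel)"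
    proof (rule nn_integral_cong)
      fix b
      have "ennreal ((cmod c)\<^sup>2) * (\<integral>\<^sup>+a. g (b, a) \<partial>lborel) =
          ennreal ((cmod c)\<^sup>2) * (ennreal ((cmod (1 / c))\<^sup>2) * (\<integral>\<^sup>+a. g (b, s * b / c + 1 / c * a) \<partial>lborel))"
        using nn_integral_complex_affine[of "\<lambda>a. g (b, a)" "1 / c" "s * b / c"] False by simp
      also have "\<dots> = (\<integral>\<^sup>+a. g (b, s * b / c + 1 / c * a) \<partial>lborel)"
        using False by (simp add: mult.assoc[symmetric] ennreal_mult[symmetric] norm_divide power_divide)
      finally show "(\<integral>\<^sup>+a. g (b, (s * b + a) / c) \<partial>lborel) = ennreal ((cmod c)\<^sup>2) * (\<integral>\<^sup>+a. g (b, a) \<partial>lborel)"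
        by (simp add: add_divide_distrib)
    qed
    also have "\<dots> = ennreal ((cmod c)\<^sup>2) * (\<integral>\<^sup>+b. \<integral>\<^sup>+a. g (b, a) \<partial>lborel \<partial>lborel)"
      by (rule nn_integral_cmult) measurable
    also have "(\<integral>\<^sup>+b. \<integral>\<^sup>+a. g (b, a) \<partial>lborel \<partial>lborel) = (\<integral>\<^sup>+a. \<integral>\<^sup>+b. g (b, a) \<partial>lborel \<partial>lborel)"
      by (rule lborel_pair.Fubini') measurable
    finally show ?thesis
      using c0 by (simp add: ennreal_mult_cancel_left)
  qed
  define w where "w x y = exp (- ((cmod x)\<^sup>2 + (cmod y)\<^sup>2)) / pi\<^sup>2" for x y :: complex
  have dens: "(\<integral>\<^sup>+a. \<integral>\<^sup>+b. g b a \<partial>cgauss \<partial>cgauss) = (\<integral>\<^sup>+a. \<integral>\<^sup>+b. ennreal (w b a) * g b a \<partial>lborel \<partial>lborel)"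
    if g[measurable]: "case_prod g \<in> borel_measurable (borel \<Otimes>\<^sub>M borel)" for g :: "complex \<Rightarrow> complex \<Rightarrow> ennreal"
  proof -
    have "(\<integral>\<^sup>+a. \<integral>\<^sup>+b. g b a \<partial>cgauss \<partial>cgauss) = (\<integral>\<^sup>+a. ennreal (exp (- (cmod a)\<^sup>2) / pi) *
        (\<integral>\<^sup>+b. ennreal (exp (- (cmod b)\<^sup>2) / pi) * g b a \<partial>lborel) \<partial>lborel)"
      by (subst nn_integral_cgauss) (auto intro!: nn_integral_cong simp: nn_integral_cgauss)
    also have "\<dots> = (\<integral>\<^sup>+a. \<integral>\<^sup>+b. ennreal (w b a) * g b a \<partial>lborel \<partial>lborel)"
    proof (rule nn_integral_cong)
      fix a :: complex
      have "ennreal (w b a) = ennreal (exp (- (cmod a)\<^sup>2) / pi) * ennreal (exp (- (cmod b)\<^sup>2) / pi)" for b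
        by (simp add: w_def ennreal_mult[symmetric] power2_eq_square exp_add exp_diff exp_minus divide_simps)
      then show "ennreal (exp (- (cmod a)\<^sup>2) / pi) *
          (\<integral>\<^sup>+b. ennreal (exp (- (cmod b)\<^sup>2) / pi) * g b a \<partial>lborel) = (\<integral>\<^sup>+b. ennreal (w b a) * g b a \<partial>lborel)"
        by (subst nn_integral_cmult[symmetric]) (auto simp: mult.assoc)
    qed
    finally show ?thesis .
  qed
  have w_inv: "w (c * b - cnj s * a) (s * b + cnj c * a) = w b a" for a b
  proof -
    have "(cmod (c * b - cnj s * a))\<^sup>2 + (cmod (s * b + cnj c * a))\<^sup>2 =
       ((cmod c)\<^sup>2 + (cmod s)\<^sup>2) * ((cmod b)\<^sup>2 + (cmod a)\<^sup>2)"
      unfolding cmod_power2 by (simp add: power2_eq_square) (simp add: algebra_simps)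
    then show ?thesis by (simp add: w_def cs)
  qed
  have wm[measurable]: "(\<lambda>x. w (fst x) (snd x)) \<in> borel_measurable (borel \<Otimes>\<^sub>M borel)"
    unfolding w_def by measurable
  have "(\<integral>\<^sup>+a. \<integral>\<^sup>+b. f (c * b - cnj s * a, s * b + cnj c * a) \<partial>cgauss \<partial>cgauss) =
     (\<integral>\<^sup>+a. \<integral>\<^sup>+b. ennreal (w (c * b - cnj s * a) (s * b + cnj c * a)) *
        f (c * b - cnj s * a, s * b + cnj c * a) \<partial>lborel \<partial>lborel)"
    by (subst dens) (auto simp: w_inv)
  also have "\<dots> = (\<integral>\<^sup>+a. \<integral>\<^sup>+b. ennreal (w b a) * f (b, a) \<partial>lborel \<partial>lborel)"
    using leb[of "\<lambda>x. ennreal (w (fst x) (snd x)) * f x"] by simp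
  also have "\<dots> = (\<integral>\<^sup>+a. \<integral>\<^sup>+b. f (b, a) \<partial>cgauss \<partial>cgauss)"
    by (subst dens) auto
  finally show ?thesis .
qed

text \<open>After the rotation a functional with coefficients \<open>p\<close>, \<open>q\<close> has
  coefficient \<open>q * cnj c - p * cnj s\<close> on the second variable. The normalized conjugates
  of \<open>p\<close> and \<open>q\<close> make it vanish.\<close>

lemma givens_exists:
  fixes p q :: complex
  obtains c s where "(cmod c)\<^sup>2 + (cmod s)\<^sup>2 = 1" "q * cnj c = p * cnj s"
proof (cases "p = 0 \<and> q = 0")
  case True
  then show ?thesis using that[of 1 0] by simp
next
  case False
  define \<rho> where "\<rho> = sqrt ((cmod p)\<^sup>2 + (cmod q)\<^sup>2)"
  have pos: "(cmod p)\<^sup>2 + (cmod q)\<^sup>2 > 0"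
    using False by (auto simp: add_pos_nonneg add_nonneg_pos)
  then have "\<rho> > 0" "\<rho>\<^sup>2 = (cmod p)\<^sup>2 + (cmod q)\<^sup>2" by (simp_all add: \<rho>_def)
  then have "(cmod (cnj p / of_real \<rho>))\<^sup>2 + (cmod (cnj q / of_real \<rho>))\<^sup>2 = 1"
    using pos False by (simp add: norm_divide power_divide add_divide_distrib[symmetric] del: sum_power2_gt_zero_iff)
  then show ?thesis using that[of "cnj p / of_real \<rho>" "cnj q / of_real \<rho>"] by simp
qed

text \<open>The factors are the rotated coefficients of two functionals, and a unitary map preserves
  Hermitian inner products.\<close>

lemma givens_gram:
  fixes c s :: complex
  assumes "(cmod c)\<^sup>2 + (cmod s)\<^sup>2 = 1"
  shows "cnj (p * c + q * s) * (p' * c + q' * s) + cnj (q * cnj c - p * cnj s) * (q' * cnj c - p' * cnj s) =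
    cnj p * p' + cnj q * q'"
proof -
  have cc: "c * cnj c + s * cnj s = 1"
    using arg_cong[OF assms, of complex_of_real] by (simp only: of_real_add complex_norm_square of_real_1)
  have "cnj (p * c + q * s) * (p' * c + q' * s) + cnj (q * cnj c - p * cnj s) * (q' * cnj c - p' * cnj s) =
    (cnj p * p' + cnj q * q') * (c * cnj c + s * cnj s)"
    by (simp add: algebra_simps)
  then show ?thesis by (simp add: cc)
qed

text \<open>The vectors \<open>(\<alpha>, 0, 0)\<close>, \<open>(\<beta>, \<delta>, 0)\<close>, \<open>(\<epsilon>, \<zeta>, \<kappa>)\<close> have the given Hermitian inner products.\<close>

definition tri_gram where
  "tri_gram \<alpha> \<beta> \<delta> \<epsilon> \<zeta> \<kappa> hh hl ht ll lt tt \<longleftrightarrow>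
    cnj \<alpha> * \<alpha> = hh \<and> cnj \<alpha> * \<beta> = hl \<and> cnj \<alpha> * \<epsilon> = ht \<and>
    cnj \<beta> * \<beta> + cnj \<delta> * \<delta> = ll \<and> cnj \<beta> * \<epsilon> + cnj \<delta> * \<zeta> = lt \<and>
    cnj \<epsilon> * \<epsilon> + cnj \<zeta> * \<zeta> + cnj \<kappa> * \<kappa> = tt"

text \<open>A further variable \<open>a\<close> enters with coefficients \<open>h\<close>,
  \<open>l\<close>, \<open>t\<close>. Rotating it against \<open>b\<close>, then \<open>c\<close>,
  then \<open>d\<close> removes it from the first, the second and the third functional in turn,
  after which it integrates out. Rotations preserve the Gram matrix, which therefore grows by
  exactly the products of \<open>h\<close>, \<open>l\<close>, \<open>t\<close>.\<close>

lemma cgauss_triangular_step: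
  shows "\<exists>\<alpha>' \<beta>' \<delta>' \<epsilon>' \<zeta>' \<kappa>'.
    (\<forall>f :: complex \<times> complex \<times> complex \<Rightarrow> ennreal. f \<in> borel_measurable borel \<longrightarrow>
      (\<integral>\<^sup>+a. \<integral>\<^sup>+b. \<integral>\<^sup>+c. \<integral>\<^sup>+d. f (\<alpha> * b + h * a, \<beta> * b + \<delta> * c + l * a, \<epsilon> * b + \<zeta> * c + \<kappa> * d + t * a)
        \<partial>cgauss \<partial>cgauss \<partial>cgauss \<partial>cgauss) =
      (\<integral>\<^sup>+b. \<integral>\<^sup>+c. \<integral>\<^sup>+d. f (\<alpha>' * b, \<beta>' * b + \<delta>' * c, \<epsilon>' * b + \<zeta>' * c + \<kappa>' * d)
        \<partial>cgauss \<partial>cgauss \<partial>cgauss)) \<and>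
    tri_gram \<alpha>' \<beta>' \<delta>' \<epsilon>' \<zeta>' \<kappa>' (cnj \<alpha> * \<alpha> + cnj h * h) (cnj \<alpha> * \<beta> + cnj h * l)
      (cnj \<alpha> * \<epsilon> + cnj h * t) (cnj \<beta> * \<beta> + cnj \<delta> * \<delta> + cnj l * l)
      (cnj \<beta> * \<epsilon> + cnj \<delta> * \<zeta> + cnj l * t) (cnj \<epsilon> * \<epsilon> + cnj \<zeta> * \<zeta> + cnj \<kappa> * \<kappa> + cnj t * t)"
proof -
  obtain c1 s1 where r1: "(cmod c1)\<^sup>2 + (cmod s1)\<^sup>2 = 1" "h * cnj c1 = \<alpha> * cnj s1"
    by (rule givens_exists)
  define \<alpha>' \<beta>' \<epsilon>' l1 t1 where
    "\<alpha>' = \<alpha> * c1 + h * s1" and "\<beta>' = \<beta> * c1 + l * s1" and "\<epsilon>' = \<epsilon> * c1 + t * s1"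
    and "l1 = l * cnj c1 - \<beta> * cnj s1" and "t1 = t * cnj c1 - \<epsilon> * cnj s1"
  note defs1 = this
  obtain c2 s2 where r2: "(cmod c2)\<^sup>2 + (cmod s2)\<^sup>2 = 1" "l1 * cnj c2 = \<delta> * cnj s2"
    by (rule givens_exists)
  define \<delta>' \<zeta>' t2 where
    "\<delta>' = \<delta> * c2 + l1 * s2" and "\<zeta>' = \<zeta> * c2 + t1 * s2" and "t2 = t1 * cnj c2 - \<zeta> * cnj s2"
  note defs2 = this
  obtain c3 s3 where r3: "(cmod c3)\<^sup>2 + (cmod s3)\<^sup>2 = 1" "t2 * cnj c3 = \<kappa> * cnj s3"
    by (rule givens_exists)
  define \<kappa>' where "\<kappa>' = \<kappa> * c3 + t2 * s3"
  show ?thesis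
  proof (rule exI[of _ \<alpha>'], rule exI[of _ \<beta>'], rule exI[of _ \<delta>'], rule exI[of _ \<epsilon>'],
      rule exI[of _ \<zeta>'], rule exI[of _ \<kappa>'], intro conjI allI impI)
    fix f :: "complex \<times> complex \<times> complex \<Rightarrow> ennreal"
    assume "f \<in> borel_measurable borel"
    then have [measurable]: "f \<in> borel_measurable (borel \<Otimes>\<^sub>M borel \<Otimes>\<^sub>M borel)"
      by (simp add: borel_prod)
    have "(\<integral>\<^sup>+a. \<integral>\<^sup>+b. \<integral>\<^sup>+c. \<integral>\<^sup>+d. f (\<alpha> * b + h * a, \<beta> * b + \<delta> * c + l * a, \<epsilon> * b + \<zeta> * c + \<kappa> * d + t * a)
        \<partial>cgauss \<partial>cgauss \<partial>cgauss \<partial>cgauss) =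
      (\<integral>\<^sup>+a. \<integral>\<^sup>+b. (\<lambda>(b, a). \<integral>\<^sup>+c. \<integral>\<^sup>+d. f (\<alpha> * b + h * a, \<beta> * b + \<delta> * c + l * a, \<epsilon> * b + \<zeta> * c + \<kappa> * d + t * a)
        \<partial>cgauss \<partial>cgauss) (c1 * b - cnj s1 * a, s1 * b + cnj c1 * a) \<partial>cgauss \<partial>cgauss)"
      by (subst cgauss_rotate[OF _ r1(1)]) (auto simp: borel_prod[symmetric])
    also have "\<dots> = (\<integral>\<^sup>+a. \<integral>\<^sup>+b. \<integral>\<^sup>+c. \<integral>\<^sup>+d. f (\<alpha>' * b, \<beta>' * b + \<delta> * c + l1 * a, \<epsilon>' * b + \<zeta> * c + \<kappa> * d + t1 * a)
        \<partial>cgauss \<partial>cgauss \<partial>cgauss \<partial>cgauss)"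
    proof -
      have "\<alpha> * (c1 * b - cnj s1 * a) + h * (s1 * b + cnj c1 * a) = \<alpha>' * b" for a b
        using r1(2) by (simp add: defs1 algebra_simps)
      moreover have "\<beta> * (c1 * b - cnj s1 * a) + \<delta> * c + l * (s1 * b + cnj c1 * a) = \<beta>' * b + \<delta> * c + l1 * a" for a b c
        by (simp add: defs1 algebra_simps)
      moreover have "\<epsilon> * (c1 * b - cnj s1 * a) + \<zeta> * c + \<kappa> * d + t * (s1 * b + cnj c1 * a) =
          \<epsilon>' * b + \<zeta> * c + \<kappa> * d + t1 * a" for a b c d
        by (simp add: defs1 algebra_simps)
      ultimately show ?thesis by (simp only: prod.case)
    qed
    \<comment> \<open>The variable \<open>a\<close> is moved inward, next to \<open>c\<close>, so
      that the second rotation acts on neighbouring integrals.\<close>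
    also have "\<dots> = (\<integral>\<^sup>+b. \<integral>\<^sup>+a. \<integral>\<^sup>+c. \<integral>\<^sup>+d. f (\<alpha>' * b, \<beta>' * b + \<delta> * c + l1 * a, \<epsilon>' * b + \<zeta> * c + \<kappa> * d + t1 * a)
        \<partial>cgauss \<partial>cgauss \<partial>cgauss \<partial>cgauss)"
      by (rule cgauss2.Fubini') measurable
    also have "\<dots> = (\<integral>\<^sup>+b. \<integral>\<^sup>+a. \<integral>\<^sup>+c. (\<lambda>(c, a). \<integral>\<^sup>+d. f (\<alpha>' * b, \<beta>' * b + \<delta> * c + l1 * a, \<epsilon>' * b + \<zeta> * c + \<kappa> * d + t1 * a)
        \<partial>cgauss) (c2 * c - cnj s2 * a, s2 * c + cnj c2 * a) \<partial>cgauss \<partial>cgauss \<partial>cgauss)"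
      by (subst cgauss_rotate[OF _ r2(1)]) (auto simp: borel_prod[symmetric])
    also have "\<dots> = (\<integral>\<^sup>+b. \<integral>\<^sup>+a. \<integral>\<^sup>+c. \<integral>\<^sup>+d. f (\<alpha>' * b, \<beta>' * b + \<delta>' * c, \<epsilon>' * b + \<zeta>' * c + \<kappa> * d + t2 * a)
        \<partial>cgauss \<partial>cgauss \<partial>cgauss \<partial>cgauss)"
    proof -
      have "\<beta>' * b + \<delta> * (c2 * c - cnj s2 * a) + l1 * (s2 * c + cnj c2 * a) = \<beta>' * b + \<delta>' * c" for a b c
        using r2(2) by (simp add: defs2 algebra_simps)
      moreover have "\<epsilon>' * b + \<zeta> * (c2 * c - cnj s2 * a) + \<kappa> * d + t1 * (s2 * c + cnj c2 * a) =
          \<epsilon>' * b + \<zeta>' * c + \<kappa> * d + t2 * a" for a b c d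
        by (simp add: defs2 algebra_simps)
      ultimately show ?thesis by (simp only: prod.case)
    qed
    also have "\<dots> = (\<integral>\<^sup>+b. \<integral>\<^sup>+c. \<integral>\<^sup>+a. \<integral>\<^sup>+d. f (\<alpha>' * b, \<beta>' * b + \<delta>' * c, \<epsilon>' * b + \<zeta>' * c + \<kappa> * d + t2 * a)
        \<partial>cgauss \<partial>cgauss \<partial>cgauss \<partial>cgauss)"
      by (rule nn_integral_cong, rule cgauss2.Fubini') measurable
    also have "\<dots> = (\<integral>\<^sup>+b. \<integral>\<^sup>+c. \<integral>\<^sup>+a. \<integral>\<^sup>+d. (\<lambda>(d, a). f (\<alpha>' * b, \<beta>' * b + \<delta>' * c, \<epsilon>' * b + \<zeta>' * c + \<kappa> * d + t2 * a))
        (c3 * d - cnj s3 * a, s3 * d + cnj c3 * a) \<partial>cgauss \<partial>cgauss \<partial>cgauss \<partial>cgauss)"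
      by (subst cgauss_rotate[OF _ r3(1)]) (auto simp: borel_prod[symmetric])
    also have "\<dots> = (\<integral>\<^sup>+b. \<integral>\<^sup>+c. \<integral>\<^sup>+a. \<integral>\<^sup>+d. f (\<alpha>' * b, \<beta>' * b + \<delta>' * c, \<epsilon>' * b + \<zeta>' * c + \<kappa>' * d)
        \<partial>cgauss \<partial>cgauss \<partial>cgauss \<partial>cgauss)"
    proof -
      have "\<epsilon>' * b + \<zeta>' * c + \<kappa> * (c3 * d - cnj s3 * a) + t2 * (s3 * d + cnj c3 * a) =
          \<epsilon>' * b + \<zeta>' * c + \<kappa>' * d" for a b c d
        using r3(2) by (simp add: \<kappa>'_def algebra_simps)
      then show ?thesis by (simp only: prod.case)
    qed
    \<comment> \<open>Nothing depends on \<open>a\<close> any more, and its law has total mass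
      one.\<close>
    also have "\<dots> = (\<integral>\<^sup>+b. \<integral>\<^sup>+c. \<integral>\<^sup>+d. f (\<alpha>' * b, \<beta>' * b + \<delta>' * c, \<epsilon>' * b + \<zeta>' * c + \<kappa>' * d)
        \<partial>cgauss \<partial>cgauss \<partial>cgauss)"
      by (simp add: cgauss.emeasure_space_1[simplified])
    finally show "(\<integral>\<^sup>+a. \<integral>\<^sup>+b. \<integral>\<^sup>+c. \<integral>\<^sup>+d. f (\<alpha> * b + h * a, \<beta> * b + \<delta> * c + l * a, \<epsilon> * b + \<zeta> * c + \<kappa> * d + t * a)
        \<partial>cgauss \<partial>cgauss \<partial>cgauss \<partial>cgauss) =
      (\<integral>\<^sup>+b. \<integral>\<^sup>+c. \<integral>\<^sup>+d. f (\<alpha>' * b, \<beta>' * b + \<delta>' * c, \<epsilon>' * b + \<zeta>' * c + \<kappa>' * d)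
        \<partial>cgauss \<partial>cgauss \<partial>cgauss)" .
  next
    \<comment> \<open>The eliminated coefficients are zero, so the second summand drops out of the
      Gram identities that involve them.\<close>
    have h0: "h * cnj c1 - \<alpha> * cnj s1 = 0" "l1 * cnj c2 - \<delta> * cnj s2 = 0" "t2 * cnj c3 - \<kappa> * cnj s3 = 0"
      using r1(2) r2(2) r3(2) by simp_all
    note g1 = givens_gram[OF r1(1)] and g2 = givens_gram[OF r2(1)] and g3 = givens_gram[OF r3(1)]
    have hh: "cnj \<alpha>' * \<alpha>' = cnj \<alpha> * \<alpha> + cnj h * h"
      using g1[of \<alpha> h \<alpha> h] unfolding h0 by (simp add: defs1)
    have hl: "cnj \<alpha>' * \<beta>' = cnj \<alpha> * \<beta> + cnj h * l"
      using g1[of \<alpha> h \<beta> l] unfolding h0 by (simp add: defs1)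
    have ht: "cnj \<alpha>' * \<epsilon>' = cnj \<alpha> * \<epsilon> + cnj h * t"
      using g1[of \<alpha> h \<epsilon> t] unfolding h0 by (simp add: defs1)
    have ll1: "cnj \<beta>' * \<beta>' + cnj l1 * l1 = cnj \<beta> * \<beta> + cnj l * l"
      using g1[of \<beta> l \<beta> l] unfolding defs1 .
    have lt1: "cnj \<beta>' * \<epsilon>' + cnj l1 * t1 = cnj \<beta> * \<epsilon> + cnj l * t"
      using g1[of \<beta> l \<epsilon> t] unfolding defs1 .
    have tt1: "cnj \<epsilon>' * \<epsilon>' + cnj t1 * t1 = cnj \<epsilon> * \<epsilon> + cnj t * t"
      using g1[of \<epsilon> t \<epsilon> t] unfolding defs1 .
    have ll2: "cnj \<delta>' * \<delta>' = cnj \<delta> * \<delta> + cnj l1 * l1"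
      using g2[of \<delta> l1 \<delta> l1] unfolding h0 by (simp add: defs2)
    have lt2: "cnj \<delta>' * \<zeta>' = cnj \<delta> * \<zeta> + cnj l1 * t1"
      using g2[of \<delta> l1 \<zeta> t1] unfolding h0 by (simp add: defs2)
    have tt2: "cnj \<zeta>' * \<zeta>' + cnj t2 * t2 = cnj \<zeta> * \<zeta> + cnj t1 * t1"
      using g2[of \<zeta> t1 \<zeta> t1] unfolding defs2 .
    have tt3: "cnj \<kappa>' * \<kappa>' = cnj \<kappa> * \<kappa> + cnj t2 * t2"
      using g3[of \<kappa> t2 \<kappa> t2] unfolding h0 by (simp add: \<kappa>'_def)
    have ll: "cnj \<beta>' * \<beta>' + cnj \<delta>' * \<delta>' = cnj \<beta> * \<beta> + cnj \<delta> * \<delta> + cnj l * l"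
      unfolding ll2 using ll1 by (simp add: algebra_simps)
    have lt: "cnj \<beta>' * \<epsilon>' + cnj \<delta>' * \<zeta>' = cnj \<beta> * \<epsilon> + cnj \<delta> * \<zeta> + cnj l * t"
      unfolding lt2 using lt1 by (simp add: algebra_simps)
    have tt: "cnj \<epsilon>' * \<epsilon>' + cnj \<zeta>' * \<zeta>' + cnj \<kappa>' * \<kappa>' = cnj \<epsilon> * \<epsilon> + cnj \<zeta> * \<zeta> + cnj \<kappa> * \<kappa> + cnj t * t"
      unfolding tt3 using tt1 tt2 by (simp add: algebra_simps)
    show "tri_gram \<alpha>' \<beta>' \<delta>' \<epsilon>' \<zeta>' \<kappa>' (cnj \<alpha> * \<alpha> + cnj h * h) (cnj \<alpha> * \<beta> + cnj h * l)
      (cnj \<alpha> * \<epsilon> + cnj h * t) (cnj \<beta> * \<beta> + cnj \<delta> * \<delta> + cnj l * l)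
      (cnj \<beta> * \<epsilon> + cnj \<delta> * \<zeta> + cnj l * t) (cnj \<epsilon> * \<epsilon> + cnj \<zeta> * \<zeta> + cnj \<kappa> * \<kappa> + cnj t * t)"
      unfolding tri_gram_def using hh hl ht ll lt tt by simp
  qed
qed

interpretation cgauss_product: product_sigma_finite "\<lambda>_ :: nat. cgauss"
  by standard

text \<open>Induction on the index set, one variable at a time. This is a QR decomposition of the
  three coefficient vectors that also covers linearly dependent ones. Only the Gram matrix of the
  triangular form is recorded, because the integral evaluated later depends on nothing else.\<close>

lemma cgauss_triangular:
  fixes I :: "nat set"
  assumes "finite I"
  shows "\<exists>\<alpha> \<beta> \<delta> \<epsilon> \<zeta> \<kappa>.
    (\<forall>f :: complex \<times> complex \<times> complex \<Rightarrow> ennreal. f \<in> borel_measurable borel \<longrightarrow>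
      (\<integral>\<^sup>+x. f (\<Sum>j\<in>I. h j * x j, \<Sum>j\<in>I. l j * x j, \<Sum>j\<in>I. t j * x j) \<partial>Pi\<^sub>M I (\<lambda>_. cgauss)) =
      (\<integral>\<^sup>+b. \<integral>\<^sup>+c. \<integral>\<^sup>+d. f (\<alpha> * b, \<beta> * b + \<delta> * c, \<epsilon> * b + \<zeta> * c + \<kappa> * d)
        \<partial>cgauss \<partial>cgauss \<partial>cgauss)) \<and>
    tri_gram \<alpha> \<beta> \<delta> \<epsilon> \<zeta> \<kappa> (\<Sum>j\<in>I. cnj (h j) * h j) (\<Sum>j\<in>I. cnj (h j) * l j) (\<Sum>j\<in>I. cnj (h j) * t j)
      (\<Sum>j\<in>I. cnj (l j) * l j) (\<Sum>j\<in>I. cnj (l j) * t j) (\<Sum>j\<in>I. cnj (t j) * t j)"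
  using assms
proof (induction I rule: finite_induct)
  case empty
  show ?case
    by (intro exI[of _ 0] conjI)
      (auto simp: tri_gram_def PiM_empty nn_integral_count_space_finite cgauss.emeasure_space_1[simplified])
next
  case (insert i I)
  then obtain \<alpha> \<beta> \<delta> \<epsilon> \<zeta> \<kappa> where IH: "\<And>f :: complex \<times> complex \<times> complex \<Rightarrow> ennreal. f \<in> borel_measurable borel \<Longrightarrow>
      (\<integral>\<^sup>+x. f (\<Sum>j\<in>I. h j * x j, \<Sum>j\<in>I. l j * x j, \<Sum>j\<in>I. t j * x j) \<partial>Pi\<^sub>M I (\<lambda>_. cgauss)) =
      (\<integral>\<^sup>+b. \<integral>\<^sup>+c. \<integral>\<^sup>+d. f (\<alpha> * b, \<beta> * b + \<delta> * c, \<epsilon> * b + \<zeta> * c + \<kappa> * d)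
        \<partial>cgauss \<partial>cgauss \<partial>cgauss)"
    and gram: "tri_gram \<alpha> \<beta> \<delta> \<epsilon> \<zeta> \<kappa> (\<Sum>j\<in>I. cnj (h j) * h j) (\<Sum>j\<in>I. cnj (h j) * l j) (\<Sum>j\<in>I. cnj (h j) * t j)
      (\<Sum>j\<in>I. cnj (l j) * l j) (\<Sum>j\<in>I. cnj (l j) * t j) (\<Sum>j\<in>I. cnj (t j) * t j)"
    by blast
  obtain \<alpha>' \<beta>' \<delta>' \<epsilon>' \<zeta>' \<kappa>' where step:
    "\<And>f :: complex \<times> complex \<times> complex \<Rightarrow> ennreal. f \<in> borel_measurable borel \<Longrightarrow>
      (\<integral>\<^sup>+a. \<integral>\<^sup>+b. \<integral>\<^sup>+c. \<integral>\<^sup>+d. f (\<alpha> * b + h i * a, \<beta> * b + \<delta> * c + l i * a, \<epsilon> * b + \<zeta> * c + \<kappa> * d + t i * a)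
        \<partial>cgauss \<partial>cgauss \<partial>cgauss \<partial>cgauss) =
      (\<integral>\<^sup>+b. \<integral>\<^sup>+c. \<integral>\<^sup>+d. f (\<alpha>' * b, \<beta>' * b + \<delta>' * c, \<epsilon>' * b + \<zeta>' * c + \<kappa>' * d)
        \<partial>cgauss \<partial>cgauss \<partial>cgauss)"
    and gram': "tri_gram \<alpha>' \<beta>' \<delta>' \<epsilon>' \<zeta>' \<kappa>' (cnj \<alpha> * \<alpha> + cnj (h i) * h i) (cnj \<alpha> * \<beta> + cnj (h i) * l i)
      (cnj \<alpha> * \<epsilon> + cnj (h i) * t i) (cnj \<beta> * \<beta> + cnj \<delta> * \<delta> + cnj (l i) * l i)
      (cnj \<beta> * \<epsilon> + cnj \<delta> * \<zeta> + cnj (l i) * t i) (cnj \<epsilon> * \<epsilon> + cnj \<zeta> * \<zeta> + cnj \<kappa> * \<kappa> + cnj (t i) * t i)"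
    using cgauss_triangular_step[of \<alpha> "h i" \<beta> \<delta> "l i" \<epsilon> \<zeta> \<kappa> "t i"] by blast
  have "(\<integral>\<^sup>+x. f (\<Sum>j\<in>insert i I. h j * x j, \<Sum>j\<in>insert i I. l j * x j, \<Sum>j\<in>insert i I. t j * x j)
          \<partial>Pi\<^sub>M (insert i I) (\<lambda>_. cgauss)) =
      (\<integral>\<^sup>+b. \<integral>\<^sup>+c. \<integral>\<^sup>+d. f (\<alpha>' * b, \<beta>' * b + \<delta>' * c, \<epsilon>' * b + \<zeta>' * c + \<kappa>' * d)
        \<partial>cgauss \<partial>cgauss \<partial>cgauss)"
    if f: "f \<in> borel_measurable borel" for f :: "complex \<times> complex \<times> complex \<Rightarrow> ennreal"
  proof -
    have [measurable]: "f \<in> borel_measurable (borel \<Otimes>\<^sub>M borel \<Otimes>\<^sub>M borel)"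
      using f by (simp add: borel_prod)
    have upd: "(\<Sum>j\<in>insert i I. g j * (x(i := y)) j) = (\<Sum>j\<in>I. g j * x j) + g i * y"
      for g x and y :: complex
      using insert.hyps by (auto simp: add.commute intro!: sum.cong)
    have "(\<integral>\<^sup>+x. f (\<Sum>j\<in>insert i I. h j * x j, \<Sum>j\<in>insert i I. l j * x j, \<Sum>j\<in>insert i I. t j * x j)
          \<partial>Pi\<^sub>M (insert i I) (\<lambda>_. cgauss)) =
       (\<integral>\<^sup>+a. \<integral>\<^sup>+x. f ((\<Sum>j\<in>I. h j * x j) + h i * a, (\<Sum>j\<in>I. l j * x j) + l i * a, (\<Sum>j\<in>I. t j * x j) + t i * a)
          \<partial>Pi\<^sub>M I (\<lambda>_. cgauss) \<partial>cgauss)"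
      by (subst cgauss_product.product_nn_integral_insert_rev)
        (use insert.hyps in \<open>simp_all only: upd\<close>, measurable)
    also have "\<dots> = (\<integral>\<^sup>+a. \<integral>\<^sup>+b. \<integral>\<^sup>+c. \<integral>\<^sup>+d. f (\<alpha> * b + h i * a, \<beta> * b + \<delta> * c + l i * a, \<epsilon> * b + \<zeta> * c + \<kappa> * d + t i * a)
        \<partial>cgauss \<partial>cgauss \<partial>cgauss \<partial>cgauss)"
    proof (rule nn_integral_cong)
      fix a
      show "(\<integral>\<^sup>+x. f ((\<Sum>j\<in>I. h j * x j) + h i * a, (\<Sum>j\<in>I. l j * x j) + l i * a, (\<Sum>j\<in>I. t j * x j) + t i * a)
          \<partial>Pi\<^sub>M I (\<lambda>_. cgauss)) =
         (\<integral>\<^sup>+b. \<integral>\<^sup>+c. \<integral>\<^sup>+d. f (\<alpha> * b + h i * a, \<beta> * b + \<delta> * c + l i * a, \<epsilon> * b + \<zeta> * c + \<kappa> * d + t i * a)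
        \<partial>cgauss \<partial>cgauss \<partial>cgauss)"
        using IH[of "\<lambda>(u, v, w). f (u + h i * a, v + l i * a, w + t i * a)"]
        by (simp add: borel_prod[symmetric])
    qed
    also have "\<dots> = (\<integral>\<^sup>+b. \<integral>\<^sup>+c. \<integral>\<^sup>+d. f (\<alpha>' * b, \<beta>' * b + \<delta>' * c, \<epsilon>' * b + \<zeta>' * c + \<kappa>' * d)
        \<partial>cgauss \<partial>cgauss \<partial>cgauss)" by (rule step[OF f])
    finally show ?thesis .
  qed
  moreover have "tri_gram \<alpha>' \<beta>' \<delta>' \<epsilon>' \<zeta>' \<kappa>' (\<Sum>j\<in>insert i I. cnj (h j) * h j)
      (\<Sum>j\<in>insert i I. cnj (h j) * l j) (\<Sum>j\<in>insert i I. cnj (h j) * t j)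
      (\<Sum>j\<in>insert i I. cnj (l j) * l j) (\<Sum>j\<in>insert i I. cnj (l j) * t j) (\<Sum>j\<in>insert i I. cnj (t j) * t j)"
    using gram gram' insert.hyps by (simp add: tri_gram_def add.commute)
  ultimately show ?case by blast
qed

text \<open>The weight times the Gaussian density is again a centred Gaussian density, of variance
  \<open>1 / (1 + |\<alpha>|^2)\<close> and of that same total mass; scaling brings it back to the
  standard one.\<close>

lemma cgauss_tilt:
  assumes [measurable]: "F \<in> borel_measurable borel"
  shows "(\<integral>\<^sup>+b. ennreal (exp (- (cmod (\<alpha> * b))\<^sup>2)) * F b \<partial>cgauss) =
    ennreal (1 / (1 + (cmod \<alpha>)\<^sup>2)) * (\<integral>\<^sup>+b. F (b / of_real (sqrt (1 + (cmod \<alpha>)\<^sup>2))) \<partial>cgauss)"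
proof -
  define q where "q = sqrt (1 + (cmod \<alpha>)\<^sup>2)"
  have q: "q > 0" "q\<^sup>2 = 1 + (cmod \<alpha>)\<^sup>2"
    unfolding q_def by (simp_all add: add_pos_nonneg)
  have "(\<integral>\<^sup>+b. ennreal (exp (- (cmod (\<alpha> * b))\<^sup>2)) * F b \<partial>cgauss) =
      (\<integral>\<^sup>+b. ennreal (exp (- (q * cmod b)\<^sup>2) / pi) * F b \<partial>lborel)"
  proof -
    have "ennreal (exp (- (cmod b)\<^sup>2) / pi) * ennreal (exp (- (cmod (\<alpha> * b))\<^sup>2)) = ennreal (exp (- (q * cmod b)\<^sup>2) / pi)" for b
      by (simp add: ennreal_mult[symmetric] norm_mult power_mult_distrib q(2) algebra_simps flip: exp_add)
    then show ?thesis
      by (subst nn_integral_cgauss) (auto simp: mult.assoc[symmetric])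
  qed
  also have "\<dots> = ennreal ((cmod (of_real (1 / q)))\<^sup>2) *
      (\<integral>\<^sup>+b. ennreal (exp (- (q * cmod (0 + of_real (1 / q) * b))\<^sup>2) / pi) * F (0 + of_real (1 / q) * b) \<partial>lborel)"
    by (rule nn_integral_complex_affine) (use q in auto)
  also have "(cmod (of_real (1 / q)))\<^sup>2 = 1 / (1 + (cmod \<alpha>)\<^sup>2)"
    using q by (simp add: norm_divide power_divide)
  also have "(\<integral>\<^sup>+b. ennreal (exp (- (q * cmod (0 + of_real (1 / q) * b))\<^sup>2) / pi) * F (0 + of_real (1 / q) * b) \<partial>lborel)
      = (\<integral>\<^sup>+b. F (b / of_real q) \<partial>cgauss)"
    using q by (subst nn_integral_cgauss) (auto simp: norm_divide norm_mult)
  finally show ?thesis by (simp only: q_def)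
qed

text \<open>Gaussian regression under a tilt. The exponential weight is what remains of the density
  of the eliminated coefficient; it produces the factor \<open>1 / (1 + hh)\<close> and Schur
  complements with respect to \<open>1 + hh\<close>. Under the tilted law \<open>v\<close> is the
  variance of the \<open>l\<close> functional, \<open>k\<close> its covariance with the
  \<open>t\<close> functional and \<open>s\<close> the variance of the latter. Given the value
  \<open>w\<close> of the former, the second moment of the latter is the squared regression mean
  plus the residual variance \<open>s - |k|^2 / v\<close>.\<close>

lemma cgauss_functional:
  fixes I :: "nat set" and h l t :: "nat \<Rightarrow> complex" and \<psi> :: "complex \<Rightarrow> ennreal"
    and hh ll tt v s :: real and hl ht lt k :: complex
  assumes I: "finite I" and \<psi>[measurable]: "\<psi> \<in> borel_measurable borel"
    and hh: "(\<Sum>j\<in>I. cnj (h j) * h j) = of_real hh" and hl: "(\<Sum>j\<in>I. cnj (h j) * l j) = hl"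
    and ht: "(\<Sum>j\<in>I. cnj (h j) * t j) = ht" and ll: "(\<Sum>j\<in>I. cnj (l j) * l j) = of_real ll"
    and lt: "(\<Sum>j\<in>I. cnj (l j) * t j) = lt" and tt: "(\<Sum>j\<in>I. cnj (t j) * t j) = of_real tt"
    and v: "v = ll - (cmod hl)\<^sup>2 / (1 + hh)" "v > 0"
    and k: "k = lt - cnj hl * ht / of_real (1 + hh)"
    and s: "s = tt - (cmod ht)\<^sup>2 / (1 + hh)"
  shows "(\<integral>\<^sup>+x. ennreal (exp (- (cmod (\<Sum>j\<in>I. h j * x j))\<^sup>2)) * ennreal ((cmod (\<Sum>j\<in>I. t j * x j))\<^sup>2) *
        \<psi> (\<Sum>j\<in>I. l j * x j) \<partial>Pi\<^sub>M I (\<lambda>_. cgauss)) =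
    (\<integral>\<^sup>+w. ennreal (exp (- (cmod w)\<^sup>2 / v) / (pi * v * (1 + hh)) *
        ((cmod k)\<^sup>2 * (cmod w)\<^sup>2 / v\<^sup>2 + (s - (cmod k)\<^sup>2 / v))) * \<psi> w \<partial>lborel)"
proof -
  have sq: "cnj z * z = of_real ((cmod z)\<^sup>2)" for z unfolding complex_norm_square by (rule mult.commute)
  obtain \<alpha> \<beta> \<delta> \<epsilon> \<zeta> \<kappa> where tri: "\<And>f :: complex \<times> complex \<times> complex \<Rightarrow> ennreal. f \<in> borel_measurable borel \<Longrightarrow>
      (\<integral>\<^sup>+x. f (\<Sum>j\<in>I. h j * x j, \<Sum>j\<in>I. l j * x j, \<Sum>j\<in>I. t j * x j) \<partial>Pi\<^sub>M I (\<lambda>_. cgauss)) =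
      (\<integral>\<^sup>+b. \<integral>\<^sup>+c. \<integral>\<^sup>+d. f (\<alpha> * b, \<beta> * b + \<delta> * c, \<epsilon> * b + \<zeta> * c + \<kappa> * d)
        \<partial>cgauss \<partial>cgauss \<partial>cgauss)"
    and gram: "tri_gram \<alpha> \<beta> \<delta> \<epsilon> \<zeta> \<kappa> (of_real hh) hl ht (of_real ll) lt (of_real tt)"
    using cgauss_triangular[OF I, of h l t] unfolding hh hl ht ll lt tt by blast
  have \<alpha>: "(cmod \<alpha>)\<^sup>2 = hh"
    using gram unfolding tri_gram_def sq of_real_eq_iff by blast
  have hh0: "hh \<ge> 0" using \<alpha> by (metis zero_le_power2)
  define q where "q = sqrt (1 + hh)"
  have q: "q > 0" "q\<^sup>2 = 1 + hh" using hh0 by (simp_all add: q_def)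
  \<comment> \<open>Tilting shrinks the first variable by the factor \<open>q\<close>; the primed
    coefficients absorb this.\<close>
  define \<beta>' \<epsilon>' where "\<beta>' = \<beta> / of_real q" and "\<epsilon>' = \<epsilon> / of_real q"
  \<comment> \<open>This rotation concentrates the \<open>l\<close> functional in one variable: with
    the coefficients defined next it is \<open>\<rho> * c\<close>, and the \<open>t\<close>
    functional is \<open>\<mu> * c + \<nu> * b + \<kappa> * d\<close>.\<close>
  obtain C S where CS: "(cmod C)\<^sup>2 + (cmod S)\<^sup>2 = 1" "\<beta>' * cnj C = \<delta> * cnj S"
    by (rule givens_exists)
  define \<rho> \<mu> \<nu> where "\<rho> = \<delta> * C + \<beta>' * S" and "\<mu> = \<zeta> * C + \<epsilon>' * S" and "\<nu> = \<epsilon>' * cnj C - \<zeta> * cnj S"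
  have b0: "\<beta>' * cnj C - \<delta> * cnj S = 0" using CS(2) by simp
  have \<rho>: "(cmod \<rho>)\<^sup>2 = v"
  proof -
    have "cnj \<rho> * \<rho> = cnj \<delta> * \<delta> + cnj \<beta>' * \<beta>'"
      using givens_gram[OF CS(1), of \<delta> \<beta>' \<delta> \<beta>'] unfolding b0 by (simp add: \<rho>_def)
    then have 1: "(cmod \<rho>)\<^sup>2 = (cmod \<delta>)\<^sup>2 + (cmod \<beta>)\<^sup>2 / (1 + hh)"
      unfolding sq of_real_add[symmetric] of_real_eq_iff using q by (simp add: \<beta>'_def norm_divide power_divide)
    have 2: "(cmod \<beta>)\<^sup>2 + (cmod \<delta>)\<^sup>2 = ll"
      using gram unfolding tri_gram_def sq of_real_add[symmetric] of_real_eq_iff by blast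
    have "cnj \<alpha> * \<beta> = hl" using gram by (simp add: tri_gram_def)
    then have 3: "(cmod hl)\<^sup>2 = hh * (cmod \<beta>)\<^sup>2"
      using \<alpha> by (auto simp: norm_mult power_mult_distrib)
    show ?thesis unfolding 1 v(1) 3 2[symmetric] using hh0 by (simp add: field_simps)
  qed
  have k': "cnj \<rho> * \<mu> = k"
  proof -
    have "cnj \<rho> * \<mu> = cnj \<delta> * \<zeta> + cnj \<beta>' * \<epsilon>'"
      using givens_gram[OF CS(1), of \<delta> \<beta>' \<zeta> \<epsilon>'] unfolding b0 by (simp add: \<rho>_def \<mu>_def)
    also have "cnj \<beta>' * \<epsilon>' = cnj \<beta> * \<epsilon> / of_real (1 + hh)"
      unfolding q(2)[symmetric] by (simp add: \<beta>'_def \<epsilon>'_def power2_eq_square)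
    finally have 1: "cnj \<rho> * \<mu> = cnj \<delta> * \<zeta> + cnj \<beta> * \<epsilon> / of_real (1 + hh)" .
    have hl': "hl = cnj \<alpha> * \<beta>" and ht': "ht = cnj \<alpha> * \<epsilon>" using gram by (simp_all add: tri_gram_def)
    have "cnj hl * ht = (cnj \<alpha> * \<alpha>) * (cnj \<beta> * \<epsilon>)"
      unfolding hl' ht' by simp
    then have 2: "cnj hl * ht = of_real hh * (cnj \<beta> * \<epsilon>)" unfolding sq \<alpha> .
    have 3: "lt = cnj \<beta> * \<epsilon> + cnj \<delta> * \<zeta>" using gram by (simp add: tri_gram_def)
    have "complex_of_real (1 + hh) \<noteq> 0" using hh0 by (simp only: of_real_eq_0_iff)
    then show ?thesis unfolding 1 k 2 3 by (simp add: field_simps)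
  qed
  have \<mu>: "(cmod \<mu>)\<^sup>2 = (cmod k)\<^sup>2 / v"
    using k' \<rho> v(2) by (auto simp: norm_mult power_mult_distrib)
  have \<nu>: "(cmod \<nu>)\<^sup>2 + (cmod \<kappa>)\<^sup>2 = s - (cmod k)\<^sup>2 / v"
  proof -
    have "cnj \<mu> * \<mu> + cnj \<nu> * \<nu> = cnj \<zeta> * \<zeta> + cnj \<epsilon>' * \<epsilon>'"
      using givens_gram[OF CS(1), of \<zeta> \<epsilon>' \<zeta> \<epsilon>'] by (simp only: \<mu>_def \<nu>_def)
    then have 1: "(cmod \<mu>)\<^sup>2 + (cmod \<nu>)\<^sup>2 = (cmod \<zeta>)\<^sup>2 + (cmod \<epsilon>)\<^sup>2 / (1 + hh)"
      unfolding sq of_real_add[symmetric] of_real_eq_iff using q by (simp add: \<epsilon>'_def norm_divide power_divide)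
    have 2: "(cmod \<epsilon>)\<^sup>2 + (cmod \<zeta>)\<^sup>2 + (cmod \<kappa>)\<^sup>2 = tt"
      using gram unfolding tri_gram_def sq of_real_add[symmetric] of_real_eq_iff by blast
    have "cnj \<alpha> * \<epsilon> = ht" using gram by (simp add: tri_gram_def)
    then have 3: "(cmod ht)\<^sup>2 = hh * (cmod \<epsilon>)\<^sup>2"
      using \<alpha> by (auto simp: norm_mult power_mult_distrib)
    have 4: "s = (cmod \<zeta>)\<^sup>2 + (cmod \<epsilon>)\<^sup>2 / (1 + hh) + (cmod \<kappa>)\<^sup>2"
      unfolding s 3 2[symmetric] using hh0 by (simp add: field_simps)
    show ?thesis using 1 4 \<mu> by simp
  qed
  have \<rho>0: "\<rho> \<noteq> 0" using \<rho> v(2) by auto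
  have Tm: "(\<lambda>(x, y, z). ennreal (exp (- (cmod x)\<^sup>2)) * ennreal ((cmod z)\<^sup>2) * \<psi> y) \<in> borel_measurable borel"
    unfolding borel_prod[symmetric] by measurable
  have "(\<integral>\<^sup>+x. ennreal (exp (- (cmod (\<Sum>j\<in>I. h j * x j))\<^sup>2)) * ennreal ((cmod (\<Sum>j\<in>I. t j * x j))\<^sup>2) *
        \<psi> (\<Sum>j\<in>I. l j * x j) \<partial>Pi\<^sub>M I (\<lambda>_. cgauss)) =
     (\<integral>\<^sup>+b. \<integral>\<^sup>+c. \<integral>\<^sup>+d. ennreal (exp (- (cmod (\<alpha> * b))\<^sup>2)) * ennreal ((cmod (\<epsilon> * b + \<zeta> * c + \<kappa> * d))\<^sup>2) *
        \<psi> (\<beta> * b + \<delta> * c) \<partial>cgauss \<partial>cgauss \<partial>cgauss)"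
    using tri[OF Tm] by simp
  also have "\<dots> = (\<integral>\<^sup>+b. \<integral>\<^sup>+c. ennreal (exp (- (cmod (\<alpha> * b))\<^sup>2)) *
        (\<psi> (\<beta> * b + \<delta> * c) * ennreal ((cmod (\<epsilon> * b + \<zeta> * c))\<^sup>2 + (cmod \<kappa>)\<^sup>2)) \<partial>cgauss \<partial>cgauss)"
  proof (rule nn_integral_cong, rule nn_integral_cong)
    fix b c
    have "(\<integral>\<^sup>+d. ennreal (exp (- (cmod (\<alpha> * b))\<^sup>2)) * ennreal ((cmod (\<epsilon> * b + \<zeta> * c + \<kappa> * d))\<^sup>2) *
        \<psi> (\<beta> * b + \<delta> * c) \<partial>cgauss) =
      (\<integral>\<^sup>+d. (ennreal (exp (- (cmod (\<alpha> * b))\<^sup>2)) * \<psi> (\<beta> * b + \<delta> * c)) *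
         ennreal ((cmod (\<epsilon> * b + \<zeta> * c + \<kappa> * d))\<^sup>2) \<partial>cgauss)"
      by (simp only: mult_ac)
    also have "\<dots> = (ennreal (exp (- (cmod (\<alpha> * b))\<^sup>2)) * \<psi> (\<beta> * b + \<delta> * c)) *
        ennreal ((cmod (\<epsilon> * b + \<zeta> * c))\<^sup>2 + (cmod \<kappa>)\<^sup>2)"
      by (subst nn_integral_cmult) (auto simp only: cgauss_second_moment, measurable)
    finally show "(\<integral>\<^sup>+d. ennreal (exp (- (cmod (\<alpha> * b))\<^sup>2)) * ennreal ((cmod (\<epsilon> * b + \<zeta> * c + \<kappa> * d))\<^sup>2) *
        \<psi> (\<beta> * b + \<delta> * c) \<partial>cgauss) = ennreal (exp (- (cmod (\<alpha> * b))\<^sup>2)) *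
        (\<psi> (\<beta> * b + \<delta> * c) * ennreal ((cmod (\<epsilon> * b + \<zeta> * c))\<^sup>2 + (cmod \<kappa>)\<^sup>2))"
      by (simp only: mult_ac)
  qed
  also have "\<dots> = (\<integral>\<^sup>+b. ennreal (exp (- (cmod (\<alpha> * b))\<^sup>2)) *
        (\<integral>\<^sup>+c. \<psi> (\<beta> * b + \<delta> * c) * ennreal ((cmod (\<epsilon> * b + \<zeta> * c))\<^sup>2 + (cmod \<kappa>)\<^sup>2) \<partial>cgauss) \<partial>cgauss)"
    by (rule nn_integral_cong, rule nn_integral_cmult) measurable
  also have "\<dots> = ennreal (1 / (1 + hh)) *
      (\<integral>\<^sup>+b. \<integral>\<^sup>+c. \<psi> (\<beta>' * b + \<delta> * c) * ennreal ((cmod (\<epsilon>' * b + \<zeta> * c))\<^sup>2 + (cmod \<kappa>)\<^sup>2) \<partial>cgauss \<partial>cgauss)"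
    by (subst cgauss_tilt) (measurable, simp add: \<alpha> q_def[symmetric] \<beta>'_def \<epsilon>'_def)
  also have "(\<integral>\<^sup>+b. \<integral>\<^sup>+c. \<psi> (\<beta>' * b + \<delta> * c) * ennreal ((cmod (\<epsilon>' * b + \<zeta> * c))\<^sup>2 + (cmod \<kappa>)\<^sup>2) \<partial>cgauss \<partial>cgauss) =
     (\<integral>\<^sup>+b. \<integral>\<^sup>+c. (\<lambda>(c, b). \<psi> (\<beta>' * b + \<delta> * c) * ennreal ((cmod (\<epsilon>' * b + \<zeta> * c))\<^sup>2 + (cmod \<kappa>)\<^sup>2))
        (C * c - cnj S * b, S * c + cnj C * b) \<partial>cgauss \<partial>cgauss)"
    by (subst cgauss_rotate[OF _ CS(1)]) (auto simp: borel_prod[symmetric])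
  also have "\<dots> = (\<integral>\<^sup>+b. \<integral>\<^sup>+c. \<psi> (\<rho> * c) * ennreal ((cmod (\<mu> * c + \<nu> * b))\<^sup>2 + (cmod \<kappa>)\<^sup>2) \<partial>cgauss \<partial>cgauss)"
  proof -
    have "\<beta>' * (S * c + cnj C * b) + \<delta> * (C * c - cnj S * b) = \<rho> * c" for b c
      using CS(2) by (simp add: \<rho>_def algebra_simps)
    moreover have "\<epsilon>' * (S * c + cnj C * b) + \<zeta> * (C * c - cnj S * b) = \<mu> * c + \<nu> * b" for b c
      by (simp add: \<mu>_def \<nu>_def algebra_simps)
    ultimately show ?thesis by (simp only: prod.case)
  qed
  also have "\<dots> = (\<integral>\<^sup>+c. \<integral>\<^sup>+b. \<psi> (\<rho> * c) * ennreal ((cmod (\<mu> * c + \<nu> * b))\<^sup>2 + (cmod \<kappa>)\<^sup>2) \<partial>cgauss \<partial>cgauss)"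
    by (rule cgauss2.Fubini') measurable
  also have "\<dots> = (\<integral>\<^sup>+c. \<psi> (\<rho> * c) * ennreal ((cmod k)\<^sup>2 * (cmod (\<rho> * c))\<^sup>2 / v\<^sup>2 + (s - (cmod k)\<^sup>2 / v)) \<partial>cgauss)"
  proof (rule nn_integral_cong)
    fix c
    have "(\<integral>\<^sup>+b. ennreal ((cmod (\<mu> * c + \<nu> * b))\<^sup>2 + (cmod \<kappa>)\<^sup>2) \<partial>cgauss) =
        (\<integral>\<^sup>+b. ennreal ((cmod (\<mu> * c + \<nu> * b))\<^sup>2) + ennreal ((cmod \<kappa>)\<^sup>2) \<partial>cgauss)"
      by (intro nn_integral_cong ennreal_plus) auto
    also have "\<dots> = ennreal ((cmod (\<mu> * c))\<^sup>2 + (cmod \<nu>)\<^sup>2) + ennreal ((cmod \<kappa>)\<^sup>2)"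
      by (subst nn_integral_add) (auto simp: cgauss_second_moment cgauss.emeasure_space_1[simplified])
    also have "\<dots> = ennreal ((cmod (\<mu> * c))\<^sup>2 + ((cmod \<nu>)\<^sup>2 + (cmod \<kappa>)\<^sup>2))"
      by (subst ennreal_plus[symmetric]) (auto simp: add.assoc)
    also have "(cmod (\<mu> * c))\<^sup>2 = (cmod k)\<^sup>2 * (cmod (\<rho> * c))\<^sup>2 / v\<^sup>2"
      unfolding norm_mult power_mult_distrib \<mu> \<rho> using v(2) by (simp add: power2_eq_square[of v])
    finally have *: "(\<integral>\<^sup>+b. ennreal ((cmod (\<mu> * c + \<nu> * b))\<^sup>2 + (cmod \<kappa>)\<^sup>2) \<partial>cgauss) =
        ennreal ((cmod k)\<^sup>2 * (cmod (\<rho> * c))\<^sup>2 / v\<^sup>2 + (s - (cmod k)\<^sup>2 / v))" unfolding \<nu> .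
    show "(\<integral>\<^sup>+b. \<psi> (\<rho> * c) * ennreal ((cmod (\<mu> * c + \<nu> * b))\<^sup>2 + (cmod \<kappa>)\<^sup>2) \<partial>cgauss) =
        \<psi> (\<rho> * c) * ennreal ((cmod k)\<^sup>2 * (cmod (\<rho> * c))\<^sup>2 / v\<^sup>2 + (s - (cmod k)\<^sup>2 / v))"
      unfolding *[symmetric] by (rule nn_integral_cmult) measurable
  qed
  also have "\<dots> = (\<integral>\<^sup>+c. ennreal (exp (- (cmod (\<rho> * c))\<^sup>2 / v) / pi) *
      (\<psi> (\<rho> * c) * ennreal ((cmod k)\<^sup>2 * (cmod (\<rho> * c))\<^sup>2 / v\<^sup>2 + (s - (cmod k)\<^sup>2 / v))) \<partial>lborel)"
  proof -
    have "(cmod (\<rho> * c))\<^sup>2 / v = (cmod c)\<^sup>2" for c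
      using v(2) by (simp add: norm_mult power_mult_distrib \<rho>)
    then show ?thesis by (subst nn_integral_cgauss) auto
  qed
  \<comment> \<open>The substitution \<open>w = \<rho> * c\<close> has Jacobian
    \<open>|\<rho>|^2 = v\<close>, so a factor \<open>v\<close> and its inverse are
    inserted.\<close>
  also have "ennreal (1 / (1 + hh)) * \<dots> = ennreal (1 / (1 + hh)) * (ennreal (1 / v) * (ennreal v * \<dots>))"
    using v(2) by (simp add: mult.assoc[symmetric] ennreal_mult[symmetric])
  also have "ennreal v * (\<integral>\<^sup>+c. ennreal (exp (- (cmod (\<rho> * c))\<^sup>2 / v) / pi) *
      (\<psi> (\<rho> * c) * ennreal ((cmod k)\<^sup>2 * (cmod (\<rho> * c))\<^sup>2 / v\<^sup>2 + (s - (cmod k)\<^sup>2 / v))) \<partial>lborel) =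
    (\<integral>\<^sup>+w. ennreal (exp (- (cmod w)\<^sup>2 / v) / pi) *
      (\<psi> w * ennreal ((cmod k)\<^sup>2 * (cmod w)\<^sup>2 / v\<^sup>2 + (s - (cmod k)\<^sup>2 / v))) \<partial>lborel)"
    by (subst nn_integral_complex_affine[OF _ \<rho>0, of _ 0]) (auto simp: \<rho>)
  also have "ennreal (1 / (1 + hh)) * (ennreal (1 / v) * \<dots>) =
      (\<integral>\<^sup>+w. ennreal (1 / (1 + hh)) * (ennreal (1 / v) * (ennreal (exp (- (cmod w)\<^sup>2 / v) / pi) *
      (\<psi> w * ennreal ((cmod k)\<^sup>2 * (cmod w)\<^sup>2 / v\<^sup>2 + (s - (cmod k)\<^sup>2 / v))))) \<partial>lborel)"
    by (simp add: nn_integral_cmult)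
  also have "\<dots> = (\<integral>\<^sup>+w. ennreal (exp (- (cmod w)\<^sup>2 / v) / (pi * v * (1 + hh)) *
        ((cmod k)\<^sup>2 * (cmod w)\<^sup>2 / v\<^sup>2 + (s - (cmod k)\<^sup>2 / v))) * \<psi> w \<partial>lborel)"
  proof (rule nn_integral_cong)
    fix w
    define X where "X = (cmod k)\<^sup>2 * (cmod w)\<^sup>2 / v\<^sup>2 + (s - (cmod k)\<^sup>2 / v)"
    have "X \<ge> 0" unfolding X_def \<nu>[symmetric] by simp
    have "exp (- (cmod w)\<^sup>2 / v) / (pi * v * (1 + hh)) * X =
        1 / (1 + hh) * (1 / v * (exp (- (cmod w)\<^sup>2 / v) / pi * X))" by (simp add: field_simps)
    moreover have "ennreal (1 / (1 + hh) * (1 / v * (exp (- (cmod w)\<^sup>2 / v) / pi * X))) =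
       ennreal (1 / (1 + hh)) * (ennreal (1 / v) * (ennreal (exp (- (cmod w)\<^sup>2 / v) / pi) * ennreal X))"
    proof -
      have m: "ennreal (a * (b * (e * X))) = ennreal a * (ennreal b * (ennreal e * ennreal X))"
        if "0 \<le> a" "0 \<le> b" "0 \<le> e" for a b e
        using that \<open>X \<ge> 0\<close> by (simp only: ennreal_mult mult_nonneg_nonneg)
      show ?thesis by (rule m) (use hh0 v(2) in auto)
    qed
    ultimately show "ennreal (1 / (1 + hh)) * (ennreal (1 / v) * (ennreal (exp (- (cmod w)\<^sup>2 / v) / pi) *
      (\<psi> w * ennreal ((cmod k)\<^sup>2 * (cmod w)\<^sup>2 / v\<^sup>2 + (s - (cmod k)\<^sup>2 / v))))) =
      ennreal (exp (- (cmod w)\<^sup>2 / v) / (pi * v * (1 + hh)) *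
        ((cmod k)\<^sup>2 * (cmod w)\<^sup>2 / v\<^sup>2 + (s - (cmod k)\<^sup>2 / v))) * \<psi> w"
      unfolding X_def[symmetric] by (simp only: mult_ac)
  qed
  finally show ?thesis .
qed

subsection \<open>Second moments of the jet of a Gaussian SU(2) polynomial at a critical point\<close>

text \<open>The identity \<open>(n choose j) * (j choose k) = (n choose k) * ((n - k) choose (j -
  k))\<close> reduces the sum to the binomial theorem. Terms with \<open>j < k\<close> vanish with
  \<open>j choose k\<close>, so the truncated exponent does no harm.\<close>

lemma binomial_moment:
  fixes r :: real
  shows "(\<Sum>j\<le>n. real (j choose k) * real (n choose j) * r ^ (j - k)) = real (n choose k) * (1 + r) ^ (n - k)"
proof (cases "k \<le> n")
  case False
  then show ?thesis by (auto simp: binomial_eq_0 intro!: sum.neutral)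
next
  case True
  have "(\<Sum>j\<le>n. real (j choose k) * real (n choose j) * r ^ (j - k)) =
      (\<Sum>j\<in>{k..n}. real (j choose k) * real (n choose j) * r ^ (j - k))"
    by (intro sum.mono_neutral_right) (auto simp: binomial_eq_0)
  also have "\<dots> = (\<Sum>j\<in>{k..n}. real (n choose k) * (real ((n - k) choose (j - k)) * r ^ (j - k)))"
  proof (intro sum.cong refl)
    fix j assume "j \<in> {k..n}"
    then have "(n choose j) * (j choose k) = (n choose k) * ((n - k) choose (j - k))"
      by (intro choose_mult) auto
    then have "real (n choose j) * real (j choose k) = real (n choose k) * real ((n - k) choose (j - k))"
      by (metis of_nat_mult)
    then show "real (j choose k) * real (n choose j) * r ^ (j - k) =
        real (n choose k) * (real ((n - k) choose (j - k)) * r ^ (j - k))"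
      by (simp add: mult_ac)
  qed
  also have "\<dots> = real (n choose k) * (\<Sum>i\<le>n - k. real ((n - k) choose i) * r ^ i)"
    unfolding sum_distrib_left
    by (rule sum.reindex_bij_witness[of _ "\<lambda>i. i + k" "\<lambda>j. j - k"]) (use True in auto)
  also have "(\<Sum>i\<le>n - k. real ((n - k) choose i) * r ^ i) = (1 + r) ^ (n - k)"
    using binomial_ring[of r 1 "n - k"] by (simp add: add.commute)
  finally show ?thesis .
qed

lemma real_choose_small:
  "real (j choose 1) = real j" "real (j choose 2) = real j * (real j - 1) / 2"
  "real (j choose 3) = real j * (real j - 1) * (real j - 2) / 6"
  "real (j choose 4) = real j * (real j - 1) * (real j - 2) * (real j - 3) / 24"
  by (simp_all add: binomial_gbinomial gbinomial_prod_rev eval_nat_numeral fact_numeral)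

text \<open>The right sides carry \<open>(1 + r) ^ n / (1 + r) ^ k\<close> in place of a truncated
  power. They then hold also for \<open>n < k\<close>, where the polynomial in \<open>n\<close>
  vanishes, and \<open>(1 + r) ^ n\<close> can be treated as one symbol in the algebra
  below.\<close>

lemma binomial_factorial_moments:
  fixes r :: real
  assumes r: "0 \<le> r"
  shows "(\<Sum>j\<le>n. real (n choose j) * r ^ j) = (1 + r) ^ n"
    and "(\<Sum>j\<le>n. real j * real (n choose j) * r ^ (j - 1)) = real n * (1 + r) ^ n / (1 + r)"
    and "(\<Sum>j\<le>n. real j * (real j - 1) * real (n choose j) * r ^ (j - 2)) =
      real n * (real n - 1) * (1 + r) ^ n / (1 + r) ^ 2"
    and "(\<Sum>j\<le>n. real j * (real j - 1) * (real j - 2) * real (n choose j) * r ^ (j - 3)) =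
      real n * (real n - 1) * (real n - 2) * (1 + r) ^ n / (1 + r) ^ 3"
    and "(\<Sum>j\<le>n. real j * (real j - 1) * (real j - 2) * (real j - 3) * real (n choose j) * r ^ (j - 4)) =
      real n * (real n - 1) * (real n - 2) * (real n - 3) * (1 + r) ^ n / (1 + r) ^ 4"
proof -
  have pw: "real (n choose k) * (1 + r) ^ (n - k) = real (n choose k) * (1 + r) ^ n / (1 + r) ^ k" for k
  proof (cases "k \<le> n")
    case True
    then show ?thesis using r by (simp add: power_diff)
  qed (simp add: binomial_eq_0)
  have m: "(\<Sum>j\<le>n. real (j choose k) * real (n choose j) * r ^ (j - k)) * c =
      real (n choose k) * c * (1 + r) ^ n / (1 + r) ^ k" for k c
    unfolding binomial_moment pw by (simp add: mult_ac)
  show "(\<Sum>j\<le>n. real (n choose j) * r ^ j) = (1 + r) ^ n"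
    using m[of 0 1] by simp
  show "(\<Sum>j\<le>n. real j * real (n choose j) * r ^ (j - 1)) = real n * (1 + r) ^ n / (1 + r)"
    using m[of 1 1] unfolding real_choose_small by simp
  show "(\<Sum>j\<le>n. real j * (real j - 1) * real (n choose j) * r ^ (j - 2)) =
      real n * (real n - 1) * (1 + r) ^ n / (1 + r) ^ 2"
    using m[of 2 2] unfolding real_choose_small sum_distrib_right by simp
  show "(\<Sum>j\<le>n. real j * (real j - 1) * (real j - 2) * real (n choose j) * r ^ (j - 3)) =
      real n * (real n - 1) * (real n - 2) * (1 + r) ^ n / (1 + r) ^ 3"
    using m[of 3 6] unfolding real_choose_small sum_distrib_right by simp
  show "(\<Sum>j\<le>n. real j * (real j - 1) * (real j - 2) * (real j - 3) * real (n choose j) * r ^ (j - 4)) =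
      real n * (real n - 1) * (real n - 2) * (real n - 3) * (1 + r) ^ n / (1 + r) ^ 4"
    using m[of 4 24] unfolding real_choose_small sum_distrib_right by simp
qed

text \<open>Solving \<open>p'(z) = 0\<close> for the coefficient \<open>a\<^sub>1\<close> makes \<open>a\<^sub>1\<close>, its derivative in \<open>z\<close>, and \<open>p(z)\<close> linear
  functionals of the remaining coefficients. The following are the weights of these functionals;
  the truncated exponents are harmless because the real factors vanish there.\<close>

definition crit_h :: "nat \<Rightarrow> complex \<Rightarrow> nat \<Rightarrow> complex" where
  "crit_h n z j = - of_real (real j * sqrt (real (n choose j)) / sqrt (real n)) * z ^ (j - 1)"

definition crit_l :: "nat \<Rightarrow> complex \<Rightarrow> nat \<Rightarrow> complex" where
  "crit_l n z j = of_real ((1 - real j) * sqrt (real (n choose j))) * z ^ j"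

definition crit_t :: "nat \<Rightarrow> complex \<Rightarrow> nat \<Rightarrow> complex" where
  "crit_t n z j = - of_real (real j * (real j - 1) * sqrt (real (n choose j)) / sqrt (real n)) * z ^ (j - 2)"

text \<open>Each product of two weights is expanded in falling factorials, for instance
  \<open>j^2 = j (j - 1) + j\<close> and \<open>(j (j - 1))^2 = j (j - 1) (j - 2) (j - 3) + 4 j (j -
  1) (j - 2) + 2 j (j - 1)\<close>; the factorial moments \<open>M0\<close> to \<open>M4\<close> do
  the rest.\<close>

lemma sum_crit_grams:
  fixes z :: complex
  assumes n: "2 \<le> n" and r: "r = (cmod z)\<^sup>2"
    and M: "M0 = (1 + r) ^ n" "M1 = real n * (1 + r) ^ n / (1 + r)"
      "M2 = real n * (real n - 1) * (1 + r) ^ n / (1 + r) ^ 2"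
      "M3 = real n * (real n - 1) * (real n - 2) * (1 + r) ^ n / (1 + r) ^ 3"
      "M4 = real n * (real n - 1) * (real n - 2) * (real n - 3) * (1 + r) ^ n / (1 + r) ^ 4"
    and I: "I = {..n} - {1}"
  shows "(\<Sum>j\<in>I. cnj (crit_h n z j) * crit_h n z j) = of_real ((r * M2 + M1) / n - 1)"
    and "(\<Sum>j\<in>I. cnj (crit_h n z j) * crit_l n z j) = of_real (r * M2 / sqrt n) * z"
    and "(\<Sum>j\<in>I. cnj (crit_h n z j) * crit_t n z j) = of_real ((r * M3 + 2 * M2) / n) * cnj z"
    and "(\<Sum>j\<in>I. cnj (crit_l n z j) * crit_l n z j) = of_real (r\<^sup>2 * M2 - r * M1 + M0)"
    and "(\<Sum>j\<in>I. cnj (crit_l n z j) * crit_t n z j) = of_real ((r * M3 + M2) / sqrt n) * (cnj z)\<^sup>2"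
    and "(\<Sum>j\<in>I. cnj (crit_t n z j) * crit_t n z j) = of_real ((r\<^sup>2 * M4 + 4 * r * M3 + 2 * M2) / n)"
proof -
  let ?h = "crit_h n z" and ?l = "crit_l n z" and ?t = "crit_t n z"
  let ?s = "\<lambda>j. sqrt (real (n choose j))" and ?q = "sqrt (real n)"
  let ?m1 = "\<lambda>j. real j * real (n choose j) * r ^ (j - 1)"
  let ?m2 = "\<lambda>j. real j * (real j - 1) * real (n choose j) * r ^ (j - 2)"
  let ?m3 = "\<lambda>j. real j * (real j - 1) * (real j - 2) * real (n choose j) * r ^ (j - 3)"
  let ?m4 = "\<lambda>j. real j * (real j - 1) * (real j - 2) * (real j - 3) * real (n choose j) * r ^ (j - 4)"
  have r0: "0 \<le> r" by (simp add: r)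
  note mom = binomial_factorial_moments[OF r0, of n, folded M]
  have rz: "complex_of_real r = cnj z * z"
    unfolding r complex_norm_square by (rule mult.commute)
  have zr: "cnj (z ^ k) * z ^ k = of_real (r ^ k)" for k
    by (simp add: rz power_mult_distrib)
  have cnj_neg: "cnj (- of_real a * x) * (- of_real b * y) = of_real (a * b) * (cnj x * y)"
    and cnj_pos: "cnj (of_real a * x) * (of_real b * y) = of_real (a * b) * (cnj x * y)"
    and cnj_neg_pos: "cnj (- of_real a * x) * (of_real b * y) = of_real (- a * b) * (cnj x * y)"
    and cnj_pos_neg: "cnj (of_real a * x) * (- of_real b * y) = of_real (- a * b) * (cnj x * y)"
    for a b x y by simp_all
  have fI: "finite {..n}" "1 \<in> {..n}" using n by auto
  have sqn: "?q * ?q = real n" by simp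
  have sqc: "?s j * ?s j = real (n choose j)" for j by simp
  \<comment> \<open>Of the three weights only \<open>crit_h\<close> is nonzero at
    \<open>j = 1\<close>, with value \<open>- 1\<close>; this is the origin of the
    \<open>- 1\<close> in the first Gram entry.\<close>
  have sumI: "(\<Sum>j\<in>I. f j) = (\<Sum>j\<le>n. f j) - f 1" for f :: "nat \<Rightarrow> complex"
    unfolding I using sum.remove[OF fI, of f] by simp
  have c: "n > 0" using n by simp
  have "(\<Sum>j\<le>n. cnj (?h j) * ?h j) =
      of_real (\<Sum>j\<le>n. (r * ?m2 j +
        ?m1 j) / n)"
    unfolding of_real_sum
  proof (rule sum.cong[OF refl])
    fix j
    have "cnj (?h j) * ?h j =
        of_real (real j * ?s j / ?q * (real j * ?s j / ?q)) *
        (cnj (z ^ (j - 1)) * z ^ (j - 1))"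
      unfolding crit_h_def by (rule cnj_neg)
    also have "\<dots> = of_real ((?s j * ?s j) * (real j * real j) * r ^ (j - 1) / (?q * ?q))"
      unfolding zr of_real_mult[symmetric]
      by (simp only: times_divide_eq_left times_divide_eq_right divide_divide_eq_left mult_ac)
    also have "(?s j * ?s j) * (real j * real j) * r ^ (j - 1) / (?q * ?q) =
       (r * ?m2 j +
        ?m1 j) / n"
    proof -
      \<comment> \<open>The exponents are truncated differences, so the small indices are split off
        before powers of \<open>r\<close> are compared.\<close>
      consider "j = 0" | "j = 1" | k where "j = Suc (Suc k)" by (metis One_nat_def not0_implies_Suc)
      then show ?thesis unfolding sqc sqn by cases (auto simp: algebra_simps)
    qed
    finally show "cnj (?h j) * ?h j = of_real ((r * ?m2 j +
        ?m1 j) / n)" .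
  qed
  also have "(\<Sum>j\<le>n. (r * ?m2 j +
        ?m1 j) / n) = (r * M2 + M1) / n"
    unfolding sum_divide_distrib[symmetric] sum.distrib sum_distrib_left[symmetric] mom ..
  finally show "(\<Sum>j\<in>I. cnj (?h j) * ?h j) = of_real ((r * M2 + M1) / n - 1)"
    unfolding sumI using c by (simp add: crit_h_def flip: of_real_mult)
  have "(\<Sum>j\<le>n. cnj (?h j) * ?l j) =
      (\<Sum>j\<le>n. of_real (r * ?m2 j / ?q) * z)"
  proof (rule sum.cong[OF refl])
    fix j
    consider "j = 0" | "j = 1" | k where "j = Suc (Suc k)" by (metis One_nat_def not0_implies_Suc)
    then show "cnj (?h j) * ?l j =
      of_real (r * ?m2 j / ?q) * z"
    proof cases
      case (3 k)
      have "cnj (?h j) * ?l j =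
        of_real (- (real j * ?s j / ?q) * ((1 - real j) * ?s j)) *
        (cnj (z ^ (j - 1)) * z ^ (j - 1)) * z"
        unfolding crit_h_def crit_l_def cnj_neg_pos by (simp add: 3 del: of_real_mult of_real_minus)
      also have "\<dots> = of_real (- (real j * ?s j / ?q) * ((1 - real j) * ?s j) * r ^ (j - 1)) * z"
        unfolding zr of_real_mult[symmetric] ..
      also have "- (real j * ?s j / ?q) * ((1 - real j) * ?s j) * r ^ (j - 1) =
          (?s j * ?s j) * (real j * (real j - 1)) * r ^ (j - 1) / ?q"
        by (simp add: divide_inverse algebra_simps)
      also have "\<dots> = r * ?m2 j / ?q"
        unfolding sqc by (simp add: 3)
      finally show ?thesis .
    qed (auto simp: crit_h_def crit_l_def)
  qed
  also have "\<dots> = of_real (r * M2 / ?q) * z"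
    unfolding sum_distrib_right[symmetric] of_real_sum[symmetric] sum_divide_distrib[symmetric] sum_distrib_left[symmetric] mom ..
  finally show "(\<Sum>j\<in>I. cnj (?h j) * ?l j) = of_real (r * M2 / ?q) * z"
    unfolding sumI by (simp add: crit_l_def)
  have "(\<Sum>j\<le>n. cnj (?h j) * ?t j) =
      (\<Sum>j\<le>n. of_real ((r * ?m3 j +
        2 * ?m2 j) / n) * cnj z)"
  proof (rule sum.cong[OF refl])
    fix j
    consider "j = 0" | "j = 1" | k where "j = Suc (Suc k)" by (metis One_nat_def not0_implies_Suc)
    then show "cnj (?h j) * ?t j =
      of_real ((r * ?m3 j +
        2 * ?m2 j) / n) * cnj z"
    proof cases
      case (3 k)
      have "cnj (?h j) * ?t j =
        of_real ((real j * ?s j / ?q) * (real j * (real j - 1) * ?s j / ?q)) *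
        (cnj (z ^ (j - 2)) * z ^ (j - 2)) * cnj z"
        unfolding crit_h_def crit_t_def cnj_neg by (simp add: 3 del: of_real_mult of_real_minus)
      also have "\<dots> = of_real ((real j * ?s j / ?q) * (real j * (real j - 1) * ?s j / ?q) * r ^ (j - 2)) * cnj z"
        unfolding zr of_real_mult[symmetric] ..
      also have "(real j * ?s j / ?q) * (real j * (real j - 1) * ?s j / ?q) * r ^ (j - 2) =
          (?s j * ?s j) * (real j * real j * (real j - 1)) * r ^ (j - 2) / (?q * ?q)"
        by (simp only: times_divide_eq_left times_divide_eq_right divide_divide_eq_left mult_ac)
      also have "\<dots> = (r * ?m3 j +
        2 * ?m2 j) / n"
        unfolding sqc sqn by (cases k) (simp_all add: 3 algebra_simps)
      finally show ?thesis .
    qed (auto simp: crit_h_def crit_t_def)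
  qed
  also have "\<dots> = of_real ((r * M3 + 2 * M2) / n) * cnj z"
    unfolding sum_distrib_right[symmetric] of_real_sum[symmetric] sum_divide_distrib[symmetric] sum.distrib sum_distrib_left[symmetric] mom ..
  finally show "(\<Sum>j\<in>I. cnj (?h j) * ?t j) = of_real ((r * M3 + 2 * M2) / n) * cnj z"
    unfolding sumI by (simp add: crit_t_def)
  have "(\<Sum>j\<le>n. cnj (?l j) * ?l j) =
      of_real (\<Sum>j\<le>n. r\<^sup>2 * ?m2 j -
        r * ?m1 j + real (n choose j) * r ^ j)"
    unfolding of_real_sum
  proof (rule sum.cong[OF refl])
    fix j
    have "cnj (?l j) * ?l j =
        of_real ((1 - real j) * ?s j * ((1 - real j) * ?s j)) * (cnj (z ^ j) * z ^ j)"
      unfolding crit_l_def by (rule cnj_pos)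
    also have "\<dots> = of_real ((?s j * ?s j) * ((1 - real j) * (1 - real j)) * r ^ j)"
      unfolding zr of_real_mult[symmetric] by (simp only: mult_ac)
    also have "(?s j * ?s j) * ((1 - real j) * (1 - real j)) * r ^ j =
       r\<^sup>2 * ?m2 j -
        r * ?m1 j + real (n choose j) * r ^ j"
    proof -
      consider "j = 0" | "j = 1" | k where "j = Suc (Suc k)" by (metis One_nat_def not0_implies_Suc)
      then show ?thesis unfolding sqc by cases (auto simp: algebra_simps power2_eq_square)
    qed
    finally show "cnj (?l j) * ?l j = of_real (r\<^sup>2 * ?m2 j -
        r * ?m1 j + real (n choose j) * r ^ j)" .
  qed
  also have "(\<Sum>j\<le>n. r\<^sup>2 * ?m2 j -
        r * ?m1 j + real (n choose j) * r ^ j) = r\<^sup>2 * M2 - r * M1 + M0"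
    unfolding sum.distrib sum_subtractf sum_distrib_left[symmetric] mom ..
  finally show "(\<Sum>j\<in>I. cnj (?l j) * ?l j) = of_real (r\<^sup>2 * M2 - r * M1 + M0)"
    unfolding sumI by (simp add: crit_l_def)
  have "(\<Sum>j\<le>n. cnj (?l j) * ?t j) =
      (\<Sum>j\<le>n. of_real ((r * ?m3 j +
        ?m2 j) / ?q) * (cnj z)\<^sup>2)"
  proof (rule sum.cong[OF refl])
    fix j
    consider "j = 0" | "j = 1" | k where "j = Suc (Suc k)" by (metis One_nat_def not0_implies_Suc)
    then show "cnj (?l j) * ?t j =
      of_real ((r * ?m3 j +
        ?m2 j) / ?q) * (cnj z)\<^sup>2"
    proof cases
      case (3 k)
      have "cnj (?l j) * ?t j =
        of_real (- ((1 - real j) * ?s j) * (real j * (real j - 1) * ?s j / ?q)) *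
        (cnj (z ^ (j - 2)) * z ^ (j - 2)) * (cnj z)\<^sup>2"
        unfolding crit_l_def crit_t_def cnj_pos_neg by (simp add: 3 power2_eq_square del: of_real_mult of_real_minus)
      also have "\<dots> = of_real (- ((1 - real j) * ?s j) * (real j * (real j - 1) * ?s j / ?q) * r ^ (j - 2)) * (cnj z)\<^sup>2"
        unfolding zr of_real_mult[symmetric] ..
      also have "- ((1 - real j) * ?s j) * (real j * (real j - 1) * ?s j / ?q) * r ^ (j - 2) =
          (?s j * ?s j) * (real j * (real j - 1) * (real j - 1)) * r ^ (j - 2) / ?q"
        by (simp add: divide_inverse algebra_simps)
      also have "\<dots> = (r * ?m3 j +
        ?m2 j) / ?q"
        unfolding sqc by (cases k) (simp_all add: 3 algebra_simps)
      finally show ?thesis .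
    qed (auto simp: crit_l_def crit_t_def)
  qed
  also have "\<dots> = of_real ((r * M3 + M2) / ?q) * (cnj z)\<^sup>2"
    unfolding sum_distrib_right[symmetric] of_real_sum[symmetric] sum_divide_distrib[symmetric] sum.distrib sum_distrib_left[symmetric] mom ..
  finally show "(\<Sum>j\<in>I. cnj (?l j) * ?t j) = of_real ((r * M3 + M2) / ?q) * (cnj z)\<^sup>2"
    unfolding sumI by (simp add: crit_t_def)
  have "(\<Sum>j\<le>n. cnj (?t j) * ?t j) =
      of_real (\<Sum>j\<le>n. (r\<^sup>2 * ?m4 j +
        4 * r * ?m3 j +
        2 * ?m2 j) / n)"
    unfolding of_real_sum
  proof (rule sum.cong[OF refl])
    fix j
    have "cnj (?t j) * ?t j =
        of_real (real j * (real j - 1) * ?s j / ?q * (real j * (real j - 1) * ?s j / ?q)) *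
        (cnj (z ^ (j - 2)) * z ^ (j - 2))"
      unfolding crit_t_def by (rule cnj_neg)
    also have "\<dots> = of_real ((?s j * ?s j) * (real j * (real j - 1) * (real j * (real j - 1))) * r ^ (j - 2) / (?q * ?q))"
      unfolding zr of_real_mult[symmetric]
      by (simp only: times_divide_eq_left times_divide_eq_right divide_divide_eq_left mult_ac)
    also have "(?s j * ?s j) * (real j * (real j - 1) * (real j * (real j - 1))) * r ^ (j - 2) / (?q * ?q) =
       (r\<^sup>2 * ?m4 j +
        4 * r * ?m3 j +
        2 * ?m2 j) / n"
    proof -
      consider "j = 0" | "j = 1" | "j = 2" | "j = 3" | k where "j = Suc (Suc (Suc (Suc k)))"
        by (metis One_nat_def not0_implies_Suc numeral_2_eq_2 numeral_3_eq_3)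
      then show ?thesis unfolding sqc sqn by cases (auto simp: algebra_simps power2_eq_square)
    qed
    finally show "cnj (?t j) * ?t j = of_real ((r\<^sup>2 * ?m4 j +
        4 * r * ?m3 j +
        2 * ?m2 j) / n)" .
  qed
  also have "(\<Sum>j\<le>n. (r\<^sup>2 * ?m4 j +
        4 * r * ?m3 j +
        2 * ?m2 j) / n) = (r\<^sup>2 * M4 + 4 * r * M3 + 2 * M2) / n"
    unfolding sum_divide_distrib[symmetric] sum.distrib sum_distrib_left[symmetric] mom ..
  finally show "(\<Sum>j\<in>I. cnj (?t j) * ?t j) = of_real ((r\<^sup>2 * M4 + 4 * r * M3 + 2 * M2) / n)"
    unfolding sumI by (simp add: crit_t_def)
qed

text \<open>Divided by \<open>pi\<close>, this is the joint intensity of a critical point with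
  \<open>|z|^2 = r\<close> and its value with \<open>|w|^2 = X\<close>. The exponential comes from
  the Gaussian density of the value given a critical point at \<open>z\<close>. The two terms of the
  last numerator are, up to a common factor, the squared regression mean of the second derivative
  and its residual variance.\<close>

definition crit_kernel :: "nat \<Rightarrow> real \<Rightarrow> real \<Rightarrow> real" where
  "crit_kernel n r X = (real n - 1) * exp (- X * ((1 + n * r) / (1 + r) ^ n)) / (pi * (1 + r) ^ n * (1 + r) ^ n) *
    (n * (real n - 1) * r\<^sup>2 * X + 2 * (1 + r) ^ n) / (1 + r)\<^sup>2"

text \<open>The Gram entries are substituted into the regression formula. The Schur complements have
  denominator \<open>1 + n r\<close>, and their numerators collapse.\<close>

lemma nn_integral_crit_functionals:
  fixes z :: complex and \<psi> :: "complex \<Rightarrow> ennreal"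
  assumes n: "2 \<le> n" and \<psi>: "\<psi> \<in> borel_measurable borel"
  shows "(\<integral>\<^sup>+x. ennreal (exp (- (cmod (\<Sum>j\<in>{..n} - {1}. crit_h n z j * x j))\<^sup>2)) *
        ennreal ((cmod (\<Sum>j\<in>{..n} - {1}. crit_t n z j * x j))\<^sup>2) *
        \<psi> (\<Sum>j\<in>{..n} - {1}. crit_l n z j * x j) \<partial>Pi\<^sub>M ({..n} - {1}) (\<lambda>_. cgauss)) =
    (\<integral>\<^sup>+w. ennreal (crit_kernel n ((cmod z)\<^sup>2) ((cmod w)\<^sup>2)) * \<psi> w \<partial>lborel)"
proof -
  define r where "r = (cmod z)\<^sup>2"
  have r0: "0 \<le> r" by (simp add: r_def)
  define N where "N = real n"
  have N: "N \<ge> 2" using n by (simp add: N_def)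
  \<comment> \<open>With \<open>u\<close> and \<open>U = u ^ n\<close> as independent symbols the
    identities below are rational, within reach of \<open>field_simps\<close>.\<close>
  define u where "u = 1 + r"
  have u: "u > 0" "u \<noteq> 0" using r0 by (auto simp: u_def)
  define U where "U = u ^ n"
  have U: "U > 0" using u by (simp add: U_def)
  define d where "d = 1 + N * r"
  have d: "d > 0" "d \<noteq> 0" using N r0 by (auto simp: d_def intro!: add_pos_nonneg) (smt (verit) mult_nonneg_nonneg)
  define M0 M1 M2 M3 M4 where "M0 = U" and "M1 = N * U / u" and "M2 = N * (N - 1) * U / u ^ 2"
    and "M3 = N * (N - 1) * (N - 2) * U / u ^ 3" and "M4 = N * (N - 1) * (N - 2) * (N - 3) * U / u ^ 4"
  note Ms = this
  note gr = sum_crit_grams[OF n r_def, of M0 M1 M2 M3 M4 "{..n} - {1}", folded N_def u_def U_def, OF M0_def M1_def M2_def M3_def M4_def refl]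
  define hh where "hh = (r * M2 + M1) / N - 1"
  define ll where "ll = r\<^sup>2 * M2 - r * M1 + M0"
  define tt where "tt = (r\<^sup>2 * M4 + 4 * r * M3 + 2 * M2) / N"
  define hl where "hl = of_real (r * M2 / sqrt N) * z"
  define ht where "ht = of_real ((r * M3 + 2 * M2) / N) * cnj z"
  define lt where "lt = of_real ((r * M3 + M2) / sqrt N) * (cnj z)\<^sup>2"
  have sqN: "(sqrt N)\<^sup>2 = N" using N by simp
  \<comment> \<open>This is the variance of \<open>p'(z) / sqrt n\<close>, the summand
    \<open>1\<close> coming from the eliminated coefficient.\<close>
  have hh1: "1 + hh = U / u\<^sup>2 * d"
    using N u unfolding hh_def Ms d_def by (simp add: field_simps power2_eq_square) (simp add: u_def algebra_simps)
  have hl2: "(cmod hl)\<^sup>2 = (r * M2)\<^sup>2 * r / N"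
    using N by (simp add: hl_def norm_mult power_mult_distrib power_divide norm_divide flip: r_def)
  have ht2: "(cmod ht)\<^sup>2 = ((r * M3 + 2 * M2) / N)\<^sup>2 * r"
    unfolding ht_def norm_mult norm_of_real power_mult_distrib complex_mod_cnj r_def[symmetric] power2_abs ..
  define v where "v = ll - (cmod hl)\<^sup>2 / (1 + hh)"
  have combine: "A * P - A * (Q / d) = A * (P * d - Q) / d" for A P Q
    using d by (simp add: field_simps)
  \<comment> \<open>The conditional variance of \<open>p(z)\<close> given \<open>p'(z) = 0\<close>;
    the cubic terms of the numerator cancel and leave \<open>u^2\<close>.\<close>
  have v: "v = U / d"
  proof -
    have 1: "ll = U / u\<^sup>2 * (N * (N - 1) * r\<^sup>2 - N * r * u + u\<^sup>2)"
      unfolding ll_def Ms using u by (simp add: field_simps power2_eq_square)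
    have 2: "(cmod hl)\<^sup>2 / (1 + hh) = U / u\<^sup>2 * (N * (N - 1)\<^sup>2 * r ^ 3 / d)"
      unfolding hl2 hh1 Ms using u U d N by (simp add: field_simps power2_eq_square power3_eq_cube)
    have "v = U / u\<^sup>2 * ((N * (N - 1) * r\<^sup>2 - N * r * u + u\<^sup>2) * d - N * (N - 1)\<^sup>2 * r ^ 3) / d"
      unfolding v_def 1 2 by (rule combine)
    also have "(N * (N - 1) * r\<^sup>2 - N * r * u + u\<^sup>2) * d - N * (N - 1)\<^sup>2 * r ^ 3 = u\<^sup>2"
      unfolding d_def u_def by (simp add: power2_eq_square power3_eq_cube algebra_simps)
    finally show ?thesis using u by simp
  qed
  define k where "k = lt - cnj hl * ht / of_real (1 + hh)"
  have k: "k = of_real (sqrt N * (N - 1) * U / (u\<^sup>2 * d)) * (cnj z)\<^sup>2"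
  proof -
    have "cnj hl * ht / of_real (1 + hh) =
        of_real ((r * M2 / sqrt N) * ((r * M3 + 2 * M2) / N) / (1 + hh)) * (cnj z)\<^sup>2"
      unfolding hl_def ht_def by (simp add: power2_eq_square)
    then have "k = of_real ((r * M3 + M2) / sqrt N - (r * M2 / sqrt N) * ((r * M3 + 2 * M2) / N) / (1 + hh)) * (cnj z)\<^sup>2"
      unfolding k_def lt_def by (simp add: algebra_simps)
    also have "(r * M3 + M2) / sqrt N - (r * M2 / sqrt N) * ((r * M3 + 2 * M2) / N) / (1 + hh) =
        sqrt N * (N - 1) * U / (u\<^sup>2 * d)"
    proof -
      have a: "r * M3 + M2 = N * (N - 1) * U / u ^ 3 * (1 + (N - 1) * r)"
        unfolding Ms using u by (simp add: field_simps power2_eq_square power3_eq_cube) (simp add: u_def algebra_simps)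
      have b: "r * M3 + 2 * M2 = N * (N - 1) * U / u ^ 3 * (2 + N * r)"
        unfolding Ms using u by (simp add: field_simps power2_eq_square power3_eq_cube) (simp add: u_def algebra_simps)
      have c: "r * M2 / (N * (1 + hh)) = (N - 1) * r / d"
        unfolding hh1 Ms using u U d N by (simp add: field_simps)
      have "(r * M3 + M2) / sqrt N - (r * M2 / sqrt N) * ((r * M3 + 2 * M2) / N) / (1 + hh) =
          ((r * M3 + M2) - r * M2 / (N * (1 + hh)) * (r * M3 + 2 * M2)) / sqrt N"
        by (simp add: diff_divide_distrib)
      also have "\<dots> = N * (N - 1) * U / u ^ 3 * ((1 + (N - 1) * r) * d - (N - 1) * r * (2 + N * r)) / d / sqrt N"
      proof -
        have "A * X - B / d * (A * Y) = A * (X * d - B * Y) / d" for A B X Y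
          using d by (simp add: field_simps)
        then show ?thesis unfolding a b c by (simp only:)
      qed
      also have "(1 + (N - 1) * r) * d - (N - 1) * r * (2 + N * r) = u"
        unfolding d_def u_def by (simp add: algebra_simps)
      also have "N * (N - 1) * U / u ^ 3 * u / d / sqrt N = (N / sqrt N) * (N - 1) * U / (u\<^sup>2 * d)"
        using u by (simp add: power2_eq_square power3_eq_cube)
      also have "N / sqrt N = sqrt N" using N by (simp add: real_div_sqrt)
      finally show ?thesis .
    qed
    finally show ?thesis .
  qed
  have k2: "(cmod k)\<^sup>2 = N * (N - 1)\<^sup>2 * U\<^sup>2 / (u ^ 4 * d\<^sup>2) * r\<^sup>2"
  proof -
    have "(cmod k)\<^sup>2 = (sqrt N * (N - 1) * U / (u\<^sup>2 * d))\<^sup>2 * r\<^sup>2"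
      unfolding k norm_mult norm_of_real power_mult_distrib power2_abs norm_power complex_mod_cnj r_def[symmetric] ..
    then show ?thesis using N by (simp add: power_mult_distrib power_divide)
  qed
  define s where "s = tt - (cmod ht)\<^sup>2 / (1 + hh)"
  \<comment> \<open>The residual variance of the second derivative given \<open>p(z)\<close> and
    \<open>p'(z) = 0\<close>, in the normalization of \<open>crit_t\<close>. The numerator collapses
    to \<open>2 * d\<close>, so the denominator \<open>1 + n r\<close> disappears.\<close>
  have s: "s - (cmod k)\<^sup>2 / v = 2 * (N - 1) * U / u ^ 4"
  proof -
    have tt: "tt = (N - 1) * U / u ^ 4 * ((N - 2) * (N - 3) * r\<^sup>2 + 4 * (N - 2) * r * u + 2 * u\<^sup>2)"
      unfolding tt_def Ms using u N by (simp add: field_simps power2_eq_square power3_eq_cube eval_nat_numeral)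
    have b: "(r * M3 + 2 * M2) / N = (N - 1) * U / u ^ 3 * (2 + N * r)"
      unfolding Ms using u N by (simp add: field_simps power2_eq_square power3_eq_cube) (simp add: u_def algebra_simps)
    have ht': "(cmod ht)\<^sup>2 / (1 + hh) = (N - 1) * U / u ^ 4 * ((N - 1) * (2 + N * r)\<^sup>2 * r / d)"
      unfolding ht2 b hh1 using u d U by (simp add: field_simps eval_nat_numeral)
    have k': "(cmod k)\<^sup>2 / v = (N - 1) * U / u ^ 4 * (N * (N - 1) * r\<^sup>2 / d)"
      unfolding k2 v using u d U by (simp add: field_simps eval_nat_numeral)
    have "s - (cmod k)\<^sup>2 / v = (N - 1) * U / u ^ 4 *
       (((N - 2) * (N - 3) * r\<^sup>2 + 4 * (N - 2) * r * u + 2 * u\<^sup>2) * d - (N - 1) * (2 + N * r)\<^sup>2 * r - N * (N - 1) * r\<^sup>2) / d"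
      unfolding s_def tt ht' k' combine by (simp only: right_diff_distrib diff_divide_distrib times_divide_eq_right)
    also have "((N - 2) * (N - 3) * r\<^sup>2 + 4 * (N - 2) * r * u + 2 * u\<^sup>2) * d - (N - 1) * (2 + N * r)\<^sup>2 * r - N * (N - 1) * r\<^sup>2 = 2 * d"
      unfolding d_def u_def by (simp add: power2_eq_square algebra_simps)
    finally show ?thesis using d by simp
  qed
  have v0: "v > 0" unfolding v using U d by simp
  have K: "exp (- (cmod w)\<^sup>2 / v) / (pi * v * (1 + hh)) *
        ((cmod k)\<^sup>2 * (cmod w)\<^sup>2 / v\<^sup>2 + (s - (cmod k)\<^sup>2 / v)) = crit_kernel n r ((cmod w)\<^sup>2)" for w
  proof -
    have e: "exp (- (cmod w)\<^sup>2 / v) = exp (- (cmod w)\<^sup>2 * (d / U))" unfolding v by simp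
    have f: "pi * v * (1 + hh) = pi * U * U / u\<^sup>2" unfolding v hh1 using d by simp
    have g: "(cmod k)\<^sup>2 * (cmod w)\<^sup>2 / v\<^sup>2 = (N - 1) / u ^ 4 * (N * (N - 1) * r\<^sup>2 * (cmod w)\<^sup>2)"
    proof -
      have *: "A * U\<^sup>2 / (y * d\<^sup>2) * R * X / (U / d)\<^sup>2 = A * R * X / y" for A y R X
        using d U by (simp add: power_divide)
      show ?thesis unfolding k2 v * by (simp add: power2_eq_square)
    qed
    show ?thesis
      unfolding e f g s crit_kernel_def N_def[symmetric] u_def[symmetric] U_def[symmetric] d_def[symmetric]
      using u U by (simp add: field_simps eval_nat_numeral)
  qed
  show ?thesis
    using cgauss_functional[OF _ \<psi> gr(1)[folded hh_def] gr(2)[folded hl_def] gr(3)[folded ht_def]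
        gr(4)[folded ll_def] gr(5)[folded lt_def] gr(6)[folded tt_def] v_def v0 k_def s_def]
    unfolding K r_def[symmetric] by simp
qed

subsection \<open>Measurability of sums over roots\<close>

text \<open>By compactness a root exists exactly when \<open>K\<close> is nonempty and the infimum
  of the modulus is zero, and continuity allows the infimum over a countable dense subset.\<close>

lemma measurable_exists_root:
  fixes Q :: "'w \<Rightarrow> complex poly"
  assumes Q[measurable]: "\<And>z. (\<lambda>\<omega>. poly (Q \<omega>) z) \<in> borel_measurable M" and K: "compact K"
  shows "Measurable.pred M (\<lambda>\<omega>. \<exists>z\<in>K. poly (Q \<omega>) z = 0)"
proof -
  obtain D where D: "countable D" "D \<subseteq> K" "K \<subseteq> closure D" by (rule separable)
  have "(\<exists>z\<in>K. poly (Q \<omega>) z = 0) \<longleftrightarrow> (\<forall>m. \<exists>q\<in>D. cmod (poly (Q \<omega>) q) < inverse (real (Suc m)))" for \<omega>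
  proof
    assume "\<exists>z\<in>K. poly (Q \<omega>) z = 0"
    then obtain z where z: "z \<in> K" "poly (Q \<omega>) z = 0" by auto
    show "\<forall>m. \<exists>q\<in>D. cmod (poly (Q \<omega>) q) < inverse (real (Suc m))"
    proof
      fix m
      have "isCont (poly (Q \<omega>)) z" by simp
      then obtain e where e: "e > 0" "\<And>q. dist q z < e \<Longrightarrow> dist (poly (Q \<omega>) q) (poly (Q \<omega>) z) < inverse (real (Suc m))"
        unfolding continuous_at_eps_delta by (metis inverse_positive_iff_positive of_nat_0_less_iff zero_less_Suc)
      moreover obtain q where "q \<in> D" "dist q z < e"
        using z D e(1) closure_approachable by blast
      ultimately show "\<exists>q\<in>D. cmod (poly (Q \<omega>) q) < inverse (real (Suc m))"
        using z(2) by (metis dist_0_norm dist_commute)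
    qed
  next
    assume H: "\<forall>m. \<exists>q\<in>D. cmod (poly (Q \<omega>) q) < inverse (real (Suc m))"
    then have "K \<noteq> {}" using D by blast
    moreover have "continuous_on K (\<lambda>z. cmod (poly (Q \<omega>) z))" by (intro continuous_intros)
    ultimately obtain z where z: "z \<in> K" "\<And>y. y \<in> K \<Longrightarrow> cmod (poly (Q \<omega>) z) \<le> cmod (poly (Q \<omega>) y)"
      using continuous_attains_inf[OF K] by blast
    have "cmod (poly (Q \<omega>) z) = 0"
    proof (rule ccontr)
      assume "cmod (poly (Q \<omega>) z) \<noteq> 0"
      then obtain m where "inverse (real (Suc m)) < cmod (poly (Q \<omega>) z)"
        using reals_Archimedean[of "cmod (poly (Q \<omega>) z)"] by auto
      moreover obtain q where "q \<in> D" "cmod (poly (Q \<omega>) q) < inverse (real (Suc m))" using H by blast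
      ultimately show False using z(2)[of q] D(2) by force
    qed
    then show "\<exists>z\<in>K. poly (Q \<omega>) z = 0" using z(1) by auto
  qed
  moreover have "Measurable.pred M (\<lambda>\<omega>. \<forall>m. \<exists>q\<in>D. cmod (poly (Q \<omega>) q) < inverse (real (Suc m)))"
    using D(1) by measurable
  ultimately show ?thesis by simp
qed

text \<open>Half-open dyadic squares of side \<open>1 / 2 ^ m\<close>: they partition the plane, so
  every root has exactly one cell at each level.\<close>

definition cell_index :: "nat \<Rightarrow> complex \<Rightarrow> int \<times> int" where
  "cell_index m z = (\<lfloor>2 ^ m * Re z\<rfloor>, \<lfloor>2 ^ m * Im z\<rfloor>)"

definition cell_corner :: "nat \<Rightarrow> int \<times> int \<Rightarrow> complex" where
  "cell_corner m q = Complex (of_int (fst q) / 2 ^ m) (of_int (snd q) / 2 ^ m)"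

lemma cell_corner_tendsto: "(\<lambda>m. cell_corner m (cell_index m z)) \<longlonglongrightarrow> z"
proof -
  have fl: "(\<lambda>m. of_int \<lfloor>2 ^ m * x\<rfloor> / 2 ^ m) \<longlonglongrightarrow> x" for x :: real
  proof (rule real_tendsto_sandwich)
    show "(\<lambda>m. x - (1 / 2) ^ m) \<longlonglongrightarrow> x"
      by (rule tendsto_eq_intros LIMSEQ_realpow_zero | simp)+
    show "\<forall>\<^sub>F m in sequentially. x - (1 / 2) ^ m \<le> of_int \<lfloor>2 ^ m * x\<rfloor> / 2 ^ m"
    proof (intro always_eventually allI)
      fix m
      have "2 ^ m * x - 1 \<le> of_int \<lfloor>2 ^ m * x\<rfloor>" by linarith
      then have "(2 ^ m * x - 1) / 2 ^ m \<le> of_int \<lfloor>2 ^ m * x\<rfloor> / 2 ^ m" by (rule divide_right_mono) simp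
      then show "x - (1 / 2) ^ m \<le> of_int \<lfloor>2 ^ m * x\<rfloor> / 2 ^ m" by (simp add: diff_divide_distrib power_one_over)
    qed
    show "\<forall>\<^sub>F m in sequentially. of_int \<lfloor>2 ^ m * x\<rfloor> / 2 ^ m \<le> x"
      by (intro always_eventually allI) (simp add: field_simps)
  qed auto
  then show ?thesis
    unfolding cell_corner_def cell_index_def tendsto_complex_iff by simp
qed

text \<open>A half-open square is a countable union of compact boxes, for which the existence of a
  root is already known to be measurable.\<close>

lemma measurable_exists_root_cell:
  fixes Q :: "'w \<Rightarrow> complex poly"
  assumes Q: "\<And>z. (\<lambda>\<omega>. poly (Q \<omega>) z) \<in> borel_measurable M"
  shows "Measurable.pred M (\<lambda>\<omega>. \<exists>z. poly (Q \<omega>) z = 0 \<and> cell_index m z = q)"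
proof -
  define a where "a = cell_corner m q"
  define b where "b l = Complex ((of_int (fst q) + 1) / 2 ^ m - inverse (real (Suc l))) ((of_int (snd q) + 1) / 2 ^ m - inverse (real (Suc l)))" for l
  \<comment> \<open>The bound is asked for all large \<open>l\<close>, so that the two coordinates
    can share one index, the maximum of their thresholds.\<close>
  have half: "(\<exists>l0. \<forall>l\<ge>l0. of_int i / 2 ^ m \<le> x \<and> x \<le> (of_int i + 1) / 2 ^ m - inverse (real (Suc l))) \<longleftrightarrow> \<lfloor>2 ^ m * x\<rfloor> = i"
    (is "?L \<longleftrightarrow> ?R") for i and x :: real
  proof
    assume ?L
    then obtain l where "of_int i / 2 ^ m \<le> x" "x \<le> (of_int i + 1) / 2 ^ m - inverse (real (Suc l))" by blast
    moreover have "0 < inverse (real (Suc l))" by simp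
    ultimately have "of_int i / 2 ^ m \<le> x" "x < (of_int i + 1) / 2 ^ m" by linarith+
    then show ?R by (simp add: floor_eq_iff field_simps)
  next
    assume ?R
    then have x: "of_int i / 2 ^ m \<le> x" "x < (of_int i + 1) / 2 ^ m" by (auto simp: floor_eq_iff field_simps)
    then obtain l0 where l0: "inverse (real (Suc l0)) < (of_int i + 1) / 2 ^ m - x"
      using reals_Archimedean[of "(of_int i + 1) / 2 ^ m - x"] by auto
    have "inverse (real (Suc l)) \<le> inverse (real (Suc l0))" if "l \<ge> l0" for l using that by simp
    then show ?L using x l0 by (intro exI[of _ l0]) (smt (verit))
  qed
  have "cell_index m z = q \<longleftrightarrow> (\<exists>l. z \<in> cbox a (b l))" for z
  proof
    assume "cell_index m z = q"
    then have "\<lfloor>2 ^ m * Re z\<rfloor> = fst q" "\<lfloor>2 ^ m * Im z\<rfloor> = snd q" by (auto simp: cell_index_def)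
    then obtain l1 l2 where
      "\<And>l. l \<ge> l1 \<Longrightarrow> of_int (fst q) / 2 ^ m \<le> Re z \<and> Re z \<le> (of_int (fst q) + 1) / 2 ^ m - inverse (real (Suc l))"
      "\<And>l. l \<ge> l2 \<Longrightarrow> of_int (snd q) / 2 ^ m \<le> Im z \<and> Im z \<le> (of_int (snd q) + 1) / 2 ^ m - inverse (real (Suc l))"
      unfolding half[symmetric] by blast
    then have "z \<in> cbox a (b (max l1 l2))"
      by (auto simp: mem_box Basis_complex_def a_def b_def cell_corner_def simp del: of_nat_Suc)
    then show "\<exists>l. z \<in> cbox a (b l)" by blast
  next
    assume "\<exists>l. z \<in> cbox a (b l)"
    then obtain l where l: "z \<in> cbox a (b l)" by blast
    have pos: "0 < inverse (real (Suc l))" by simp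
    have "of_int (fst q) / 2 ^ m \<le> Re z" "Re z \<le> (of_int (fst q) + 1) / 2 ^ m - inverse (real (Suc l))"
      "of_int (snd q) / 2 ^ m \<le> Im z" "Im z \<le> (of_int (snd q) + 1) / 2 ^ m - inverse (real (Suc l))"
      using l by (auto simp: mem_box Basis_complex_def a_def b_def cell_corner_def simp del: of_nat_Suc)
    then have "of_int (fst q) / 2 ^ m \<le> Re z" "Re z < (of_int (fst q) + 1) / 2 ^ m"
      "of_int (snd q) / 2 ^ m \<le> Im z" "Im z < (of_int (snd q) + 1) / 2 ^ m"
      using pos by linarith+
    then show "cell_index m z = q"
      by (auto simp: cell_index_def prod_eq_iff floor_eq_iff field_simps)
  qed
  then have "(\<lambda>\<omega>. \<exists>z. poly (Q \<omega>) z = 0 \<and> cell_index m z = q) = (\<lambda>\<omega>. \<exists>l. \<exists>z\<in>cbox a (b l). poly (Q \<omega>) z = 0)"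
    by (auto simp: fun_eq_iff)
  moreover have "Measurable.pred M (\<lambda>\<omega>. \<exists>l. \<exists>z\<in>cbox a (b l). poly (Q \<omega>) z = 0)"
    by (intro pred_intros_countable measurable_exists_root Q compact_cbox)
  ultimately show ?thesis by simp
qed

text \<open>The roots are separated by dyadic cells, so the sum over the corners of the cells that contain
  a root converges to the sum over the roots. This makes the sum measurable everywhere,
  not just almost everywhere, as the Bochner integral requires.\<close>

lemma measurable_sum_roots:
  fixes Q :: "'w \<Rightarrow> complex poly" and f :: "'w \<Rightarrow> complex \<Rightarrow> real"
  assumes Q[measurable]: "\<And>z. (\<lambda>\<omega>. poly (Q \<omega>) z) \<in> borel_measurable M"
    and f[measurable]: "\<And>z. (\<lambda>\<omega>. f \<omega> z) \<in> borel_measurable M"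
    and cont: "\<And>\<omega>. continuous_on UNIV (f \<omega>)"
  shows "(\<lambda>\<omega>. \<Sum>z | poly (Q \<omega>) z = 0. f \<omega> z) \<in> borel_measurable M"
proof -
  define e where "e = from_nat_into (UNIV :: (int \<times> int) set)"
  have e: "bij e"
    unfolding e_def by (rule bij_betw_from_nat_into) (auto simp: infinite_UNIV_char_0 finite_prod)
  define Z where "Z \<omega> = {z. poly (Q \<omega>) z = 0}" for \<omega>
  \<comment> \<open>The zero polynomial has an infinite root set, and the sum over it is
    \<open>0\<close> by convention; vanishing at all natural numbers detects this case
    measurably.\<close>
  define S where "S m \<omega> = (if \<forall>k::nat. poly (Q \<omega>) (of_nat k) = 0 then 0 else
    (\<Sum>k. if \<exists>z. poly (Q \<omega>) z = 0 \<and> cell_index m z = e k then f \<omega> (cell_corner m (e k)) else 0))" for m \<omega>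
  have [measurable]: "Measurable.pred M (\<lambda>\<omega>. \<exists>z. poly (Q \<omega>) z = 0 \<and> cell_index m z = q)" for m q
    by (rule measurable_exists_root_cell[OF Q])
  have Sm: "S m \<in> borel_measurable M" for m
    unfolding S_def[abs_def] by measurable
  have "(\<lambda>m. S m \<omega>) \<longlonglongrightarrow> (\<Sum>z\<in>Z \<omega>. f \<omega> z)" for \<omega>
  proof (cases "Q \<omega> = 0")
    case True
    then show ?thesis by (simp add: S_def Z_def infinite_UNIV_char_0)
  next
    case False
    have fin: "finite (Z \<omega>)" unfolding Z_def by (rule poly_roots_finite[OF False])
    have nz: "\<not> (\<forall>k::nat. poly (Q \<omega>) (of_nat k) = 0)"
    proof
      assume "\<forall>k::nat. poly (Q \<omega>) (of_nat k) = 0"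
      then have "range (of_nat :: nat \<Rightarrow> complex) \<subseteq> Z \<omega>" by (auto simp: Z_def)
      then have "finite (range (of_nat :: nat \<Rightarrow> complex))" using fin finite_subset by blast
      then show False using finite_imageD[OF _ inj_of_nat] by auto
    qed
    have S_eq: "S m \<omega> = (\<Sum>q\<in>cell_index m ` Z \<omega>. f \<omega> (cell_corner m q))" for m
    proof -
      have "S m \<omega> = (\<Sum>k. if e k \<in> cell_index m ` Z \<omega> then f \<omega> (cell_corner m (e k)) else 0)"
      proof -
        have "(\<exists>z. poly (Q \<omega>) z = 0 \<and> cell_index m z = e k) \<longleftrightarrow> e k \<in> cell_index m ` Z \<omega>" for k
          unfolding Z_def by (auto simp: image_iff eq_commute[of "e k"])
        then show ?thesis unfolding S_def using nz by (simp only: if_False)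
      qed
      also have "\<dots> = (\<Sum>k\<in>inv e ` (cell_index m ` Z \<omega>). if e k \<in> cell_index m ` Z \<omega> then f \<omega> (cell_corner m (e k)) else 0)"
      proof (rule suminf_finite)
        show "finite (inv e ` (cell_index m ` Z \<omega>))" using fin by simp
        fix k assume "k \<notin> inv e ` (cell_index m ` Z \<omega>)"
        then have "e k \<notin> cell_index m ` Z \<omega>" using e by (metis bij_is_inj image_eqI inv_f_f)
        then show "(if e k \<in> cell_index m ` Z \<omega> then f \<omega> (cell_corner m (e k)) else 0) = 0" by simp
      qed
      also have "\<dots> = (\<Sum>q\<in>cell_index m ` Z \<omega>. f \<omega> (cell_corner m q))"
      proof (subst sum.reindex)
        show "inj_on (inv e) (cell_index m ` Z \<omega>)"
          using e by (metis bij_imp_bij_inv bij_is_inj inj_on_subset top_greatest)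
        show "sum ((\<lambda>k. if e k \<in> cell_index m ` Z \<omega> then f \<omega> (cell_corner m (e k)) else 0) \<circ> inv e) (cell_index m ` Z \<omega>) =
          (\<Sum>q\<in>cell_index m ` Z \<omega>. f \<omega> (cell_corner m q))"
          using e by (intro sum.cong) (auto simp: bij_is_surj surj_f_inv_f)
      qed
      finally show ?thesis .
    qed
    \<comment> \<open>Distinct roots are limits of their cell corners, hence eventually lie in
      distinct cells, and \<open>cell_index m\<close> is injective on the finite root set.\<close>
    have "\<forall>\<^sub>F m in sequentially. \<forall>z\<in>Z \<omega>. \<forall>w\<in>Z \<omega>. z \<noteq> w \<longrightarrow> cell_index m z \<noteq> cell_index m w"
    proof (intro eventually_ball_finite[OF fin] ballI)
      fix z w
      show "\<forall>\<^sub>F m in sequentially. z \<noteq> w \<longrightarrow> cell_index m z \<noteq> cell_index m w"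
      proof (cases "z = w")
        case False
        have "(\<lambda>m. cell_corner m (cell_index m z) - cell_corner m (cell_index m w)) \<longlonglongrightarrow> z - w"
          by (intro tendsto_diff cell_corner_tendsto)
        then have "\<forall>\<^sub>F m in sequentially. cell_corner m (cell_index m z) - cell_corner m (cell_index m w) \<noteq> 0"
          by (rule tendsto_imp_eventually_ne) (use False in simp)
        then show ?thesis by eventually_elim auto
      qed simp
    qed
    then have "\<forall>\<^sub>F m in sequentially. S m \<omega> = (\<Sum>z\<in>Z \<omega>. f \<omega> (cell_corner m (cell_index m z)))"
    proof eventually_elim
      case (elim m)
      then have "inj_on (cell_index m) (Z \<omega>)" by (auto simp: inj_on_def)
      then show ?case unfolding S_eq by (simp add: sum.reindex)
    qed
    moreover have "(\<lambda>m. \<Sum>z\<in>Z \<omega>. f \<omega> (cell_corner m (cell_index m z))) \<longlonglongrightarrow> (\<Sum>z\<in>Z \<omega>. f \<omega> z)"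
    proof (intro tendsto_sum)
      fix z
      show "(\<lambda>m. f \<omega> (cell_corner m (cell_index m z))) \<longlonglongrightarrow> f \<omega> z"
        using continuous_on_tendsto_compose[OF cont cell_corner_tendsto] by simp
    qed
    ultimately show ?thesis by (simp add: filterlim_cong)
  qed
  then have "(\<lambda>\<omega>. \<Sum>z\<in>Z \<omega>. f \<omega> z) \<in> borel_measurable M"
    by (intro borel_measurable_LIMSEQ_real[OF _ Sm])
  then show ?thesis by (simp add: Z_def)
qed

subsection \<open>The Kac-Rice formula\<close>

lemma pderiv_sum: "pderiv (\<Sum>i\<in>A. f i) = (\<Sum>i\<in>A. pderiv (f i))"
  by (induction A rule: infinite_finite_induct) (auto simp: pderiv_add)

lemma poly_SU2: "poly (SU2_poly a n \<omega>) z = (\<Sum>j\<le>n. of_real (sqrt (real (n choose j))) * z ^ j * a j \<omega>)"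
  by (simp add: SU2_poly_def poly_sum poly_monom mult_ac)

lemma poly_pderiv_SU2: "poly (pderiv (SU2_poly a n \<omega>)) z =
    (\<Sum>j\<le>n. of_real (real j * sqrt (real (n choose j))) * z ^ (j - 1) * a j \<omega>)"
  by (simp add: SU2_poly_def poly_sum pderiv_sum pderiv_monom poly_monom mult_ac)

abbreviation crit_sum :: "(complex \<Rightarrow> real) \<Rightarrow> complex poly \<Rightarrow> real" where
  "crit_sum g p \<equiv> \<Sum>z\<in>crit_points p. g (poly p z)"

lemma measurable_crit_sum:
  fixes \<psi> :: "complex \<Rightarrow> real"
  assumes [measurable]: "\<And>j. j \<le> n \<Longrightarrow> a j \<in> borel_measurable M" and \<psi>: "continuous_on UNIV \<psi>"
  shows "(\<lambda>\<omega>. crit_sum \<psi> (SU2_poly a n \<omega>)) \<in> borel_measurable M"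
  unfolding crit_points_def
proof (rule measurable_sum_roots)
  have [measurable]: "\<psi> \<in> borel_measurable borel" using \<psi> by (rule borel_measurable_continuous_onI)
  show "(\<lambda>\<omega>. poly (pderiv (SU2_poly a n \<omega>)) z) \<in> borel_measurable M" for z
    unfolding poly_pderiv_SU2 by (intro borel_measurable_sum borel_measurable_times borel_measurable_const) auto
  have P: "(\<lambda>\<omega>. poly (SU2_poly a n \<omega>) z) \<in> borel_measurable M" for z
    unfolding poly_SU2 by (intro borel_measurable_sum borel_measurable_times borel_measurable_const) auto
  show "(\<lambda>\<omega>. \<psi> (poly (SU2_poly a n \<omega>) z)) \<in> borel_measurable M" for z
    using P by measurable
  show "continuous_on UNIV (\<lambda>z. \<psi> (poly (SU2_poly a n \<omega>) z))" for \<omega>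
    by (rule continuous_on_compose2[OF \<psi>]) (auto intro!: continuous_intros)
qed

lemma measurable_crit_functionals [measurable]:
  "(\<lambda>z. crit_h n z j) \<in> borel_measurable borel" "(\<lambda>z. crit_l n z j) \<in> borel_measurable borel"
  "(\<lambda>z. crit_t n z j) \<in> borel_measurable borel"
  unfolding crit_h_def crit_l_def crit_t_def by measurable

lemma measurable_crit_kernel [measurable]:
  "(\<lambda>(r, X). crit_kernel n r X) \<in> borel_measurable (borel \<Otimes>\<^sub>M borel)"
  unfolding crit_kernel_def by measurable

lemma crit_kernel_nonneg: "1 \<le> n \<Longrightarrow> 0 \<le> r \<Longrightarrow> 0 \<le> X \<Longrightarrow> 0 \<le> crit_kernel n r X"
  unfolding crit_kernel_def by (intro divide_nonneg_nonneg mult_nonneg_nonneg add_nonneg_nonneg) auto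

text \<open>With the other coefficients fixed, \<open>p'(z)\<close> is \<open>sqrt n\<close> times
  \<open>y - h(z)\<close>, so the critical points for the value \<open>y\<close> form the fibre of
  \<open>h\<close> over \<open>y\<close>. On that fibre the weight \<open>exp (- |y|^2)\<close> is
  \<open>exp (- |h(z)|^2)\<close>, and the area formula contributes
  \<open>|h'(z)|^2\<close>.\<close>

lemma nn_integral_crit_sum_linear_coefficient:
  fixes \<psi> :: "complex \<Rightarrow> real" and x :: "nat \<Rightarrow> complex"
  assumes n: "2 \<le> n" and \<psi>: "continuous_on UNIV \<psi>" "\<And>w. 0 \<le> \<psi> w"
  shows "(\<integral>\<^sup>+y. ennreal (crit_sum \<psi> (SU2_poly (\<lambda>j x. x j) n (x(1 := y)))) \<partial>cgauss) =
    (\<integral>\<^sup>+z. ennreal (1 / pi) * (ennreal (exp (- (cmod (\<Sum>j\<in>{..n} - {1}. crit_h n z j * x j))\<^sup>2)) *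
        ennreal ((cmod (\<Sum>j\<in>{..n} - {1}. crit_t n z j * x j))\<^sup>2) *
        ennreal (\<psi> (\<Sum>j\<in>{..n} - {1}. crit_l n z j * x j))) \<partial>lborel)"
proof -
  define I where "I = {..n} - {1}"
  define P where "P y = SU2_poly (\<lambda>j x. x j) n (x(1 := y))" for y
  define h where "h = (\<Sum>j\<in>I. monom (- of_real (real j * sqrt (real (n choose j)) / sqrt (real n)) * x j) (j - 1))"
  have [measurable]: "\<psi> \<in> borel_measurable borel" using \<psi>(1) by (rule borel_measurable_continuous_onI)
  have c1: "n > 0" using n by simp
  have h: "poly h z = (\<Sum>j\<in>I. crit_h n z j * x j)" for z
    by (simp add: h_def poly_sum poly_monom crit_h_def mult_ac)
  have h': "poly (pderiv h) z = (\<Sum>j\<in>I. crit_t n z j * x j)" for z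
    unfolding h_def pderiv_sum poly_sum pderiv_monom poly_monom
  proof (rule sum.cong[OF refl])
    fix j
    show "of_nat (j - 1) * (- complex_of_real (real j * sqrt (real (n choose j)) / sqrt (real n)) * x j) * z ^ (j - 1 - 1) =
        crit_t n z j * x j"
      by (cases j) (simp_all add: crit_t_def)
  qed
  have sumI: "(\<Sum>j\<le>n. f j * (x(1 := y)) j) = f 1 * y + (\<Sum>j\<in>I. f j * x j)" for f y
  proof -
    have "(\<Sum>j\<le>n. f j * (x(1 := y)) j) = f 1 * (x(1 := y)) 1 + (\<Sum>j\<in>I. f j * (x(1 := y)) j)"
      unfolding I_def using n by (intro sum.remove) auto
    moreover have "(\<Sum>j\<in>I. f j * (x(1 := y)) j) = (\<Sum>j\<in>I. f j * x j)"
      by (intro sum.cong) (auto simp: I_def)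
    ultimately show ?thesis by simp
  qed
  have sqn: "complex_of_real (sqrt (real n)) \<noteq> 0" using c1 by simp
  have dP: "poly (pderiv (P y)) z = of_real (sqrt (real n)) * (y - poly h z)" for y z
  proof -
    have "poly (pderiv (P y)) z = of_real (sqrt (real n)) * y +
        (\<Sum>j\<in>I. of_real (real j * sqrt (real (n choose j))) * z ^ (j - 1) * x j)"
      unfolding P_def poly_pderiv_SU2 sumI by simp
    also have "(\<Sum>j\<in>I. of_real (real j * sqrt (real (n choose j))) * z ^ (j - 1) * x j) = - of_real (sqrt (real n)) * poly h z"
      unfolding h sum_distrib_left crit_h_def using c1 by (intro sum.cong) auto
    finally show ?thesis by (simp add: algebra_simps)
  qed
  then have roots: "crit_points (P y) = {z. poly h z = y}" for y
    using sqn by (auto simp: crit_points_def)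
  \<comment> \<open>Replacing \<open>y\<close> by \<open>h(z)\<close> expresses the critical value
    through the other coefficients; their weights become \<open>1 - j\<close> times those in
    \<open>p(z)\<close>.\<close>
  have val: "poly (P y) z = (\<Sum>j\<in>I. crit_l n z j * x j)" if "poly h z = y" for y z
  proof -
    have "poly (P y) z = of_real (sqrt (real n)) * z * poly h z +
        (\<Sum>j\<in>I. of_real (sqrt (real (n choose j))) * z ^ j * x j)"
      unfolding P_def poly_SU2 sumI that by simp
    also have "\<dots> = (\<Sum>j\<in>I. (of_real (sqrt (real n)) * z * crit_h n z j + of_real (sqrt (real (n choose j))) * z ^ j) * x j)"
      unfolding h sum_distrib_left by (simp add: sum.distrib[symmetric] algebra_simps)
    also have "\<dots> = (\<Sum>j\<in>I. crit_l n z j * x j)"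
    proof (rule sum.cong[OF refl])
      fix j
      have "of_real (sqrt (real n)) * z * crit_h n z j + of_real (sqrt (real (n choose j))) * z ^ j = crit_l n z j"
        using sqn by (cases j) (simp_all add: crit_h_def crit_l_def field_simps)
      then show "(of_real (sqrt (real n)) * z * crit_h n z j + of_real (sqrt (real (n choose j))) * z ^ j) * x j = crit_l n z j * x j"
        by simp
    qed
    finally show ?thesis .
  qed
  define F where "F z = ennreal (exp (- (cmod (poly h z))\<^sup>2) / pi) * ennreal (\<psi> (\<Sum>j\<in>I. crit_l n z j * x j))" for z
  have [measurable]: "F \<in> borel_measurable borel" unfolding F_def by measurable
  have "(\<lambda>y. crit_sum \<psi> (P y)) =
      (\<lambda>y. \<Sum>z\<in>crit_points (SU2_poly (\<lambda>j y. (x(1 := y)) j) n y). \<psi> (poly (SU2_poly (\<lambda>j y. (x(1 := y)) j) n y) z))"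
    by (simp add: P_def SU2_poly_def)
  moreover have "\<dots> \<in> borel_measurable borel"
    by (rule measurable_crit_sum[OF _ \<psi>(1)]) (auto simp: fun_upd_def)
  ultimately have [measurable]: "(\<lambda>y. crit_sum \<psi> (P y)) \<in> borel_measurable borel"
    by simp
  have "(\<integral>\<^sup>+y. ennreal (crit_sum \<psi> (P y)) \<partial>cgauss) =
      (\<integral>\<^sup>+y. ennreal (exp (- (cmod y)\<^sup>2) / pi) * ennreal (crit_sum \<psi> (P y)) \<partial>lborel)"
    by (rule nn_integral_cgauss) measurable
  also have "\<dots> = (\<integral>\<^sup>+y. (\<Sum>z | poly h z = y. F z) \<partial>lborel)"
  proof (rule nn_integral_cong)
    fix y
    have "ennreal (crit_sum \<psi> (P y)) = (\<Sum>z | poly h z = y. ennreal (\<psi> (poly (P y) z)))"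
      unfolding roots by (rule sum_ennreal[symmetric]) (rule \<psi>(2))
    then have "ennreal (exp (- (cmod y)\<^sup>2) / pi) * ennreal (crit_sum \<psi> (P y)) =
        (\<Sum>z | poly h z = y. ennreal (exp (- (cmod y)\<^sup>2) / pi) * ennreal (\<psi> (poly (P y) z)))"
      by (simp add: sum_distrib_left)
    also have "\<dots> = (\<Sum>z | poly h z = y. F z)"
      by (rule sum.cong[OF refl]) (simp add: F_def val)
    finally show "ennreal (exp (- (cmod y)\<^sup>2) / pi) * ennreal (crit_sum \<psi> (P y)) =
        (\<Sum>z | poly h z = y. F z)" .
  qed
  also have "\<dots> = (\<integral>\<^sup>+z. F z * ennreal ((cmod (poly (pderiv h) z))\<^sup>2) \<partial>lborel)"
    by (rule area_formula_poly) measurable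
  also have "\<dots> = (\<integral>\<^sup>+z. ennreal (1 / pi) * (ennreal (exp (- (cmod (\<Sum>j\<in>I. crit_h n z j * x j))\<^sup>2)) *
        ennreal ((cmod (\<Sum>j\<in>I. crit_t n z j * x j))\<^sup>2) *
        ennreal (\<psi> (\<Sum>j\<in>I. crit_l n z j * x j))) \<partial>lborel)"
  proof (rule nn_integral_cong)
    fix z
    have "ennreal (exp (- (cmod (poly h z))\<^sup>2) / pi) = ennreal (1 / pi) * ennreal (exp (- (cmod (poly h z))\<^sup>2))"
      by (simp add: ennreal_mult[symmetric])
    then show "F z * ennreal ((cmod (poly (pderiv h) z))\<^sup>2) =
      ennreal (1 / pi) * (ennreal (exp (- (cmod (\<Sum>j\<in>I. crit_h n z j * x j))\<^sup>2)) *
        ennreal ((cmod (\<Sum>j\<in>I. crit_t n z j * x j))\<^sup>2) *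
        ennreal (\<psi> (\<Sum>j\<in>I. crit_l n z j * x j)))"
      unfolding F_def h' h by (simp only: mult_ac)
  qed
  finally show ?thesis unfolding P_def I_def .
qed

text \<open>Tonelli brings the integral over \<open>z\<close> outside, where for each
  \<open>z\<close> the remaining coefficients contribute the functional computed above. The kernel
  sees \<open>z\<close> only through its squared modulus, and polar coordinates give the factor
  \<open>pi\<close> that cancels \<open>1 / pi\<close>.\<close>

lemma nn_integral_crit_sum_cgauss:
  fixes \<psi> :: "complex \<Rightarrow> real"
  assumes n: "2 \<le> n" and \<psi>: "continuous_on UNIV \<psi>" "\<And>w. 0 \<le> \<psi> w"
  shows "(\<integral>\<^sup>+x. ennreal (crit_sum \<psi> (SU2_poly (\<lambda>j x. x j) n x))
        \<partial>Pi\<^sub>M {..n} (\<lambda>_. cgauss)) =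
    (\<integral>\<^sup>+w. ennreal (\<psi> w) * (\<integral>\<^sup>+r. indicator {0..} r * ennreal (crit_kernel n r ((cmod w)\<^sup>2)) \<partial>lborel) \<partial>lborel)"
proof -
  define I where "I = {..n} - {1}"
  have I: "finite I" "1 \<notin> I" "insert 1 I = {..n}" using n by (auto simp: I_def)
  have [measurable]: "\<psi> \<in> borel_measurable borel" using \<psi>(1) by (rule borel_measurable_continuous_onI)
  let ?G = "\<lambda>x. crit_sum \<psi> (SU2_poly (\<lambda>j x. x j) n x)"
  have [measurable]: "?G \<in> borel_measurable (Pi\<^sub>M {..n} (\<lambda>_. cgauss))"
    by (rule measurable_crit_sum[OF _ \<psi>(1)]) measurable
  interpret PI: finite_product_sigma_finite "\<lambda>_. cgauss" I by standard (rule I(1))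
  interpret PL: pair_sigma_finite "Pi\<^sub>M I (\<lambda>_. cgauss)" "lborel :: complex measure" ..
  have "(\<integral>\<^sup>+x. ennreal (?G x) \<partial>Pi\<^sub>M {..n} (\<lambda>_. cgauss)) =
     (\<integral>\<^sup>+x. \<integral>\<^sup>+y. ennreal (?G (x(1 := y))) \<partial>cgauss \<partial>Pi\<^sub>M I (\<lambda>_. cgauss))"
    using cgauss_product.product_nn_integral_insert[OF I(1,2), of "\<lambda>x. ennreal (?G x)"] unfolding I(3) by simp
  also have "\<dots> = (\<integral>\<^sup>+x. \<integral>\<^sup>+z. ennreal (1 / pi) * (ennreal (exp (- (cmod (\<Sum>j\<in>I. crit_h n z j * x j))\<^sup>2)) *
        ennreal ((cmod (\<Sum>j\<in>I. crit_t n z j * x j))\<^sup>2) *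
        ennreal (\<psi> (\<Sum>j\<in>I. crit_l n z j * x j))) \<partial>lborel \<partial>Pi\<^sub>M I (\<lambda>_. cgauss))"
    unfolding I_def by (rule nn_integral_cong, rule nn_integral_crit_sum_linear_coefficient[OF n \<psi>])
  also have "\<dots> = (\<integral>\<^sup>+z. \<integral>\<^sup>+x. ennreal (1 / pi) * (ennreal (exp (- (cmod (\<Sum>j\<in>I. crit_h n z j * x j))\<^sup>2)) *
        ennreal ((cmod (\<Sum>j\<in>I. crit_t n z j * x j))\<^sup>2) *
        ennreal (\<psi> (\<Sum>j\<in>I. crit_l n z j * x j))) \<partial>Pi\<^sub>M I (\<lambda>_. cgauss) \<partial>lborel)"
    by (rule PL.Fubini'[symmetric]) measurable
  also have "\<dots> = (\<integral>\<^sup>+z. ennreal (1 / pi) * (\<integral>\<^sup>+x. ennreal (exp (- (cmod (\<Sum>j\<in>I. crit_h n z j * x j))\<^sup>2)) *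
        ennreal ((cmod (\<Sum>j\<in>I. crit_t n z j * x j))\<^sup>2) *
        ennreal (\<psi> (\<Sum>j\<in>I. crit_l n z j * x j)) \<partial>Pi\<^sub>M I (\<lambda>_. cgauss)) \<partial>lborel)"
    by (rule nn_integral_cong, rule nn_integral_cmult) measurable
  also have "\<dots> = (\<integral>\<^sup>+z. ennreal (1 / pi) * (\<integral>\<^sup>+w. ennreal (crit_kernel n ((cmod z)\<^sup>2) ((cmod w)\<^sup>2)) * ennreal (\<psi> w) \<partial>lborel) \<partial>lborel)"
    unfolding I_def by (subst nn_integral_crit_functionals[OF n]) auto
  also have "\<dots> = ennreal (1 / pi) * (\<integral>\<^sup>+z. \<integral>\<^sup>+w. ennreal (crit_kernel n ((cmod z)\<^sup>2) ((cmod w)\<^sup>2)) * ennreal (\<psi> w) \<partial>lborel \<partial>lborel)"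
    by (rule nn_integral_cmult) measurable
  also have "(\<integral>\<^sup>+z. \<integral>\<^sup>+w. ennreal (crit_kernel n ((cmod z)\<^sup>2) ((cmod w)\<^sup>2)) * ennreal (\<psi> w) \<partial>lborel \<partial>(lborel :: complex measure)) =
      (\<integral>\<^sup>+w. \<integral>\<^sup>+z. ennreal (crit_kernel n ((cmod z)\<^sup>2) ((cmod w)\<^sup>2)) * ennreal (\<psi> w) \<partial>lborel \<partial>lborel)"
    by (rule lborel_pair.Fubini') measurable
  also have "\<dots> = (\<integral>\<^sup>+w. ennreal pi * (ennreal (\<psi> w) * (\<integral>\<^sup>+r. indicator {0..} r * ennreal (crit_kernel n r ((cmod w)\<^sup>2)) \<partial>lborel)) \<partial>lborel)"
  proof (rule nn_integral_cong)
    fix w :: complex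
    have "(\<integral>\<^sup>+z. ennreal (crit_kernel n ((cmod z)\<^sup>2) ((cmod w)\<^sup>2)) * ennreal (\<psi> w) \<partial>(lborel :: complex measure)) =
        (\<integral>\<^sup>+z. ennreal (crit_kernel n ((cmod z)\<^sup>2) ((cmod w)\<^sup>2)) \<partial>(lborel :: complex measure)) * ennreal (\<psi> w)"
      by (rule nn_integral_multc) measurable
    also have "(\<integral>\<^sup>+z. ennreal (crit_kernel n ((cmod z)\<^sup>2) ((cmod w)\<^sup>2)) \<partial>(lborel :: complex measure)) =
        ennreal pi * (\<integral>\<^sup>+r. indicator {0..} r * ennreal (crit_kernel n r ((cmod w)\<^sup>2)) \<partial>lborel)"
      by (rule nn_integral_cmod_square) measurable
    finally show "(\<integral>\<^sup>+z. ennreal (crit_kernel n ((cmod z)\<^sup>2) ((cmod w)\<^sup>2)) * ennreal (\<psi> w) \<partial>(lborel :: complex measure)) =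
        ennreal pi * (ennreal (\<psi> w) * (\<integral>\<^sup>+r. indicator {0..} r * ennreal (crit_kernel n r ((cmod w)\<^sup>2)) \<partial>lborel))"
      by (simp only: mult_ac)
  qed
  also have "\<dots> = ennreal pi * (\<integral>\<^sup>+w. ennreal (\<psi> w) * (\<integral>\<^sup>+r. indicator {0..} r * ennreal (crit_kernel n r ((cmod w)\<^sup>2)) \<partial>lborel) \<partial>lborel)"
    by (rule nn_integral_cmult) measurable
  also have "ennreal (1 / pi) * \<dots> = (\<integral>\<^sup>+w. ennreal (\<psi> w) * (\<integral>\<^sup>+r. indicator {0..} r * ennreal (crit_kernel n r ((cmod w)\<^sup>2)) \<partial>lborel) \<partial>lborel)"
    by (simp add: mult.assoc[symmetric] ennreal_mult[symmetric])
  finally show ?thesis .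
qed

text \<open>Independence makes the joint law of the coefficients \<open>0\<close> to
  \<open>n\<close> a product of standard Gaussians, and \<open>SU2_poly a n\<close> reads no
  others.\<close>

theorem nn_integral_crit_sum:
  fixes M :: "'w measure" and a :: "nat \<Rightarrow> 'w \<Rightarrow> complex" and \<psi> :: "complex \<Rightarrow> real"
  assumes M: "prob_space M"
    and indep: "prob_space.indep_vars M (\<lambda>_. borel) a UNIV"
    and dist: "\<And>j. distributed M lborel (a j) (\<lambda>z. ennreal (exp (- (cmod z)\<^sup>2) / pi))"
    and n: "2 \<le> n" and \<psi>: "continuous_on UNIV \<psi>" "\<And>w. 0 \<le> \<psi> w"
  shows "(\<integral>\<^sup>+\<omega>. ennreal (crit_sum \<psi> (SU2_poly a n \<omega>)) \<partial>M) =
    (\<integral>\<^sup>+w. ennreal (\<psi> w) * (\<integral>\<^sup>+r. indicator {0..} r * ennreal (crit_kernel n r ((cmod w)\<^sup>2)) \<partial>lborel) \<partial>lborel)"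
proof -
  interpret M: prob_space M by (rule M)
  have am[measurable]: "a j \<in> borel_measurable M" for j
    using dist[of j] by (simp add: distributed_def)
  have da: "distr M borel (a j) = cgauss" for j
  proof -
    have "distr M borel (a j) = distr M lborel (a j)" by (rule distr_cong) auto
    also have "\<dots> = cgauss" using dist[of j] by (simp add: distributed_def cgauss_def)
    finally show ?thesis .
  qed
  have "M.indep_vars (\<lambda>_. borel) a {..n}" using indep by (rule M.indep_vars_subset) simp
  then have "distr M (Pi\<^sub>M {..n} (\<lambda>_. borel)) (\<lambda>\<omega>. \<lambda>j\<in>{..n}. a j \<omega>) = Pi\<^sub>M {..n} (\<lambda>_. cgauss)"
    by (subst (asm) M.indep_vars_iff_distr_eq_PiM) (auto simp: da)
  note D = this[symmetric]
  have [measurable]: "(\<lambda>x. crit_sum \<psi> (SU2_poly (\<lambda>j x. x j) n x)) \<in>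
      borel_measurable (Pi\<^sub>M {..n} (\<lambda>_. borel))"
    by (rule measurable_crit_sum[OF _ \<psi>(1)]) measurable
  have P: "SU2_poly (\<lambda>j x. x j) n (\<lambda>j\<in>{..n}. a j \<omega>) = SU2_poly a n \<omega>" for \<omega>
    unfolding SU2_poly_def by (intro sum.cong) auto
  show ?thesis
    unfolding nn_integral_crit_sum_cgauss[OF n \<psi>, symmetric] D
    by (subst nn_integral_distr) (auto simp: P)
qed

subsection \<open>The density of critical values\<close>

definition crit_A :: "nat \<Rightarrow> real \<Rightarrow> real" where
  "crit_A n r = (1 + n * r) / (1 + r) ^ n"

abbreviation crit_integrand :: "nat \<Rightarrow> real \<Rightarrow> real \<Rightarrow> real" where
  "crit_integrand n X r \<equiv> exp (- X * crit_A n r) * crit_A n r / (1 + r)\<^sup>2"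

definition crit_D :: "nat \<Rightarrow> real \<Rightarrow> real" where
  "crit_D n X = (real n - 1) / pi * (LINT r:{0..}|lborel. crit_integrand n X r)"

lemma crit_A_pos: "0 \<le> r \<Longrightarrow> 0 < crit_A n r"
  unfolding crit_A_def by (intro divide_pos_pos add_pos_nonneg zero_less_power) auto

lemma crit_A_le_1: "0 \<le> r \<Longrightarrow> crit_A n r \<le> 1"
  unfolding crit_A_def using Bernoulli_inequality[of r n] by (simp add: divide_le_eq_1)

lemma measurable_crit_A [measurable]: "crit_A n \<in> borel_measurable borel"
  unfolding crit_A_def[abs_def] by measurable

lemma nn_integral_inverse_square:
  "(\<integral>\<^sup>+r. ennreal (1 / (1 + r)\<^sup>2) * indicator {0..} r \<partial>lborel) = 1"
proof -
  have "(\<integral>\<^sup>+r. ennreal (1 / (1 + r)\<^sup>2) * indicator {0..} r \<partial>lborel) = ennreal (0 - (- (1 / (1 + 0))))"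
  proof (rule nn_integral_FTC_atLeast)
    show "((\<lambda>r::real. - (1 / (1 + r))) \<longlongrightarrow> 0) at_top" by real_asymp
    show "DERIV (\<lambda>r. - (1 / (1 + r))) r :> 1 / (1 + r)\<^sup>2" if "0 \<le> r" for r :: real
      using that by (auto intro!: derivative_eq_intros simp: power2_eq_square divide_simps)
  qed auto
  then show ?thesis by simp
qed

lemma integrable_inverse_square: "set_integrable lborel {0..} (\<lambda>r::real. 1 / (1 + r)\<^sup>2)"
  unfolding set_integrable_def
proof (rule integrableI_nonneg)
  have "(\<integral>\<^sup>+r. ennreal (indicator {0..} r *\<^sub>R (1 / (1 + r)\<^sup>2)) \<partial>lborel) = (\<integral>\<^sup>+r. ennreal (1 / (1 + r)\<^sup>2) * indicator {0..} r \<partial>lborel)"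
    by (intro nn_integral_cong) (auto simp: indicator_def)
  then show "(\<integral>\<^sup>+r. ennreal (indicator {0..} r *\<^sub>R (1 / (1 + r)\<^sup>2)) \<partial>lborel) < \<infinity>"
    by (simp add: nn_integral_inverse_square)
qed auto

text \<open>Since \<open>crit_A n r\<close> lies between \<open>0\<close> and \<open>1\<close>, the
  majorant is free of both \<open>n\<close> and \<open>X\<close>; it serves for continuity in
  \<open>X\<close> and for the limit at negative \<open>x\<close>.\<close>

lemma crit_D_integrand_bound:
  assumes "0 \<le> r" "0 \<le> X"
  shows "0 \<le> crit_integrand n X r"
    and "crit_integrand n X r \<le> 1 / (1 + r)\<^sup>2"
proof -
  have A: "0 < crit_A n r" "crit_A n r \<le> 1" using assms crit_A_pos crit_A_le_1 by auto
  show "0 \<le> crit_integrand n X r" using A by simp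
  have "exp (- X * crit_A n r) * crit_A n r \<le> 1 * 1"
    using A assms by (intro mult_mono) auto
  then show "crit_integrand n X r \<le> 1 / (1 + r)\<^sup>2"
    by (intro divide_right_mono) auto
qed

lemma integrable_crit_D:
  assumes "0 \<le> X"
  shows "set_integrable lborel {0..} (\<lambda>r. crit_integrand n X r)"
  unfolding set_integrable_def
proof (rule Bochner_Integration.integrable_bound[OF integrable_inverse_square[unfolded set_integrable_def]])
  show "AE r in lborel. norm (indicator {0..} r *\<^sub>R (crit_integrand n X r)) \<le>
      norm (indicator {0..} r *\<^sub>R (1 / (1 + r)\<^sup>2) :: real)"
    using crit_D_integrand_bound[OF _ assms] by (intro AE_I2) (auto simp: indicator_def abs_mult crit_A_pos less_imp_le)
qed measurable

lemma crit_D_nonneg: "1 \<le> n \<Longrightarrow> 0 \<le> X \<Longrightarrow> 0 \<le> crit_D n X"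
  unfolding crit_D_def set_lebesgue_integral_def
  using crit_D_integrand_bound(1)[of _ X n]
  by (intro mult_nonneg_nonneg Bochner_Integration.integral_nonneg) (auto simp: indicator_def)

lemma continuous_on_crit_D: "continuous_on {0..} (crit_D n)"
  unfolding continuous_on_sequentially
proof (intro allI impI ballI, elim conjE)
  fix X :: "nat \<Rightarrow> real" and X0
  assume X0: "X0 \<in> {0..}" and X: "\<forall>m. X m \<in> {0..}" and lim: "X \<longlonglongrightarrow> X0"
  have "(\<lambda>m. LINT r|lborel. indicator {0..} r *\<^sub>R (crit_integrand n (X m) r)) \<longlonglongrightarrow>
      (LINT r|lborel. indicator {0..} r *\<^sub>R (crit_integrand n X0 r))"
  proof (rule integral_dominated_convergence[OF _ _ integrable_inverse_square[unfolded set_integrable_def]])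
    show "AE r in lborel. (\<lambda>m. indicator {0..} r *\<^sub>R (crit_integrand n (X m) r)) \<longlonglongrightarrow>
        indicator {0..} r *\<^sub>R (crit_integrand n X0 r)"
    proof (rule AE_I2)
      fix r :: real
      show "(\<lambda>m. indicator {0..} r *\<^sub>R (crit_integrand n (X m) r)) \<longlonglongrightarrow>
        indicator {0..} r *\<^sub>R (crit_integrand n X0 r)"
        by (cases "r \<ge> 0") (auto intro!: tendsto_intros lim)
    qed
    show "AE r in lborel. norm (indicator {0..} r *\<^sub>R (crit_integrand n (X m) r)) \<le>
      indicator {0..} r *\<^sub>R (1 / (1 + r)\<^sup>2)" for m
      using crit_D_integrand_bound[of _ "X m" n] X
      by (intro AE_I2) (auto simp: indicator_def abs_mult crit_A_pos less_imp_le)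
  qed measurable
  then show "(crit_D n \<circ> X) \<longlonglongrightarrow> crit_D n X0"
    unfolding crit_D_def set_lebesgue_integral_def o_def by (intro tendsto_intros)
qed

section \<open>From the kernel to the density by integration by parts\<close>

lemma DERIV_crit_A:
  assumes "0 \<le> r" "1 \<le> n"
  shows "DERIV (crit_A n) r :> - (n * (real n - 1) * r / (1 + r) ^ (n + 1))"
proof -
  obtain m where n: "n = Suc m" using assms by (cases n) auto
  have u: "1 + r \<noteq> 0" using assms by simp
  have "DERIV (\<lambda>r. (1 + real n * r) / (1 + r) ^ n) r :>
      (n * (1 + r) ^ n - (1 + n * r) * (n * (1 + r) ^ (n - 1))) / ((1 + r) ^ n * (1 + r) ^ n)"
    using u by (auto intro!: derivative_eq_intros)
  also have "(n * (1 + r) ^ n - (1 + n * r) * (n * (1 + r) ^ (n - 1))) / ((1 + r) ^ n * (1 + r) ^ n) =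
      (1 + r) ^ m * (n * (1 + r) - (1 + n * r) * n) / ((1 + r) ^ m * ((1 + r) ^ n * (1 + r)))"
    unfolding n by (simp add: algebra_simps)
  also have "\<dots> = (n * (1 + r) - (1 + n * r) * n) / ((1 + r) ^ n * (1 + r))"
    using u by simp
  also have "\<dots> = - (n * (real n - 1) * r / (1 + r) ^ (n + 1))"
    unfolding minus_divide_left by (rule arg_cong2[where f="(/)"]) (simp_all add: algebra_simps)
  finally show ?thesis by (simp add: crit_A_def[abs_def])
qed

text \<open>The two integrands differ by the derivative of \<open>(n - 1) / \<pi> * r / (1 + r) ^ (n + 1) * exp (- X * A)\<close>,
  where \<open>A = crit_A n r\<close>, and this function vanishes at both ends.\<close>

lemma nn_integral_crit_kernel:
  assumes n: "2 \<le> n" and X: "0 \<le> X"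
  shows "(\<integral>\<^sup>+r. indicator {0..} r * ennreal (crit_kernel n r X) \<partial>lborel) = ennreal (crit_D n X)"
proof -
  define c where "c = (real n - 1) / pi"
  have c: "c > 0" using n by (simp add: c_def)
  define T where "T r = c * (crit_integrand n X r)" for r
  define B where "B r = c * (r / (1 + r) ^ (n + 1) * exp (- X * crit_A n r))" for r
  define B' where "B' r = c * exp (- X * crit_A n r) *
    ((1 - n * r) / ((1 + r) ^ n * (1 + r)\<^sup>2) + n * (real n - 1) * r\<^sup>2 * X / ((1 + r) ^ n * (1 + r) ^ n * (1 + r)\<^sup>2))" for r :: real
  have [measurable]: "T \<in> borel_measurable borel" "B' \<in> borel_measurable borel"
    unfolding T_def[abs_def] B'_def[abs_def] by measurable
  have K: "crit_kernel n r X = T r + B' r" if r: "0 \<le> r" for r :: real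
  proof -
    define u where "u = 1 + r"
    define U where "U = u ^ n"
    have u: "u \<noteq> 0" "U \<noteq> 0" using r by (auto simp: U_def u_def)
    show ?thesis
      unfolding crit_kernel_def T_def B'_def crit_A_def c_def u_def[symmetric] U_def[symmetric]
      using u by (simp add: field_simps power2_eq_square)
  qed
  have DB: "DERIV B r :> B' r" if r: "0 \<le> r" for r :: real
  proof -
    define u where "u = 1 + r"
    define U where "U = u ^ n"
    have u: "u \<noteq> 0" "U \<noteq> 0" using r by (auto simp: U_def u_def)
    have "DERIV (\<lambda>r. r / (1 + r) ^ (n + 1)) r :>
        (1 * (1 + r) ^ (n + 1) - r * (real (n + 1) * (1 + r) ^ n)) / ((1 + r) ^ (n + 1) * (1 + r) ^ (n + 1))"
    proof (rule DERIV_divide[OF DERIV_ident])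
      have "DERIV (\<lambda>r. 1 + r) r :> 1" by (auto intro!: derivative_eq_intros)
      from DERIV_fun_pow[OF this, of "n + 1"]
      show "DERIV (\<lambda>r. (1 + r) ^ (n + 1)) r :> real (n + 1) * (1 + r) ^ n" by simp
      show "(1 + r) ^ (n + 1) \<noteq> 0" using r by simp
    qed
    also have "(1 * (1 + r) ^ (n + 1) - r * (real (n + 1) * (1 + r) ^ n)) / ((1 + r) ^ (n + 1) * (1 + r) ^ (n + 1)) =
        (U * (1 - n * r)) / (U * (U * u * u))"
      by (rule arg_cong2[where f="(/)"]) (simp_all add: U_def u_def algebra_simps)
    also have "\<dots> = (1 - n * r) / (U * u\<^sup>2)" using u by (simp add: power2_eq_square)
    finally have 1: "DERIV (\<lambda>r. r / (1 + r) ^ (n + 1)) r :> (1 - n * r) / (U * u\<^sup>2)" .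
    have 2: "DERIV (\<lambda>r. exp (- X * crit_A n r)) r :> exp (- X * crit_A n r) * (X * (n * (real n - 1) * r / (U * u)))"
      using DERIV_crit_A[OF r, of n] n unfolding U_def u_def
      by (auto intro!: derivative_eq_intros simp: mult_ac)
    have "DERIV B r :> c * ((1 - n * r) / (U * u\<^sup>2) * exp (- X * crit_A n r) +
        exp (- X * crit_A n r) * (X * (n * (real n - 1) * r / (U * u))) * (r / (1 + r) ^ (n + 1)))"
      unfolding B_def[abs_def] by (intro DERIV_cmult DERIV_mult 1 2)
    moreover have "c * ((1 - n * r) / (U * u\<^sup>2) * exp (- X * crit_A n r) +
        exp (- X * crit_A n r) * (X * (n * (real n - 1) * r / (U * u))) * (r / (1 + r) ^ (n + 1))) = B' r"
    proof -
      have p: "(1 + r) ^ (n + 1) = U * u" by (simp add: U_def u_def mult.commute)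
      have *: "c * (P * E + E * (X * (N * r / (U * u))) * (r / (U * u))) = c * E * (P + N * r\<^sup>2 * X / (U * U * u\<^sup>2))"
        for P E N by (simp add: algebra_simps power2_eq_square)
      show ?thesis
        unfolding B'_def u_def[symmetric] U_def[symmetric] p[unfolded u_def[symmetric]] * ..
    qed
    ultimately show ?thesis by (simp only:)
  qed
  \<comment> \<open>A crude bound for fixed \<open>n\<close> and \<open>X\<close>; it only has to
    make \<open>B'\<close> integrable, so that the boundary values determine its integral.\<close>
  have Bb: "\<bar>B' r\<bar> \<le> c * (1 + n * real n * X) * (1 / (1 + r)\<^sup>2)" if r: "0 \<le> r" for r :: real
  proof -
    have A1: "(1 + n * r) / (1 + r) ^ n \<le> 1" using crit_A_le_1[OF r, of n] by (simp add: crit_A_def)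
    have "\<bar>(1 - n * r) / ((1 + r) ^ n * (1 + r)\<^sup>2)\<bar> \<le> (1 + n * r) / ((1 + r) ^ n * (1 + r)\<^sup>2)"
    proof -
      have "\<bar>1 - real n * r\<bar> \<le> 1 + n * r" using mult_nonneg_nonneg[of "real n" r] r by linarith
      then show ?thesis using r by (simp add: abs_mult divide_right_mono)
    qed
    also have "\<dots> = (1 + n * r) / (1 + r) ^ n * (1 / (1 + r)\<^sup>2)" by simp
    also have "\<dots> \<le> 1 * (1 / (1 + r)\<^sup>2)" by (intro mult_right_mono A1) auto
    finally have 1: "\<bar>(1 - n * r) / ((1 + r) ^ n * (1 + r)\<^sup>2)\<bar> \<le> 1 / (1 + r)\<^sup>2" by simp
    have "r\<^sup>2 \<le> (1 + r) ^ n * (1 + r) ^ n"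
    proof -
      have "r\<^sup>2 \<le> (1 + r)\<^sup>2" using r by (intro power_mono) auto
      also have "\<dots> \<le> (1 + r) ^ (n + n)" using r n by (intro power_increasing) auto
      finally show ?thesis by (simp add: power_add)
    qed
    then have "r\<^sup>2 / ((1 + r) ^ n * (1 + r) ^ n) \<le> 1" using r by (simp add: divide_le_eq_1)
    then have "n * (real n - 1) * X * (r\<^sup>2 / ((1 + r) ^ n * (1 + r) ^ n)) \<le> n * real n * X * 1"
      using n X r by (intro mult_mono) auto
    then have "n * (real n - 1) * X * (r\<^sup>2 / ((1 + r) ^ n * (1 + r) ^ n)) * (1 / (1 + r)\<^sup>2) \<le> n * real n * X * 1 * (1 / (1 + r)\<^sup>2)"
      by (intro mult_right_mono) auto
    then have 2: "\<bar>n * (real n - 1) * r\<^sup>2 * X / ((1 + r) ^ n * (1 + r) ^ n * (1 + r)\<^sup>2)\<bar> \<le> n * real n * X * (1 / (1 + r)\<^sup>2)"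
      using n X r by (simp add: abs_mult mult_ac)
    have "\<bar>B' r\<bar> = c * exp (- X * crit_A n r) * \<bar>(1 - n * r) / ((1 + r) ^ n * (1 + r)\<^sup>2) + n * (real n - 1) * r\<^sup>2 * X / ((1 + r) ^ n * (1 + r) ^ n * (1 + r)\<^sup>2)\<bar>"
      unfolding B'_def using c by (simp add: abs_mult)
    also have "\<dots> \<le> c * 1 * (1 / (1 + r)\<^sup>2 + n * real n * X * (1 / (1 + r)\<^sup>2))"
      using c X crit_A_pos[OF r, of n] 1 2
      by (intro mult_mono order_trans[OF abs_triangle_ineq] add_mono) auto
    also have "\<dots> = c * (1 + n * real n * X) * (1 / (1 + r)\<^sup>2)"
      by (simp add: algebra_simps)
    finally show ?thesis .
  qed
  have intB: "set_integrable lborel {0..} B'"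
    unfolding set_integrable_def
  proof (rule Bochner_Integration.integrable_bound)
    show "integrable lborel (\<lambda>r. c * (1 + n * real n * X) * (indicator {0..} r *\<^sub>R (1 / (1 + r)\<^sup>2)))"
      by (intro integrable_mult_right integrable_inverse_square[unfolded set_integrable_def])
    show "AE r in lborel. norm (indicator {0..} r *\<^sub>R B' r) \<le> norm (c * (1 + n * real n * X) * (indicator {0..} r *\<^sub>R (1 / (1 + r)\<^sup>2)))"
      using Bb c X by (intro AE_I2) (auto simp: indicator_def abs_mult)
  qed measurable
  have intT: "set_integrable lborel {0..} T"
    unfolding T_def by (intro set_integrable_mult_right integrable_crit_D X)
  have "(LBINT r=ereal 0..\<infinity>. B' r) = 0 - 0"
  proof (rule interval_integral_FTC_integrable)
    show "(B has_vector_derivative B' r) (at r)" if "ereal 0 < ereal r" for r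
      using DB[of r] that by (simp add: has_real_derivative_iff_has_vector_derivative)
    show "isCont B' r" if "ereal 0 < ereal r" for r
    proof -
      have "isCont (crit_A n) r" using DERIV_isCont[OF DERIV_crit_A[of r n]] that n by auto
      then show ?thesis unfolding B'_def[abs_def] using that by (auto intro!: continuous_intros)
    qed
    show "set_integrable lborel (einterval (ereal 0) \<infinity>) B'"
      by (rule set_integrable_subset[OF intB]) (auto simp: einterval_def)
    \<comment> \<open>At the origin \<open>B\<close> vanishes through its factor \<open>r\<close>;
      at infinity it is bounded by a multiple of \<open>1 / (1 + r)\<close>.\<close>
    have "(B \<longlongrightarrow> B 0) (at_right 0)"
      using DERIV_isCont[OF DB[of 0]] by (auto simp: isCont_def intro: tendsto_mono[OF at_le])
    then show "((B \<circ> real_of_ereal) \<longlongrightarrow> 0) (at_right (ereal 0))"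
      by (simp add: ereal_tendsto_simps B_def)
    have "(B \<longlongrightarrow> 0) at_top"
    proof (rule Lim_null_comparison)
      show "\<forall>\<^sub>F r in at_top. norm (B r) \<le> c * (1 / (1 + r))"
        using eventually_ge_at_top[of 0]
      proof eventually_elim
        case (elim r)
        have "r / (1 + r) ^ (n + 1) \<le> 1 / (1 + r)"
        proof -
          have "r * 1 \<le> (1 + r) ^ n"
            using elim n power_increasing[of 1 n "1 + r"] by simp
          then have "r / (1 + r) ^ n \<le> 1" using elim by (simp add: divide_le_eq_1)
          then have "r / (1 + r) ^ n * (1 / (1 + r)) \<le> 1 * (1 / (1 + r))"
            using elim by (intro mult_right_mono) auto
          then show ?thesis by (simp add: mult.commute)
        qed
        then have "r / (1 + r) ^ (n + 1) * exp (- X * crit_A n r) \<le> 1 / (1 + r) * 1"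
          using elim X crit_A_pos[OF elim, of n] by (intro mult_mono) auto
        then have "B r \<le> c * (1 / (1 + r) * 1)" unfolding B_def using c by (intro mult_left_mono) auto
        moreover have "0 \<le> B r" using elim c by (simp add: B_def)
        ultimately show ?case by simp
      qed
      show "((\<lambda>r. c * (1 / (1 + r))) \<longlongrightarrow> 0) at_top" by real_asymp
    qed
    then show "((B \<circ> real_of_ereal) \<longlongrightarrow> 0) (at_left \<infinity>)"
      by (simp add: ereal_tendsto_simps)
  qed simp
  then have B0: "(LINT r:{0..}|lborel. B' r) = 0"
  proof -
    have "(LINT r:{0..}|lborel. B' r) = (LINT r:{0<..}|lborel. B' r)"
    proof (rule set_integral_cong_set)
      have "AE r in lborel. r \<noteq> (0::real)" by (rule AE_lborel_singleton)
      then show "AE r in lborel. (r \<in> {0::real<..}) = (r \<in> {0..})"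
        by eventually_elim auto
    qed (auto simp: set_borel_measurable_def)
    also have "{0::real<..} = einterval (ereal 0) \<infinity>" by (auto simp: einterval_def)
    finally show ?thesis using \<open>(LBINT r=ereal 0..\<infinity>. B' r) = 0 - 0\<close> by (simp add: interval_lebesgue_integral_def)
  qed
  have intK: "set_integrable lborel {0..} (\<lambda>r. crit_kernel n r X)"
    by (rule set_integrable_cong[THEN iffD2, OF refl refl _ set_integral_add(1)[OF intT intB]]) (simp add: K)
  have "(\<integral>\<^sup>+r. indicator {0..} r * ennreal (crit_kernel n r X) \<partial>lborel) =
      (\<integral>\<^sup>+r. ennreal (indicator {0..} r *\<^sub>R crit_kernel n r X) \<partial>lborel)"
    by (intro nn_integral_cong) (auto simp: indicator_def)
  also have "\<dots> = ennreal (LINT r:{0..}|lborel. crit_kernel n r X)"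
    unfolding set_lebesgue_integral_def
    using intK n X by (intro nn_integral_eq_integral) (auto simp: set_integrable_def indicator_def crit_kernel_nonneg)
  also have "(LINT r:{0..}|lborel. crit_kernel n r X) = (LINT r:{0..}|lborel. T r + B' r)"
    by (rule set_lebesgue_integral_cong) (auto simp: K)
  also have "\<dots> = (LINT r:{0..}|lborel. T r) + (LINT r:{0..}|lborel. B' r)"
    by (rule set_integral_add(2)[OF intT intB])
  also have "\<dots> = crit_D n X"
    unfolding B0 T_def crit_D_def c_def by (simp only: set_integral_mult_right add_0_right)
  finally show ?thesis .
qed

subsection \<open>Limit at the critical radius\<close>

text \<open>A lower bound for \<open>(1 + s / n) ^ n\<close> that is cubic in \<open>s\<close> and
  uniform in \<open>n\<close> yields an integrable majorant for \<open>1 + s\<close> divided by that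
  power. Bernoulli with exponent \<open>k = n div 3\<close> gives each of the three factors;
  \<open>n \<le> 5 * k\<close> for \<open>n \<ge> 3\<close>, with equality at \<open>n = 5\<close>,
  explains the constant \<open>5\<close>.\<close>

lemma power_ge_cube:
  fixes s :: real
  assumes s: "0 \<le> s" and n: "3 \<le> n"
  shows "(1 + s / 5) ^ 3 \<le> (1 + s / n) ^ n"
proof -
  define k where "k = n div 3"
  have "n < 3 * k + 3" "3 * k \<le> n" by (simp_all add: k_def)
  moreover from this n have "1 \<le> k" by linarith
  ultimately have k: "3 * k \<le> n" "n \<le> 5 * k" by linarith+
  have "s / 5 \<le> k * (s / n)"
  proof -
    have "real n \<le> 5 * real k" using k(2) by (metis of_nat_le_iff of_nat_mult of_nat_numeral)
    then have "s * real n \<le> s * (5 * real k)" using s by (rule mult_left_mono)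
    then show ?thesis using n by (simp add: field_simps)
  qed
  then have "1 + s / 5 \<le> 1 + k * (s / n)" by simp
  also have "\<dots> \<le> (1 + s / n) ^ k" using s by (intro Bernoulli_inequality) (simp add: order_trans[of _ 0])
  finally have "(1 + s / 5) ^ 3 \<le> ((1 + s / n) ^ k) ^ 3" using s by (intro power_mono) auto
  also have "\<dots> = (1 + s / n) ^ (3 * k)" by (simp add: power_mult[symmetric] mult.commute)
  also have "\<dots> \<le> (1 + s / n) ^ n" using s k by (intro power_increasing) auto
  finally show ?thesis .
qed

lemma integrable_inverse_square_scaled:
  "integrable lborel (\<lambda>s::real. indicator {0..} s *\<^sub>R (5 / (1 + s / 5)\<^sup>2))"
proof -
  have "integrable lborel (\<lambda>s::real. indicator {0..} (0 + 1 / 5 * s) *\<^sub>R (1 / (1 + (0 + 1 / 5 * s))\<^sup>2))"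
    by (rule lborel_integrable_real_affine[OF integrable_inverse_square[unfolded set_integrable_def]]) simp
  then have "integrable lborel (\<lambda>s::real. 5 * (indicator {0..} (0 + 1 / 5 * s) *\<^sub>R (1 / (1 + (0 + 1 / 5 * s))\<^sup>2)))"
    by (rule integrable_mult_right)
  then show ?thesis
    by (rule Bochner_Integration.integrable_cong[THEN iffD1, rotated -1]) (auto simp: indicator_def)
qed

text \<open>The substitution \<open>r = s / n\<close> resolves the scale on which
  \<open>crit_A n\<close> varies, and its factor \<open>1 / n\<close> balances
  \<open>n - 1\<close>.\<close>

lemma crit_D_1_rescaled:
  assumes n: "1 \<le> n"
  shows "crit_D n 1 = (real n - 1) / n / pi *
    (LINT s|lborel. indicator {0..} s *\<^sub>R (exp (- crit_A n (s / n)) * crit_A n (s / n) / (1 + s / n)\<^sup>2))"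
proof -
  have "(LINT r|lborel. indicator {0..} r *\<^sub>R (exp (- 1 * crit_A n r) * crit_A n r / (1 + r)\<^sup>2)) =
     \<bar>1 / real n\<bar> *\<^sub>R (LINT s|lborel. indicator {0..} (0 + 1 / real n * s) *\<^sub>R (exp (- 1 * crit_A n (0 + 1 / real n * s)) * crit_A n (0 + 1 / real n * s) / (1 + (0 + 1 / real n * s))\<^sup>2))"
    by (rule lborel_integral_real_affine) (use n in auto)
  also have "(LINT s|lborel. indicator {0..} (0 + 1 / real n * s) *\<^sub>R (exp (- 1 * crit_A n (0 + 1 / real n * s)) * crit_A n (0 + 1 / real n * s) / (1 + (0 + 1 / real n * s))\<^sup>2)) =
    (LINT s|lborel. indicator {0..} s *\<^sub>R (exp (- crit_A n (s / n)) * crit_A n (s / n) / (1 + s / n)\<^sup>2))"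
    using n by (intro Bochner_Integration.integral_cong) (auto simp: indicator_def zero_le_divide_iff)
  finally show ?thesis
    unfolding crit_D_def set_lebesgue_integral_def by simp
qed

lemma crit_A_rescaled_tendsto: "(\<lambda>n. crit_A n (s / real n)) \<longlonglongrightarrow> (1 + s) * exp (- s)"
proof -
  have "(\<lambda>n. (1 + s) / (1 + s / n) ^ n) \<longlonglongrightarrow> (1 + s) / exp s"
    by (intro tendsto_intros tendsto_exp_limit_sequentially) auto
  then have "(\<lambda>n. (1 + s) / (1 + s / n) ^ n) \<longlonglongrightarrow> (1 + s) * exp (- s)"
    by (simp add: exp_minus divide_inverse)
  moreover have "\<forall>\<^sub>F n in sequentially. (1 + s) / (1 + s / n) ^ n = crit_A n (s / real n)"
    using eventually_gt_at_top[of 0] by eventually_elim (simp add: crit_A_def)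
  ultimately show ?thesis by (simp add: filterlim_cong)
qed

lemma crit_D_1_tendsto:
  "(\<lambda>n. crit_D n 1) \<longlonglongrightarrow> 1 / pi * (LINT s|lborel. indicator {0..} s *\<^sub>R (exp (- ((1 + s) * exp (- s))) * ((1 + s) * exp (- s))))"
proof -
  \<comment> \<open>The index is shifted by \<open>3\<close> because the cubic lower bound is
    available from degree \<open>3\<close> on.\<close>
  define f where "f n s = indicator {0..} s *\<^sub>R (exp (- crit_A (n + 3) (s / real (n + 3))) *
    crit_A (n + 3) (s / real (n + 3)) / (1 + s / real (n + 3))\<^sup>2)" for n s
  have "(\<lambda>n. LINT s|lborel. f n s) \<longlonglongrightarrow> (LINT s|lborel. indicator {0..} s *\<^sub>R (exp (- ((1 + s) * exp (- s))) * ((1 + s) * exp (- s))))"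
  proof (rule integral_dominated_convergence[OF _ _ integrable_inverse_square_scaled])
    show "AE s in lborel. (\<lambda>n. f n s) \<longlonglongrightarrow> indicator {0..} s *\<^sub>R (exp (- ((1 + s) * exp (- s))) * ((1 + s) * exp (- s)))"
    proof (rule AE_I2)
      fix s :: real
      have A: "(\<lambda>n. crit_A (n + 3) (s / real (n + 3))) \<longlonglongrightarrow> (1 + s) * exp (- s)"
        by (rule LIMSEQ_ignore_initial_segment[OF crit_A_rescaled_tendsto])
      have "(\<lambda>n. 1 + s / real n) \<longlonglongrightarrow> 1" by real_asymp
      then have B: "(\<lambda>n. 1 + s / real (n + 3)) \<longlonglongrightarrow> 1"
        by (rule LIMSEQ_ignore_initial_segment)
      have "(\<lambda>n. f n s) \<longlonglongrightarrow> indicator {0..} s *\<^sub>R (exp (- ((1 + s) * exp (- s))) * ((1 + s) * exp (- s)) / 1\<^sup>2)"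
        unfolding f_def by (intro tendsto_intros A B) simp
      then show "(\<lambda>n. f n s) \<longlonglongrightarrow> indicator {0..} s *\<^sub>R (exp (- ((1 + s) * exp (- s))) * ((1 + s) * exp (- s)))" by simp
    qed
    show "AE s in lborel. norm (f n s) \<le> indicator {0..} s *\<^sub>R (5 / (1 + s / 5)\<^sup>2)" for n
    proof (rule AE_I2)
      fix s :: real
      show "norm (f n s) \<le> indicator {0..} s *\<^sub>R (5 / (1 + s / 5)\<^sup>2)"
      proof (cases "0 \<le> s")
        case True
        define A where "A = crit_A (n + 3) (s / real (n + 3))"
        have A0: "0 < A" unfolding A_def using True by (intro crit_A_pos) auto
        have "A = (1 + s) / (1 + s / real (n + 3)) ^ (n + 3)" by (simp add: A_def crit_A_def)
        also have "\<dots> \<le> (1 + s) / (1 + s / 5) ^ 3"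
          using True power_ge_cube[OF True, of "n + 3"] by (intro divide_left_mono mult_pos_pos zero_less_power) (auto intro: add_pos_nonneg)
        \<comment> \<open>Here \<open>1 + s\<close> is enlarged to \<open>5 + s\<close>, which
          cancels one of the three factors.\<close>
        also have "\<dots> \<le> (5 * (1 + s / 5)) / (1 + s / 5) ^ 3"
          using True by (intro divide_right_mono) auto
        also have "\<dots> = 5 / (1 + s / 5)\<^sup>2"
        proof -
          have "5 * u / u ^ 3 = 5 / u\<^sup>2" if "u \<noteq> 0" for u :: real
            using that by (simp add: power2_eq_square power3_eq_cube)
          from this[of "1 + s / 5"] show ?thesis using True by (metis add_nonneg_eq_0_iff divide_nonneg_pos zero_le_one zero_less_numeral zero_neq_one)
        qed
        finally have A1: "A \<le> 5 / (1 + s / 5)\<^sup>2" .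
        have "exp (- A) * A / (1 + s / real (n + 3))\<^sup>2 \<le> 1 * A / 1"
          using A0 True by (intro frac_le mult_mono) (auto intro!: one_le_power)
        moreover have "f n s = exp (- A) * A / (1 + s / real (n + 3))\<^sup>2"
          using True by (simp add: f_def A_def)
        moreover have "0 \<le> exp (- A) * A / (1 + s / real (n + 3))\<^sup>2" using A0 by simp
        ultimately show ?thesis using A1 True by simp
      qed (simp add: f_def)
    qed
  qed (auto simp: f_def[abs_def])
  moreover have "(\<lambda>n. (real (n + 3) - 1) / real (n + 3)) \<longlonglongrightarrow> 1" by real_asymp
  then have "(\<lambda>n. (real (n + 3) - 1) / real (n + 3) / pi) \<longlonglongrightarrow> 1 / pi"
    by (rule tendsto_divide[OF _ tendsto_const pi_neq_zero])
  ultimately have "(\<lambda>n. (real (n + 3) - 1) / real (n + 3) / pi * (LINT s|lborel. f n s)) \<longlonglongrightarrow>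
     1 / pi * (LINT s|lborel. indicator {0..} s *\<^sub>R (exp (- ((1 + s) * exp (- s))) * ((1 + s) * exp (- s))))"
    by (intro tendsto_mult)
  then have "(\<lambda>n. crit_D (n + 3) 1) \<longlonglongrightarrow>
     1 / pi * (LINT s|lborel. indicator {0..} s *\<^sub>R (exp (- ((1 + s) * exp (- s))) * ((1 + s) * exp (- s))))"
    by (simp add: crit_D_1_rescaled f_def)
  then show ?thesis by (rule LIMSEQ_offset)
qed

text \<open>The factor \<open>1 + s\<close> splits the integral in two. The part with
  \<open>s * exp (- s)\<close> integrates the derivative of \<open>E\<close>, which rises from
  \<open>exp (- 1)\<close> to \<open>1\<close>; the part with \<open>exp (- s)\<close> becomes the
  remaining integral after \<open>t = exp (- s)\<close>.\<close>

lemma integral_limit_density: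
  "(LINT s|(lborel :: real measure). indicator {0..} s *\<^sub>R (exp (- ((1 + s) * exp (- s))) * ((1 + s) * exp (- s)))) =
    1 - exp (- 1) + (LINT t:{0..1}|lborel. exp (- (t - t * ln t)))"
proof -
  define E where "E s = exp (- ((1 + s) * exp (- s)))" for s :: real
  have [measurable]: "E \<in> borel_measurable borel" unfolding E_def[abs_def] by measurable
  have nn1: "(\<integral>\<^sup>+s. ennreal (E s * (s * exp (- s))) * indicator {0..} s \<partial>lborel) = ennreal (1 - E 0)"
  proof (rule nn_integral_FTC_atLeast)
    show "DERIV E s :> E s * (s * exp (- s))" for s
      unfolding E_def[abs_def] by (auto intro!: derivative_eq_intros simp: algebra_simps)
    show "(E \<longlongrightarrow> 1) at_top" unfolding E_def[abs_def] by real_asymp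
  qed (auto simp: E_def)
  have h1: "has_bochner_integral lborel (\<lambda>s. indicator {0..} s *\<^sub>R (E s * (s * exp (- s)))) (1 - exp (- 1))"
  proof (rule has_bochner_integral_nn_integral)
    have "(\<integral>\<^sup>+s. ennreal (indicator {0..} s *\<^sub>R (E s * (s * exp (- s)))) \<partial>lborel) =
        (\<integral>\<^sup>+s. ennreal (E s * (s * exp (- s))) * indicator {0..} s \<partial>lborel)"
      by (intro nn_integral_cong) (auto simp: indicator_def)
    then show "(\<integral>\<^sup>+s. ennreal (indicator {0..} s *\<^sub>R (E s * (s * exp (- s)))) \<partial>lborel) = ennreal (1 - exp (- 1))"
      unfolding nn1 by (simp add: E_def)
  qed (auto simp: E_def indicator_def)
  have i2: "integrable lborel (\<lambda>s. indicator {0..} s *\<^sub>R (E s * exp (- s)))"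
  proof (rule Bochner_Integration.integrable_bound)
    have "(\<integral>\<^sup>+s. ennreal (indicator {0..} s *\<^sub>R exp (- s)) \<partial>lborel) = (\<integral>\<^sup>+s. ennreal (s ^ 0 * exp (- s)) * indicator {0..} s \<partial>lborel)"
      by (intro nn_integral_cong) (auto simp: indicator_def)
    then show "integrable lborel (\<lambda>s::real. indicator {0..} s *\<^sub>R exp (- s))"
      unfolding nn_intergal_power_times_exp_Ici by (intro integrableI_nonneg) (auto simp: indicator_def)
    show "AE s in lborel. norm (indicator {0..} s *\<^sub>R (E s * exp (- s))) \<le> norm (indicator {0..} s *\<^sub>R exp (- s))"
      by (intro AE_I2) (auto simp: indicator_def E_def abs_mult)
  qed measurable
  have "(LINT s|lborel. indicator {0..} s *\<^sub>R (E s * ((1 + s) * exp (- s)))) =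
      (LINT s|lborel. indicator {0..} s *\<^sub>R (E s * exp (- s)) + indicator {0..} s *\<^sub>R (E s * (s * exp (- s))))"
    by (intro Bochner_Integration.integral_cong) (auto simp: algebra_simps)
  also have "\<dots> = (LINT s|lborel. indicator {0..} s *\<^sub>R (E s * exp (- s))) + (1 - exp (- 1))"
    using h1 i2 by (subst Bochner_Integration.integral_add) (auto simp: has_bochner_integral_iff)
  also have "(LINT s|lborel. indicator {0..} s *\<^sub>R (E s * exp (- s))) = (LINT t:{0..1}|lborel. exp (- (t - t * ln t)))"
  proof -
    define f where "f t = exp (- (t - t * ln t))" for t :: real
    have fg: "f (exp x) * exp x = E (- x) * exp (- (- x))" for x
      by (simp add: f_def E_def algebra_simps)
    \<comment> \<open>The substitution rule wants a nondecreasing map, so \<open>t = exp x\<close>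
      is used on the negative half-line and reflected afterwards.\<close>
    have "(LBINT t=ereal 0..ereal 1. f t) = (LBINT x=-\<infinity>..ereal 0. f (exp x) * exp x)"
    proof (rule interval_integral_substitution_nonneg(2))
      show "DERIV exp x :> exp x" for x :: real by (rule DERIV_exp)
      show "isCont f (exp x)" for x unfolding f_def[abs_def] by (intro continuous_intros) auto
      have "((\<lambda>x::real. exp x) \<longlongrightarrow> 0) at_bot" by real_asymp
      then show "((ereal \<circ> exp \<circ> real_of_ereal) \<longlongrightarrow> ereal 0) (at_right (- \<infinity>))"
        by (simp add: ereal_tendsto_simps o_assoc[symmetric])
      have "((\<lambda>x::real. exp x) \<longlongrightarrow> exp 0) (at_left 0)" by (intro tendsto_intros)
      then show "((ereal \<circ> exp \<circ> real_of_ereal) \<longlongrightarrow> ereal 1) (at_left (ereal 0))"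
        by (simp add: ereal_tendsto_simps o_assoc[symmetric])
      have "integrable lborel (\<lambda>x. indicator {0..} (0 + (- 1) * x) *\<^sub>R (E (0 + (- 1) * x) * exp (- (0 + (- 1) * x))))"
        by (rule lborel_integrable_real_affine[OF i2]) simp
      then have "set_integrable lborel {..0} (\<lambda>x. f (exp x) * exp x)"
        unfolding set_integrable_def fg
        by (rule Bochner_Integration.integrable_cong[THEN iffD1, rotated -1]) (auto simp: indicator_def)
      then show "set_integrable lborel (einterval (- \<infinity>) (ereal 0)) (\<lambda>x. f (exp x) * exp x)"
        by (rule set_integrable_subset) (auto simp: einterval_def)
    qed (auto simp: f_def)
    also have "(LBINT x=-\<infinity>..ereal 0. f (exp x) * exp x) = (LBINT x:{..<0}. E (- x) * exp (- (- x)))"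
      unfolding fg by (simp add: interval_lebesgue_integral_def einterval_def lessThan_def)
    also have "\<dots> = (LBINT s:{0<..}. E s * exp (- s))"
      by (subst set_integral_reflect) (simp add: lessThan_def greaterThan_def)
    also have "\<dots> = (LBINT s:{0..}. E s * exp (- s))"
    proof (rule set_integral_cong_set)
      have "AE s in lborel. s \<noteq> (0::real)" by (rule AE_lborel_singleton)
      then show "AE s in lborel. (s \<in> {0..}) = (s \<in> {0::real<..})" by eventually_elim auto
    qed (auto simp: set_borel_measurable_def)
    finally have 1: "(LBINT t=ereal 0..ereal 1. f t) = (LBINT s:{0..}. E s * exp (- s))" .
    have [measurable]: "f \<in> borel_measurable borel" unfolding f_def[abs_def] by measurable
    have "(LBINT t=ereal 0..ereal 1. f t) = (LINT t:{0<..<1}|lborel. f t)"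
      by (simp add: interval_lebesgue_integral_def einterval_def greaterThanLessThan_def greaterThan_def lessThan_def Int_def)
    also have "\<dots> = (LINT t:{0..1}|lborel. f t)"
    proof (rule set_integral_cong_set)
      have "AE s in lborel. s \<noteq> (0::real)" "AE s in lborel. s \<noteq> (1::real)" by (rule AE_lborel_singleton)+
      then show "AE s in lborel. (s \<in> {0..1}) = (s \<in> {0::real<..<1})" by eventually_elim auto
    qed (auto simp: set_borel_measurable_def)
    finally show ?thesis using 1 by (simp add: set_lebesgue_integral_def f_def)
  qed
  finally show ?thesis unfolding E_def by (simp only: add.commute)
qed

lemma crit_D_1_limit:
  "(\<lambda>n. crit_D n 1) \<longlonglongrightarrow> (1 - exp (- 1)) / pi + 1 / pi * (LINT s:{0..1}|lborel. exp (- (s - s * ln s)))"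
  using crit_D_1_tendsto unfolding integral_limit_density by (simp add: add_divide_distrib)

subsection \<open>Limits away from the critical radius\<close>

lemma crit_A_antimono:
  assumes "1 \<le> n" "0 \<le> r" "r \<le> r'"
  shows "crit_A n r' \<le> crit_A n r"
proof (rule DERIV_nonpos_imp_nonincreasing[OF assms(3)])
  fix y assume "r \<le> y" "y \<le> r'"
  then show "\<exists>d. DERIV (crit_A n) y :> d \<and> d \<le> 0"
    using assms by (intro exI[of _ "- (n * (real n - 1) * y / (1 + y) ^ (n + 1))"] conjI DERIV_crit_A) auto
qed

abbreviation scaled_integrand :: "nat \<Rightarrow> real \<Rightarrow> real \<Rightarrow> real" where
  "scaled_integrand n X r \<equiv> n * (X * crit_A n r) * exp (- X * crit_A n r) / (1 + r)\<^sup>2"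

text \<open>This is \<open>R_n(x)\<close> as a function of \<open>X = exp (n x)\<close>. The
  integrand depends on \<open>V = X * crit_A n r\<close> through \<open>V * exp (- V)\<close>, which
  is small both for large and for small \<open>V\<close>.\<close>

definition scaled_density :: "nat \<Rightarrow> real \<Rightarrow> real" where
  "scaled_density n X = (LINT r:{0..}|lborel. scaled_integrand n X r)"

lemma scaled_density_eq:
  assumes "2 \<le> n"
  shows "scaled_density n X = real n / (real n - 1) * pi * X * crit_D n X"
proof -
  have "scaled_density n X = (LINT r:{0..}|lborel. n * X * (crit_integrand n X r))"
    unfolding scaled_density_def by (rule set_lebesgue_integral_cong) auto
  also have "\<dots> = n * X * (LINT r:{0..}|lborel. crit_integrand n X r)"
    by (rule set_integral_mult_right)
  finally show ?thesis using assms by (simp add: crit_D_def)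
qed

lemma nn_integral_scaled_density:
  assumes "0 \<le> X"
  shows "(\<integral>\<^sup>+r. ennreal (scaled_integrand n X r) * indicator {0..} r \<partial>lborel) =
    ennreal (scaled_density n X)"
proof -
  have "set_integrable lborel {0..} (\<lambda>r. n * X * (crit_integrand n X r))"
    by (intro set_integrable_mult_right integrable_crit_D assms)
  then have "integrable lborel (\<lambda>r. indicator {0..} r *\<^sub>R (scaled_integrand n X r))"
    unfolding set_integrable_def by (rule Bochner_Integration.integrable_cong[THEN iffD1, rotated -1]) (auto simp: indicator_def)
  then have "(\<integral>\<^sup>+r. ennreal (indicator {0..} r *\<^sub>R (scaled_integrand n X r)) \<partial>lborel) =
      ennreal (scaled_density n X)"
    unfolding scaled_density_def set_lebesgue_integral_def
    using assms crit_A_pos by (intro nn_integral_eq_integral) (auto simp: indicator_def less_imp_le)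
  moreover have "(\<integral>\<^sup>+r. ennreal (scaled_integrand n X r) * indicator {0..} r \<partial>lborel) =
      (\<integral>\<^sup>+r. ennreal (indicator {0..} r *\<^sub>R (scaled_integrand n X r)) \<partial>lborel)"
    by (intro nn_integral_cong) (auto simp: indicator_def)
  ultimately show ?thesis by simp
qed

lemma scaled_density_nonneg: "0 \<le> X \<Longrightarrow> 0 \<le> scaled_density n X"
  unfolding scaled_density_def set_lebesgue_integral_def
  by (intro Bochner_Integration.integral_nonneg) (auto simp: indicator_def intro!: divide_nonneg_nonneg mult_nonneg_nonneg less_imp_le[OF crit_A_pos])

text \<open>As \<open>crit_A n r\<close> and the exponential are at most one, the integrand is below
  \<open>n * X\<close> times a weight of total mass one. For \<open>X = exp (n x)\<close> with
  \<open>x < 0\<close> this bound tends to \<open>0\<close>.\<close>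

lemma scaled_density_le:
  assumes X: "0 \<le> X"
  shows "scaled_density n X \<le> n * X"
proof -
  have "ennreal (scaled_density n X) \<le> (\<integral>\<^sup>+r. ennreal (n * X) * (ennreal (1 / (1 + r)\<^sup>2) * indicator {0..} r) \<partial>lborel)"
    unfolding nn_integral_scaled_density[OF X, symmetric]
  proof (rule nn_integral_mono)
    fix r :: real
    have "scaled_integrand n X r \<le> n * X * (1 / (1 + r)\<^sup>2)" if "0 \<le> r"
      using mult_left_mono[OF crit_D_integrand_bound(2)[OF that X, of n], of "n * X"] X by (simp add: mult_ac)
    then show "ennreal (scaled_integrand n X r) * indicator {0..} r \<le>
        ennreal (n * X) * (ennreal (1 / (1 + r)\<^sup>2) * indicator {0..} r)"
      using X by (cases "0 \<le> r") (simp_all add: ennreal_mult[symmetric] ennreal_leI)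
  qed
  also have "\<dots> = ennreal (n * X)"
    by (subst nn_integral_cmult) (auto simp: nn_integral_inverse_square)
  finally show ?thesis using X by (simp add: ennreal_le_iff)
qed

lemma scaled_density_tendsto_neg:
  assumes "x < 0"
  shows "(\<lambda>n. scaled_density n (exp (real n * x))) \<longlonglongrightarrow> 0"
proof (rule tendsto_sandwich)
  show "\<forall>\<^sub>F n in sequentially. 0 \<le> scaled_density n (exp (real n * x))"
    by (intro always_eventually allI scaled_density_nonneg) simp
  show "\<forall>\<^sub>F n in sequentially. scaled_density n (exp (real n * x)) \<le> real n * exp x ^ n"
    unfolding exp_of_nat_mult by (intro always_eventually allI scaled_density_le) simp
  show "(\<lambda>n. real n * exp x ^ n) \<longlonglongrightarrow> 0"
    using powser_times_n_limit_0[of "exp x"] assms by simp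
qed simp

text \<open>Up to the slowly varying weight below, the integrand of \<open>scaled_density\<close> is the derivative of
  \<open>exp (- X * crit_A n r)\<close>, which for \<open>X = exp (n * x)\<close> and \<open>x > 0\<close> jumps from 0 to 1 near \<open>r = exp x - 1\<close>.\<close>

definition crit_weight :: "nat \<Rightarrow> real \<Rightarrow> real" where
  "crit_weight n r = (1 + n * r) / ((real n - 1) * r * (1 + r))"

text \<open>The weight is a product of positive factors none of which increases. Hence it can be
  frozen at an endpoint, from above on \<open>{a..}\<close> and from below on
  \<open>{a..b}\<close>.\<close>

lemma crit_weight_antimono:
  assumes n: "2 \<le> n" and r: "0 < r" "r \<le> r'"
  shows "crit_weight n r' \<le> crit_weight n r"
proof -
  have eq: "crit_weight n r = (1 / r + n) * (1 / (real n - 1)) * (1 / (1 + r))" if "0 < r" for r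
    using that n by (simp add: crit_weight_def field_simps)
  have "1 / r' + n \<le> 1 / r + n" "1 / (1 + r') \<le> 1 / (1 + r)"
    using r by (auto intro!: divide_left_mono)
  then show ?thesis
    using n r by (simp only: eq) (intro mult_mono mult_nonneg_nonneg, auto)
qed

lemma crit_weight_pos: "2 \<le> n \<Longrightarrow> 0 < r \<Longrightarrow> 0 < crit_weight n r"
  unfolding crit_weight_def by (intro divide_pos_pos mult_pos_pos add_pos_nonneg) auto

text \<open>At \<open>a = exp x - 1\<close> the limit is \<open>exp (- x)\<close>, the value of the
  limiting density.\<close>

lemma crit_weight_tendsto:
  assumes "0 < a"
  shows "(\<lambda>n. crit_weight n a) \<longlonglongrightarrow> 1 / (1 + a)"
proof -
  have "(\<lambda>n. (1 / a + real n) / (real n - 1)) \<longlonglongrightarrow> 1" by real_asymp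
  then have "(\<lambda>n. (1 / a + real n) / (real n - 1) / (1 + a)) \<longlonglongrightarrow> 1 / (1 + a)"
    by (rule tendsto_divide[OF _ tendsto_const]) (use assms in simp)
  moreover have "(1 / a + real n) / (real n - 1) / (1 + a) = crit_weight n a" for n
  proof -
    have "(1 / a + real n) / (real n - 1) / (1 + a) = ((1 / a + real n) * a) / ((real n - 1) * a * (1 + a))"
      using assms by simp
    also have "(1 / a + real n) * a = 1 + n * a" using assms by (simp add: field_simps)
    finally show ?thesis by (simp add: crit_weight_def)
  qed
  ultimately show ?thesis by simp
qed

definition exp_crit_A_deriv :: "nat \<Rightarrow> real \<Rightarrow> real \<Rightarrow> real" where
  "exp_crit_A_deriv n X r = exp (- X * crit_A n r) * (X * (n * (real n - 1) * r / (1 + r) ^ (n + 1)))"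

lemma DERIV_exp_crit_A:
  assumes "0 \<le> r" "1 \<le> n"
  shows "DERIV (\<lambda>r. exp (- X * crit_A n r)) r :> exp_crit_A_deriv n X r"
  unfolding exp_crit_A_deriv_def
  using DERIV_crit_A[OF assms] by (auto intro!: derivative_eq_intros simp: mult_ac)

lemma exp_crit_A_deriv_nonneg: "1 \<le> n \<Longrightarrow> 0 \<le> r \<Longrightarrow> 0 \<le> X \<Longrightarrow> 0 \<le> exp_crit_A_deriv n X r"
  unfolding exp_crit_A_deriv_def by (intro mult_nonneg_nonneg divide_nonneg_nonneg) auto

lemma measurable_exp_crit_A_deriv [measurable]: "exp_crit_A_deriv n X \<in> borel_measurable borel"
  unfolding exp_crit_A_deriv_def[abs_def] by measurable

lemma scaled_integrand_eq:
  assumes "2 \<le> n" "0 < r"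
  shows "scaled_integrand n X r = crit_weight n r * exp_crit_A_deriv n X r"
proof -
  define E where "E = exp (- X * crit_A n r)"
  define u where "u = 1 + r"
  define U where "U = u ^ n"
  define N where "N = real n"
  have nz: "u \<noteq> 0" "U \<noteq> 0" "r \<noteq> 0" "N - 1 \<noteq> 0" using assms by (auto simp: U_def u_def N_def)
  have p: "(1 + r) ^ (n + 1) = U * u" by (simp add: U_def u_def mult.commute)
  show ?thesis
    unfolding crit_weight_def exp_crit_A_deriv_def E_def[symmetric] p
    unfolding crit_A_def u_def[symmetric] U_def[symmetric] N_def[symmetric]
    using nz by (simp add: field_simps power2_eq_square)
qed

text \<open>The integral is cut at \<open>a\<close>. To the left, \<open>V = X * crit_A n r\<close>
  is at least its value \<open>W\<close> at \<open>a\<close>, and \<open>V * exp (- V)\<close> is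
  small when \<open>W\<close> is large. To the right, the weight is frozen at \<open>a\<close>, and
  the derivative has total increment at most one.\<close>

lemma scaled_density_upper:
  assumes n: "2 \<le> n" and X: "0 < X" and a: "0 < a"
  shows "scaled_density n X \<le> 2 * n / (X * crit_A n a) + crit_weight n a"
proof -
  define W where "W = X * crit_A n a"
  have W: "W > 0" unfolding W_def using X a by (intro mult_pos_pos crit_A_pos) auto
  have pt: "ennreal (scaled_integrand n X r) * indicator {0..} r \<le>
      ennreal (2 * n / W) * (ennreal (1 / (1 + r)\<^sup>2) * indicator {0..} r) +
      ennreal (crit_weight n a) * (ennreal (exp_crit_A_deriv n X r) * indicator {a..} r)" for r
  proof (cases "0 \<le> r")
    case True
    show ?thesis
    proof (cases "r < a")
      case True
      define V where "V = X * crit_A n r"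
      have V: "V \<ge> W" unfolding V_def W_def using crit_A_antimono[of n r a] True \<open>0 \<le> r\<close> n X by (intro mult_left_mono) auto
      then have "V > 0" using W by simp
      \<comment> \<open>The quadratic Taylor bound gives \<open>V * exp (- V) \<le> 2 / V\<close>,
        enough to beat the factor \<open>n\<close> once \<open>W\<close> grows
        exponentially.\<close>
      have "V\<^sup>2 / 2 \<le> exp V" using exp_lower_Taylor_quadratic[of V] \<open>V > 0\<close> by simp
      then have "V * exp (- V) \<le> 2 / V"
        using \<open>V > 0\<close> by (simp add: exp_minus field_simps power2_eq_square)
      also have "2 / V \<le> 2 / W" using V W by (intro divide_left_mono) auto
      finally have "n * (V * exp (- V)) \<le> n * (2 / W)" by (intro mult_left_mono) auto
      then have "n * (V * exp (- V)) / (1 + r)\<^sup>2 \<le> n * (2 / W) / (1 + r)\<^sup>2"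
        by (intro divide_right_mono) auto
      then have "n * V * exp (- V) / (1 + r)\<^sup>2 \<le> 2 * n / W * (1 / (1 + r)\<^sup>2)"
        by (simp add: mult_ac)
      then show ?thesis
        using True \<open>0 \<le> r\<close> W by (simp add: V_def ennreal_mult[symmetric] ennreal_leI)
    next
      case False
      then have r: "a \<le> r" "0 < r" using a by auto
      have "scaled_integrand n X r \<le> crit_weight n a * exp_crit_A_deriv n X r"
        unfolding scaled_integrand_eq[OF n r(2)]
        using n r a X by (intro mult_right_mono crit_weight_antimono exp_crit_A_deriv_nonneg) auto
      then have "ennreal (scaled_integrand n X r) \<le>
          ennreal (crit_weight n a) * ennreal (exp_crit_A_deriv n X r)"
        using n r X a by (simp add: ennreal_mult[symmetric] ennreal_leI less_imp_le[OF crit_weight_pos] exp_crit_A_deriv_nonneg)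
      then show ?thesis using r a by (simp add: add_increasing)
    qed
  qed simp
  have "(\<integral>\<^sup>+r. ennreal (exp_crit_A_deriv n X r) * indicator {a..} r \<partial>lborel) = ennreal (1 - exp (- X * crit_A n a))"
  proof (rule nn_integral_FTC_atLeast)
    show "((\<lambda>r. exp (- X * crit_A n r)) \<longlongrightarrow> 1) at_top"
    proof -
      have "(crit_A n \<longlongrightarrow> 0) at_top"
      proof (rule tendsto_sandwich)
        show "\<forall>\<^sub>F r in at_top. 0 \<le> crit_A n r"
          using eventually_ge_at_top[of 0] by eventually_elim (simp add: less_imp_le[OF crit_A_pos])
        show "\<forall>\<^sub>F r::real in at_top. crit_A n r \<le> (1 + n * r) / (1 + r)\<^sup>2"
          using eventually_ge_at_top[of 0]
        proof eventually_elim
          case (elim r)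
          then show ?case unfolding crit_A_def using n
            by (intro divide_left_mono power_increasing mult_pos_pos zero_less_power) auto
        qed
        show "((\<lambda>r::real. (1 + n * r) / (1 + r)\<^sup>2) \<longlongrightarrow> 0) at_top" by real_asymp
      qed simp
      then have "((\<lambda>r. exp (- X * crit_A n r)) \<longlongrightarrow> exp (- X * 0)) at_top" by (intro tendsto_intros)
      then show ?thesis by simp
    qed
    show "DERIV (\<lambda>r. exp (- X * crit_A n r)) r :> exp_crit_A_deriv n X r" if "a \<le> r" for r
      using that a n by (intro DERIV_exp_crit_A) auto
    show "0 \<le> exp_crit_A_deriv n X r" if "a \<le> r" for r
      using that a n X by (intro exp_crit_A_deriv_nonneg) auto
  qed measurable
  also have "\<dots> \<le> 1" by (simp add: ennreal_le_1)
  finally have G: "(\<integral>\<^sup>+r. ennreal (exp_crit_A_deriv n X r) * indicator {a..} r \<partial>lborel) \<le> 1" .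
  have "ennreal (scaled_density n X) \<le> (\<integral>\<^sup>+r. ennreal (2 * n / W) * (ennreal (1 / (1 + r)\<^sup>2) * indicator {0..} r) +
      ennreal (crit_weight n a) * (ennreal (exp_crit_A_deriv n X r) * indicator {a..} r) \<partial>lborel)"
    unfolding nn_integral_scaled_density[OF less_imp_le[OF X], symmetric] by (rule nn_integral_mono) (rule pt)
  also have "\<dots> = ennreal (2 * n / W) * (\<integral>\<^sup>+r. ennreal (1 / (1 + r)\<^sup>2) * indicator {0..} r \<partial>lborel) +
      ennreal (crit_weight n a) * (\<integral>\<^sup>+r. ennreal (exp_crit_A_deriv n X r) * indicator {a..} r \<partial>lborel)"
    by (subst nn_integral_add) (auto simp: nn_integral_cmult)
  also have "\<dots> \<le> ennreal (2 * n / W) * 1 + ennreal (crit_weight n a) * 1"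
    unfolding nn_integral_inverse_square by (intro add_mono mult_left_mono G) auto
  also have "\<dots> = ennreal (2 * n / W + crit_weight n a)"
    using W n a by (subst ennreal_plus) (auto intro: less_imp_le[OF crit_weight_pos])
  finally show ?thesis
    using W n a by (subst (asm) ennreal_le_iff) (auto simp: W_def[symmetric] intro!: add_nonneg_nonneg less_imp_le[OF crit_weight_pos])
qed

text \<open>Only \<open>{a..b}\<close> is kept and the weight is frozen at \<open>b\<close>. When
  the jump of the exponential lies inside the interval, the increment is close to one.\<close>

lemma scaled_density_lower:
  assumes n: "2 \<le> n" and X: "0 < X" and ab: "0 < a" "a \<le> b"
  shows "crit_weight n b * (exp (- X * crit_A n b) - exp (- X * crit_A n a)) \<le> scaled_density n X"
proof -
  have pt: "ennreal (crit_weight n b) * (ennreal (exp_crit_A_deriv n X r) * indicator {a..b} r) \<le>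
    ennreal (scaled_integrand n X r) * indicator {0..} r" for r
  proof (cases "r \<in> {a..b}")
    case True
    then have r: "0 < r" "r \<le> b" using ab by auto
    have "crit_weight n b * exp_crit_A_deriv n X r \<le> scaled_integrand n X r"
      unfolding scaled_integrand_eq[OF n r(1)]
      using n r X by (intro mult_right_mono crit_weight_antimono exp_crit_A_deriv_nonneg) auto
    then show ?thesis
      using True r n X by (simp add: ennreal_mult[symmetric] ennreal_leI less_imp_le[OF crit_weight_pos] exp_crit_A_deriv_nonneg)
  qed simp
  have "(\<integral>\<^sup>+r. ennreal (exp_crit_A_deriv n X r) * indicator {a..b} r \<partial>lborel) = ennreal (exp (- X * crit_A n b) - exp (- X * crit_A n a))"
  proof (rule nn_integral_FTC_Icc)
    show "DERIV (\<lambda>r. exp (- X * crit_A n r)) r :> exp_crit_A_deriv n X r" if "r \<in> {a..b}" for r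
      using that ab n by (intro DERIV_exp_crit_A) auto
    show "0 \<le> exp_crit_A_deriv n X r" if "r \<in> {a..b}" for r
      using that ab n X by (intro exp_crit_A_deriv_nonneg) auto
  qed (use ab in auto)
  then have "ennreal (crit_weight n b) * ennreal (exp (- X * crit_A n b) - exp (- X * crit_A n a)) =
     (\<integral>\<^sup>+r. ennreal (crit_weight n b) * (ennreal (exp_crit_A_deriv n X r) * indicator {a..b} r) \<partial>lborel)"
    by (subst nn_integral_cmult) auto
  also have "\<dots> \<le> ennreal (scaled_density n X)"
    unfolding nn_integral_scaled_density[OF less_imp_le[OF X], symmetric] by (rule nn_integral_mono) (rule pt)
  finally have "ennreal (crit_weight n b * (exp (- X * crit_A n b) - exp (- X * crit_A n a))) \<le> ennreal (scaled_density n X)"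
    using n ab by (simp add: ennreal_mult' less_imp_le[OF crit_weight_pos])
  then show ?thesis using X by (simp add: ennreal_le_iff scaled_density_nonneg)
qed

lemma exp_crit_A_eq: "exp (real n * x) * crit_A n r = (1 + n * r) * (exp x / (1 + r)) ^ n"
  by (simp add: crit_A_def exp_of_nat_mult power_divide)

lemma scaled_density_tendsto_pos:
  assumes x: "0 < x"
  shows "(\<lambda>n. scaled_density n (exp (real n * x))) \<longlonglongrightarrow> exp (- x)"
proof (rule order_tendstoI)
  define s where "s = exp x - 1"
  have s: "s > 0" "exp (- x) = 1 / (1 + s)" using x by (simp_all add: s_def exp_minus divide_inverse)
  have inv: "(\<lambda>n. (inverse (exp x / (1 + a))) ^ n) \<longlonglongrightarrow> 0" if "0 < a" "a < s" for a
    using that by (intro LIMSEQ_realpow_zero) (auto simp: s_def field_simps)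
  fix y
  {
    assume y: "exp (- x) < y"
    then have y0: "y > 0" using exp_gt_zero[of "- x"] by linarith
    \<comment> \<open>The midpoint of \<open>1 / y - 1\<close> and \<open>s\<close> lies below
      \<open>s\<close> and gives \<open>1 / (1 + a) < y\<close>; the maximum with
      \<open>s / 2\<close> keeps \<open>a\<close> positive.\<close>
    define a where "a = max (s / 2) ((1 / y - 1 + s) / 2)"
    have "1 / y < 1 + s" using y y0 s by (simp add: field_simps)
    then have a: "0 < a" "a < s" "1 / y - 1 < a" using s by (auto simp: a_def max_def)
    then have "1 < y * (1 + a)" using y0 by (simp add: field_simps)
    then have ay: "1 / (1 + a) < y" using a by (simp add: divide_less_eq)
    have "(\<lambda>n. 2 * real n / (exp (real n * x) * crit_A n a)) \<longlonglongrightarrow> 0"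
    proof (rule tendsto_sandwich)
      show "\<forall>\<^sub>F n in sequentially. 0 \<le> 2 * real n / (exp (real n * x) * crit_A n a)"
        using a by (intro always_eventually allI) (simp add: less_imp_le[OF crit_A_pos])
      show "\<forall>\<^sub>F n in sequentially. 2 * real n / (exp (real n * x) * crit_A n a) \<le> 2 / a * (inverse (exp x / (1 + a))) ^ n"
      proof (intro always_eventually allI)
        fix n
        define R where "R = (exp x / (1 + a)) ^ n"
        have R: "R > 0" using a by (simp add: R_def)
        \<comment> \<open>The linear factor \<open>1 + n * a\<close> of \<open>crit_A\<close>
          absorbs the \<open>n\<close> in the numerator and leaves a geometric sequence.\<close>
        have "2 * real n / ((1 + n * a) * R) \<le> 2 / a * inverse R"
          using a R by (simp add: field_simps add_pos_nonneg)
        then show "2 * real n / (exp (real n * x) * crit_A n a) \<le> 2 / a * (inverse (exp x / (1 + a))) ^ n"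
          unfolding exp_crit_A_eq R_def by (simp only: power_inverse)
      qed
      show "(\<lambda>n. 2 / a * (inverse (exp x / (1 + a))) ^ n) \<longlonglongrightarrow> 0"
        by (rule tendsto_mult_right_zero[OF inv[OF a(1,2)]])
    qed simp
    then have "(\<lambda>n. 2 * real n / (exp (real n * x) * crit_A n a) + crit_weight n a) \<longlonglongrightarrow> 0 + 1 / (1 + a)"
      by (intro tendsto_add crit_weight_tendsto a)
    then have "\<forall>\<^sub>F n in sequentially. 2 * real n / (exp (real n * x) * crit_A n a) + crit_weight n a < y"
      using ay by (intro order_tendstoD(2)) auto
    then show "\<forall>\<^sub>F n in sequentially. scaled_density n (exp (real n * x)) < y"
      using eventually_ge_at_top[of 2]
    proof eventually_elim
      case (elim n)
      then show ?case using scaled_density_upper[of n "exp (real n * x)" a] a by simp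
    qed
  }
  {
    assume y: "y < exp (- x)"
    \<comment> \<open>For positive \<open>y\<close> this is the midpoint of \<open>s\<close> and
      \<open>1 / y - 1\<close>; for \<open>y \<le> 0\<close> every point above \<open>s\<close>
      serves.\<close>
    define b where "b = (if y \<le> 0 then s + 1 else (1 / y - 1 + s) / 2)"
    have b: "s < b" "y < 1 / (1 + b)"
    proof -
      have "s < b \<and> y < 1 / (1 + b)"
      proof (cases "y \<le> 0")
        case True
        then show ?thesis using s by (simp add: b_def less_le_trans[OF _ less_imp_le] order_le_less_trans[of y 0])
      next
        case False
        then have "1 + s < 1 / y" using y s by (simp add: field_simps)
        moreover have "2 * b = 1 / y - 1 + s" using False by (simp add: b_def)
        ultimately have bs: "s < b" "1 + b < 1 / y" by linarith+
        then have "y * (1 + b) < 1" using False by (simp add: field_simps)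
        then show ?thesis using bs s by (simp add: less_divide_eq)
      qed
      then show "s < b" "y < 1 / (1 + b)" by auto
    qed
    \<comment> \<open>The left endpoint only has to stay below the jump, so its position does not
      depend on \<open>y\<close>.\<close>
    define a where "a = s / 2"
    have a: "0 < a" "a < s" "a \<le> b" using s b by (auto simp: a_def)
    have "(\<lambda>n. exp (real n * x) * crit_A n b) \<longlonglongrightarrow> 0"
    proof -
      have "0 < 1 + b" using b(1) s(1) by linarith
      moreover have "exp x < 1 + b" using b(1) by (simp add: s_def)
      ultimately have lt: "norm (exp x / (1 + b)) < 1" by simp
      have "(\<lambda>n. (exp x / (1 + b)) ^ n + b * (real n * (exp x / (1 + b)) ^ n)) \<longlonglongrightarrow> 0 + b * 0"
        using lt by (intro tendsto_intros LIMSEQ_power_zero) (auto intro: powser_times_n_limit_0)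
      then show ?thesis unfolding exp_crit_A_eq by (simp add: algebra_simps)
    qed
    then have "(\<lambda>n. exp (- (exp (real n * x) * crit_A n b))) \<longlonglongrightarrow> exp (- 0)" by (intro tendsto_intros)
    then have Gb: "(\<lambda>n. exp (- exp (real n * x) * crit_A n b)) \<longlonglongrightarrow> 1" by simp
    have Ga: "(\<lambda>n. exp (- exp (real n * x) * crit_A n a)) \<longlonglongrightarrow> 0"
    proof (rule tendsto_sandwich[OF _ _ tendsto_const inv[OF a(1,2)]])
      show "\<forall>\<^sub>F n in sequentially. exp (- exp (real n * x) * crit_A n a) \<le> inverse (exp x / (1 + a)) ^ n"
      proof (intro always_eventually allI)
        fix n
        define R where "R = (exp x / (1 + a)) ^ n"
        have R: "R > 0" using a by (simp add: R_def)
        have "R \<le> (1 + n * a) * R" using R a by simp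
        also have "\<dots> = exp (real n * x) * crit_A n a" unfolding exp_crit_A_eq R_def ..
        also have "\<dots> \<le> exp (exp (real n * x) * crit_A n a)"
          using exp_ge_add_one_self[of "exp (real n * x) * crit_A n a"] by linarith
        finally have "inverse (exp (exp (real n * x) * crit_A n a)) \<le> inverse R"
          using R by (intro le_imp_inverse_le) auto
        then show "exp (- exp (real n * x) * crit_A n a) \<le> inverse (exp x / (1 + a)) ^ n"
          by (simp only: R_def exp_minus mult_minus_left power_inverse)
      qed
    qed auto
    have "(\<lambda>n. crit_weight n b * (exp (- exp (real n * x) * crit_A n b) - exp (- exp (real n * x) * crit_A n a))) \<longlonglongrightarrow>
        1 / (1 + b) * (1 - 0)"
      using b s by (intro tendsto_mult tendsto_diff crit_weight_tendsto Ga Gb) auto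
    then have "\<forall>\<^sub>F n in sequentially. y < crit_weight n b * (exp (- exp (real n * x) * crit_A n b) - exp (- exp (real n * x) * crit_A n a))"
      using b by (intro order_tendstoD(1)) auto
    then show "\<forall>\<^sub>F n in sequentially. y < scaled_density n (exp (real n * x))"
      using eventually_ge_at_top[of 2]
    proof eventually_elim
      case (elim n)
      then show ?case using scaled_density_lower[of n "exp (real n * x)" a b] a by simp
    qed
  }
qed

subsection \<open>Test functions determine continuous densities\<close>

text \<open>Sets within which Frechet derivatives are unique.\<close>

definition accessible_set :: "'a::euclidean_space set \<Rightarrow> bool" where
  "accessible_set S \<longleftrightarrow> (\<forall>x\<in>S. \<forall>i\<in>Basis. \<forall>e>0. \<exists>d. 0 < \<bar>d\<bar> \<and> \<bar>d\<bar> < e \<and> x + d *\<^sub>R i \<in> S)"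

lemma accessible_UNIV: "accessible_set UNIV"
  unfolding accessible_set_def using dense by (metis UNIV_I abs_of_pos)

lemma accessible_atLeast: "accessible_set {0::real..}"
  unfolding accessible_set_def
proof (intro ballI allI impI)
  fix x i e :: real
  assume "x \<in> {0..}" "i \<in> Basis" "0 < e"
  then show "\<exists>d. 0 < \<bar>d\<bar> \<and> \<bar>d\<bar> < e \<and> x + d *\<^sub>R i \<in> {0..}"
    by (intro exI[of _ "e / 2"]) auto
qed

lemma frechet_derivative_within_eqI:
  assumes "accessible_set S" "x \<in> S" "(f has_derivative f') (at x within S)"
  shows "frechet_derivative f (at x within S) = f'"
proof (rule frechet_derivative_unique_within)
  show "(f has_derivative frechet_derivative f (at x within S)) (at x within S)"
    using assms(3) by (metis differentiableI frechet_derivative_works)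
qed (use assms in \<open>auto simp: accessible_set_def\<close>)

text \<open>Differentiation within \<open>S\<close> sees only values on \<open>S\<close>, so the
  claim passes to the derivatives; the induction therefore generalizes over both functions.\<close>

lemma Ck_on_cong:
  assumes "\<And>x. x \<in> S \<Longrightarrow> f x = g x"
  shows "Ck_on k S f \<longleftrightarrow> Ck_on k S g"
  using assms
proof (induction k arbitrary: f g)
  case 0
  then show ?case by (simp cong: continuous_on_cong)
next
  case (Suc k)
  have "(f has_derivative f') (at x within S) \<longleftrightarrow> (g has_derivative f') (at x within S)" if "x \<in> S" for x f'
    using has_derivative_transform[OF that, of f g f'] has_derivative_transform[OF that, of g f f'] Suc.prems
    by auto
  then have eq: "f differentiable (at x within S) \<longleftrightarrow> g differentiable (at x within S)"
    "frechet_derivative f (at x within S) = frechet_derivative g (at x within S)" if "x \<in> S" for x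
    using that by (simp_all add: differentiable_def frechet_derivative_def)
  have "Ck_on k S (\<lambda>x. frechet_derivative f (at x within S) v) \<longleftrightarrow> Ck_on k S (\<lambda>x. frechet_derivative g (at x within S) v)" for v
    by (rule Suc.IH) (simp add: eq(2))
  then show ?case using eq(1) by simp
qed

text \<open>Uniqueness of derivatives within an accessible set lets a derivative given by a formula
  stand for the one chosen by \<open>frechet_derivative\<close>.\<close>

lemma Ck_on_SucI:
  assumes S: "accessible_set S"
    and der: "\<And>x. x \<in> S \<Longrightarrow> (f has_derivative f' x) (at x within S)"
    and Ck: "\<And>v. Ck_on k S (\<lambda>x. f' x v)"
  shows "Ck_on (Suc k) S f"
proof -
  have "Ck_on k S (\<lambda>x. frechet_derivative f (at x within S) v)" for v
    using Ck[of v] by (rule Ck_on_cong[THEN iffD1, rotated]) (simp add: frechet_derivative_within_eqI[OF S _ der])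
  then show ?thesis using der by (auto simp: differentiable_def)
qed

lemma Ck_on_SucD: "Ck_on (Suc k) S f \<Longrightarrow> Ck_on k S f"
proof (induction k arbitrary: f)
  case 0
  then show ?case
    by (auto simp: continuous_on_eq_continuous_within intro: differentiable_imp_continuous_within)
next
  case (Suc k)
  then show ?case by (metis Ck_on.simps(2))
qed

lemma Ck_on_const:
  assumes "accessible_set S"
  shows "Ck_on k S (\<lambda>x. c)"
proof (induction k arbitrary: c)
  case (Suc k)
  show ?case by (rule Ck_on_SucI[OF assms has_derivative_const Suc.IH])
qed simp

lemma Ck_on_add:
  assumes S: "accessible_set S"
  shows "Ck_on k S f \<Longrightarrow> Ck_on k S g \<Longrightarrow> Ck_on k S (\<lambda>x. f x + g x)"
proof (induction k arbitrary: f g)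
  case 0
  then show ?case by (auto intro: continuous_on_add)
next
  case (Suc k)
  have "(f has_derivative frechet_derivative f (at x within S)) (at x within S)"
    "(g has_derivative frechet_derivative g (at x within S)) (at x within S)" if "x \<in> S" for x
    using Suc.prems that by (auto simp: frechet_derivative_works)
  then have "((\<lambda>x. f x + g x) has_derivative
      (\<lambda>v. frechet_derivative f (at x within S) v + frechet_derivative g (at x within S) v)) (at x within S)" if "x \<in> S" for x
    using that by (intro has_derivative_add) auto
  then show ?case
    by (rule Ck_on_SucI[OF S]) (use Suc in auto)
qed

lemma Ck_on_mult:
  assumes S: "accessible_set S"
  shows "Ck_on k S f \<Longrightarrow> Ck_on k S g \<Longrightarrow> Ck_on k S (\<lambda>x. f x * g x)"
proof (induction k arbitrary: f g)
  case 0
  then show ?case by (auto intro: continuous_on_mult)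
next
  case (Suc k)
  have "(f has_derivative frechet_derivative f (at x within S)) (at x within S)"
    "(g has_derivative frechet_derivative g (at x within S)) (at x within S)" if "x \<in> S" for x
    using Suc.prems that by (auto simp: frechet_derivative_works)
  then have "((\<lambda>x. f x * g x) has_derivative
      (\<lambda>v. f x * frechet_derivative g (at x within S) v + frechet_derivative f (at x within S) v * g x)) (at x within S)" if "x \<in> S" for x
    using that by (intro has_derivative_mult) auto
  then show ?case
  proof (rule Ck_on_SucI[OF S])
    fix v
    have "Ck_on k S f" "Ck_on k S g" using Suc.prems Ck_on_SucD by blast+
    then show "Ck_on k S (\<lambda>x. f x * frechet_derivative g (at x within S) v + frechet_derivative f (at x within S) v * g x)"
      using Suc.prems by (intro Ck_on_add[OF S] Suc.IH) auto
  qed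
qed

section \<open>A smooth function flat at the origin, and bump functions\<close>

text \<open>Carrying a polynomial in \<open>1 / t\<close> along makes the family closed under
  differentiation, which turns smoothness at the origin into an induction.\<close>

definition flat_fun :: "real poly \<Rightarrow> real \<Rightarrow> real" where
  "flat_fun P t = (if t > 0 then poly P (1 / t) * exp (- (1 / t)) else 0)"

lemma poly_exp_tendsto_0: "((\<lambda>y. poly P y * exp (- y)) \<longlongrightarrow> (0::real)) at_top"
proof -
  have "((\<lambda>y. \<Sum>i\<le>degree P. coeff P i * (y ^ i / exp y)) \<longlongrightarrow> (\<Sum>i\<le>degree P. coeff P i * 0)) at_top"
    by (intro tendsto_sum tendsto_mult tendsto_const tendsto_power_div_exp_0)
  then show ?thesis
    by (simp add: poly_altdef sum_distrib_right exp_minus divide_inverse mult.assoc)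
qed

lemma flat_fun_at_right: "(flat_fun P \<longlongrightarrow> 0) (at_right 0)"
proof -
  have "((\<lambda>t. poly P (inverse t) * exp (- inverse t)) \<longlongrightarrow> 0) (at_right 0)"
    by (rule filterlim_compose[OF poly_exp_tendsto_0 filterlim_inverse_at_top_right])
  moreover have "\<forall>\<^sub>F t in at_right 0. poly P (inverse t) * exp (- inverse t) = flat_fun P t"
    by (intro eventually_at_rightI[of 0 1]) (auto simp: flat_fun_def inverse_eq_divide)
  ultimately show ?thesis by (simp add: filterlim_cong)
qed

text \<open>By the chain rule \<open>P\<close> is replaced by \<open>X^2 (P - P')\<close>, where
  \<open>[:0, 0, 1:]\<close> is \<open>X^2\<close>. At the origin the difference quotient from the
  right is again a member of the family, with \<open>X P\<close>, and tends to zero.\<close>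

lemma DERIV_flat_fun: "DERIV (flat_fun P) t :> flat_fun ([:0, 0, 1:] * (P - pderiv P)) t"
proof -
  consider "t > 0" | "t < 0" | "t = 0" by linarith
  then show ?thesis
  proof cases
    case 1
    have "DERIV (\<lambda>t. poly P (1 / t) * exp (- (1 / t))) t :>
        poly (pderiv P) (1 / t) * (- (1 / t\<^sup>2)) * exp (- (1 / t)) + exp (- (1 / t)) * (1 / t\<^sup>2) * poly P (1 / t)"
      using 1 by (auto intro!: derivative_eq_intros DERIV_chain2[OF poly_DERIV] simp: power2_eq_square)
    also have "poly (pderiv P) (1 / t) * (- (1 / t\<^sup>2)) * exp (- (1 / t)) + exp (- (1 / t)) * (1 / t\<^sup>2) * poly P (1 / t) =
        flat_fun ([:0, 0, 1:] * (P - pderiv P)) t"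
      using 1 by (simp add: flat_fun_def power2_eq_square algebra_simps)
    finally show ?thesis
    proof (rule DERIV_cong_ev[THEN iffD1, rotated -1, OF _ refl _ refl])
      show "\<forall>\<^sub>F t in nhds t. poly P (1 / t) * exp (- (1 / t)) = flat_fun P t"
        using eventually_nhds_in_open[of "{0<..}" t] 1 by (auto elim!: eventually_mono simp: flat_fun_def)
    qed
  next
    case 2
    have "DERIV (\<lambda>t. 0) t :> flat_fun ([:0, 0, 1:] * (P - pderiv P)) t"
      using 2 by (simp add: flat_fun_def)
    then show ?thesis
    proof (rule DERIV_cong_ev[THEN iffD1, rotated -1, OF _ refl _ refl])
      show "\<forall>\<^sub>F t in nhds t. 0 = flat_fun P t"
        using eventually_nhds_in_open[of "{..<0}" t] 2 by (auto elim!: eventually_mono simp: flat_fun_def)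
    qed
  next
    case 3
    have "((\<lambda>h. flat_fun P h / h) \<longlongrightarrow> 0) (at_right 0)"
      using flat_fun_at_right[of "[:0, 1:] * P"]
    proof (rule filterlim_cong[THEN iffD1, OF refl refl, rotated])
      show "\<forall>\<^sub>F h in at_right 0. flat_fun ([:0, 1:] * P) h = flat_fun P h / h"
        by (intro eventually_at_rightI[of 0 1]) (auto simp: flat_fun_def)
    qed
    moreover have "((\<lambda>h. flat_fun P h / h) \<longlongrightarrow> 0) (at_left 0)"
    proof (rule tendsto_eventually)
      show "\<forall>\<^sub>F h in at_left 0. flat_fun P h / h = 0"
        by (intro eventually_at_leftI[of "-1" 0]) (auto simp: flat_fun_def)
    qed
    ultimately have "((\<lambda>h. flat_fun P h / h) \<longlongrightarrow> 0) (at 0)"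
      by (simp add: filterlim_at_split)
    then show ?thesis
      unfolding 3 by (simp add: DERIV_def flat_fun_def)
  qed
qed

text \<open>The squared distance keeps the argument polynomial in \<open>x\<close>, also at the
  centre, and the argument is positive exactly inside the ball when \<open>e > 0\<close>.\<close>

definition bump :: "'a::euclidean_space \<Rightarrow> real \<Rightarrow> 'a \<Rightarrow> real" where
  "bump c e x = flat_fun 1 (e\<^sup>2 - (x - c) \<bullet> (x - c))"

text \<open>Induction on the order for all polynomials at once: differentiation yields another
  \<open>flat_fun\<close> times an affine function of \<open>x\<close>.\<close>

lemma Ck_on_flat_fun_ball:
  assumes S: "accessible_set S"
  shows "Ck_on k S (\<lambda>x. flat_fun P (d - (x - c) \<bullet> (x - c)))"
proof (induction k arbitrary: P)
  case 0
  have "continuous_on UNIV (flat_fun P)"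
    using DERIV_isCont[OF DERIV_flat_fun] by (simp add: continuous_at_imp_continuous_on)
  then show ?case
    by (auto intro!: continuous_on_compose2[of UNIV "flat_fun P"] continuous_intros)
next
  case (Suc k)
  define Q where "Q = [:0, 0, 1:] * (P - pderiv P)"
  show ?case
  proof (rule Ck_on_SucI[OF S])
    fix x assume "x \<in> S"
    have "((\<lambda>x. d - (x - c) \<bullet> (x - c)) has_derivative (\<lambda>v. - 2 * ((x - c) \<bullet> v))) (at x within S)"
      by (auto intro!: derivative_eq_intros simp: inner_commute)
    from DERIV_compose_FDERIV[OF DERIV_flat_fun[of P] this]
    show "((\<lambda>x. flat_fun P (d - (x - c) \<bullet> (x - c))) has_derivative
        (\<lambda>v. flat_fun Q (d - (x - c) \<bullet> (x - c)) * (- 2 * ((x - c) \<bullet> v)))) (at x within S)"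
      by (simp add: Q_def mult.commute)
  next
    fix v
    have lin: "Ck_on k S (\<lambda>x. - 2 * ((x - c) \<bullet> v))"
    proof (cases k)
      case 0
      then show ?thesis by (auto intro!: continuous_intros)
    next
      case (Suc l)
      show ?thesis unfolding Suc
      proof (rule Ck_on_SucI[OF S])
        show "((\<lambda>x. - 2 * ((x - c) \<bullet> v)) has_derivative (\<lambda>w. - 2 * (w \<bullet> v))) (at x within S)" for x
          by (auto intro!: derivative_eq_intros)
      qed (rule Ck_on_const[OF S])
    qed
    show "Ck_on k S (\<lambda>x. flat_fun Q (d - (x - c) \<bullet> (x - c)) * (- 2 * ((x - c) \<bullet> v)))"
      by (rule Ck_on_mult[OF S Suc.IH lin])
  qed
qed

lemma bump_nonneg: "0 \<le> bump c e x"
  by (simp add: bump_def flat_fun_def)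

lemma bump_pos: "0 < e \<Longrightarrow> x \<in> ball c e \<Longrightarrow> 0 < bump c e x"
proof -
  assume "0 < e" "x \<in> ball c e"
  then have "(norm (x - c))\<^sup>2 < e\<^sup>2"
    by (intro power_strict_mono) (auto simp: dist_norm norm_minus_commute)
  then show ?thesis by (simp add: bump_def flat_fun_def power2_norm_eq_inner)
qed

lemma bump_eq_0: "0 < e \<Longrightarrow> x \<notin> ball c e \<Longrightarrow> bump c e x = 0"
proof -
  assume "0 < e" "x \<notin> ball c e"
  then have "e\<^sup>2 \<le> (norm (x - c))\<^sup>2"
    by (intro power_mono) (auto simp: dist_norm norm_minus_commute)
  then show ?thesis by (simp add: bump_def flat_fun_def power2_norm_eq_inner)
qed

lemma continuous_on_bump: "continuous_on A (bump c e)"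
proof -
  have "Ck_on 0 UNIV (bump c e)"
    unfolding bump_def[abs_def] by (rule Ck_on_flat_fun_ball[OF accessible_UNIV])
  then show ?thesis using continuous_on_subset by auto
qed

lemma test_fun_on_bump:
  assumes "accessible_set S" "0 < e"
  shows "test_fun_on S (bump c e)"
proof -
  have "{x \<in> S. bump c e x \<noteq> 0} \<subseteq> ball c e" using bump_eq_0[OF assms(2)] by blast
  then have "bounded {x \<in> S. bump c e x \<noteq> 0}" using bounded_ball bounded_subset by blast
  then show ?thesis
    using Ck_on_flat_fun_ball[OF assms(1)] by (simp add: test_fun_on_def smooth_on_def bump_def[abs_def])
qed

text \<open>If the inequality held at an interior point, it would hold on a small ball, and a bump
  supported there would separate the integrals. The one-sided form is applied twice, with the roles
  exchanged, to obtain equality.\<close>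

lemma density_unique_interior:
  fixes D1 D2 :: "'a::euclidean_space \<Rightarrow> real"
  assumes S: "accessible_set S" and c: "continuous_on S D1" "continuous_on S D2"
    and eq: "\<And>\<phi>. test_fun_on S \<phi> \<Longrightarrow> (LINT x:S|lborel. \<phi> x * D1 x) = (LINT x:S|lborel. \<phi> x * D2 x)"
    and x0: "x0 \<in> interior S"
  shows "\<not> D1 x0 < D2 x0"
proof
  assume less: "D1 x0 < D2 x0"
  obtain e0 where e0: "e0 > 0" "cball x0 e0 \<subseteq> S" using x0 mem_interior_cball by blast
  have cd: "continuous_on (interior S) (\<lambda>x. D2 x - D1 x)"
    using c interior_subset by (intro continuous_on_diff) (auto intro: continuous_on_subset)
  then have "open (interior S \<inter> (\<lambda>x. D2 x - D1 x) -` {0<..})"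
    by (intro continuous_open_preimage) auto
  then have op: "open ((\<lambda>x. D2 x - D1 x) -` {0<..} \<inter> interior S)" by (simp add: Int_commute)
  have "x0 \<in> (\<lambda>x. D2 x - D1 x) -` {0<..} \<inter> interior S" using less x0 by auto
  then obtain e where e: "e > 0" "cball x0 e \<subseteq> (\<lambda>x. D2 x - D1 x) -` {0<..} \<inter> interior S"
    using op open_contains_cball by blast
  have sub: "cball x0 e \<subseteq> S" using e interior_subset by blast
  have pos: "D1 x < D2 x" if "x \<in> cball x0 e" for x using that e by auto
  define \<phi> where "\<phi> = bump x0 e"
  have conv: "(LINT x:S|lborel. \<phi> x * D x) = (LINT x|lborel. indicator (cball x0 e) x *\<^sub>R (\<phi> x * D x))" for D
    unfolding set_lebesgue_integral_def \<phi>_def using sub bump_eq_0[OF e(1), of _ x0]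
    by (intro Bochner_Integration.integral_cong) (auto simp: indicator_def)
  have int: "integrable lborel (\<lambda>x. indicator (cball x0 e) x *\<^sub>R (\<phi> x * D x))" if "continuous_on S D" for D
    unfolding \<phi>_def using that sub
    by (intro borel_integrable_compact continuous_intros continuous_on_bump) (auto intro: continuous_on_subset)
  let ?g = "\<lambda>x. indicator (cball x0 e) x *\<^sub>R (\<phi> x * (D2 x - D1 x))"
  have intg: "integrable lborel ?g"
    using Bochner_Integration.integrable_diff[OF int[OF c(2)] int[OF c(1)]] by (simp add: algebra_simps)
  have "(LINT x|lborel. ?g x) = (LINT x|lborel. indicator (cball x0 e) x *\<^sub>R (\<phi> x * D2 x) - indicator (cball x0 e) x *\<^sub>R (\<phi> x * D1 x))"
    by (simp add: algebra_simps)
  also have "\<dots> = (LINT x:S|lborel. \<phi> x * D2 x) - (LINT x:S|lborel. \<phi> x * D1 x)"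
    unfolding conv by (rule Bochner_Integration.integral_diff[OF int[OF c(2)] int[OF c(1)]])
  also have "\<dots> = 0" using eq[of \<phi>] test_fun_on_bump[OF S e(1), of x0] by (simp add: \<phi>_def)
  finally have "AE x in lborel. ?g x = 0"
    using pos bump_nonneg[of x0 e]
    by (subst integral_nonneg_eq_0_iff_AE[symmetric, OF intg]) (auto simp: indicator_def \<phi>_def less_imp_le)
  then have "AE x in lborel. x \<notin> ball x0 e"
  proof eventually_elim
    case (elim x)
    show ?case
    proof
      assume x: "x \<in> ball x0 e"
      then have "0 < \<phi> x * (D2 x - D1 x)"
        using bump_pos[OF e(1) x] pos[of x] by (auto simp: \<phi>_def)
      then show False using elim x by (auto simp: indicator_def)
    qed
  qed
  then have "emeasure lborel (ball x0 e) = 0"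
    by (subst (asm) AE_iff_measurable[of "ball x0 e"]) auto
  then have "ennreal (unit_ball_vol (real DIM('a)) * e ^ DIM('a)) = 0"
    using e(1) by (simp add: emeasure_ball)
  moreover have "0 < unit_ball_vol (real DIM('a)) * e ^ DIM('a)"
    using e(1) by (intro mult_pos_pos unit_ball_vol_pos) auto
  ultimately show False by (simp add: ennreal_eq_0_iff)
qed

subsection \<open>The densities of critical values and of their moduli\<close>

lemma distr_cmod: "distr lborel borel cmod = density lborel (\<lambda>x. ennreal (indicator {0..} x * (2 * pi * x)))"
proof (rule measure_eqI_generator_eq[where \<Omega>=UNIV and E="range (\<lambda>a::real. {..a})" and A="\<lambda>i. {..real i}"])
  show "Int_stable (range (\<lambda>a::real. {..a}))"
    by (auto simp: Int_stable_def)
  show "(\<Union>i. {..real i}) = UNIV" using real_arch_simple by auto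
  have disc: "emeasure (distr lborel borel cmod) {..a} = ennreal (pi * (max 0 a)\<^sup>2)" for a
  proof (cases "a < 0")
    case True
    have "\<not> cmod z \<le> a" for z using True norm_ge_zero[of z] by linarith
    then have "cmod -` {..a} = {}" by auto
    then show ?thesis using True by (simp add: emeasure_distr)
  next
    case False
    then have "cmod -` {..a} = {z. cmod z \<le> a}" by auto
    then show ?thesis using False emeasure_disc_complex[of a] by (simp add: emeasure_distr)
  qed
  show "emeasure (distr lborel borel cmod) X =
      emeasure (density lborel (\<lambda>x. ennreal (indicator {0..} x * (2 * pi * x)))) X"
    if X_range: "X \<in> range (\<lambda>a::real. {..a})" for X
  proof -
    obtain a where X: "X = {..a}" using X_range by auto
    have "emeasure (density lborel (\<lambda>x. ennreal (indicator {0..} x * (2 * pi * x)))) {..a} =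
        (\<integral>\<^sup>+x. ennreal (2 * pi * x) * indicator {0..max 0 a} x \<partial>lborel)"
    proof (subst emeasure_density)
      have "AE x in lborel. x \<noteq> (0::real)" by (rule AE_lborel_singleton)
      then show "(\<integral>\<^sup>+x. ennreal (indicator {0..} x * (2 * pi * x)) * indicator {..a} x \<partial>lborel) =
          (\<integral>\<^sup>+x. ennreal (2 * pi * x) * indicator {0..max 0 a} x \<partial>lborel)"
        by (intro nn_integral_cong_AE) (auto elim!: eventually_mono simp: indicator_def)
    qed auto
    also have "\<dots> = ennreal (pi * (max 0 a)\<^sup>2 - pi * 0\<^sup>2)"
      by (rule nn_integral_FTC_Icc) (auto intro!: derivative_eq_intros)
    finally show ?thesis using disc X by simp
  qed
  show "emeasure (distr lborel borel cmod) {..real i} \<noteq> \<infinity>" for i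
    by (simp add: disc)
  show "sets (distr lborel borel cmod) = sigma_sets UNIV (range (\<lambda>a::real. {..a}))"
    by (simp add: borel_eq_atMost)
  show "sets (density lborel (\<lambda>x. ennreal (indicator {0..} x * (2 * pi * x)))) = sigma_sets UNIV (range (\<lambda>a::real. {..a}))"
    by (simp add: borel_eq_atMost)
qed auto

text \<open>Polar coordinates for radial functions. Measurability is asked on the half-line only,
  since a test function on \<open>{0..}\<close> may be arbitrary at negative arguments.\<close>

lemma integral_cmod:
  fixes g :: "real \<Rightarrow> real"
  assumes [measurable]: "(\<lambda>x. indicator {0..} x * g x) \<in> borel_measurable borel"
  shows "(LINT w|lborel. g (cmod w)) = (LINT x:{0..}|lborel. 2 * pi * x * g x)"
proof -
  have "(LINT w|lborel. g (cmod w)) = (LINT w|lborel. indicator {0..} (cmod w) * g (cmod w))" by simp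
  also have "\<dots> = (LINT x|distr lborel borel cmod. indicator {0..} x * g x)"
    using integral_distr[of cmod lborel borel "\<lambda>x. indicator {0..} x * g x"] assms by simp
  also have "\<dots> = (LINT x|lborel. (indicator {0..} x * (2 * pi * x)) *\<^sub>R (indicator {0..} x * g x))"
    unfolding distr_cmod
  proof (rule integral_density)
    show "(\<lambda>x. indicator {0..} x * g x) \<in> borel_measurable lborel" using assms by simp
  qed (auto simp: indicator_def)
  also have "\<dots> = (LINT x:{0..}|lborel. 2 * pi * x * g x)"
    unfolding set_lebesgue_integral_def by (intro Bochner_Integration.integral_cong) (auto simp: indicator_def)
  finally show ?thesis .
qed

lemma continuous_on_crit_D_cmod: "continuous_on UNIV (\<lambda>w::complex. crit_D n ((cmod w)\<^sup>2))"
  by (rule continuous_on_compose2[OF continuous_on_crit_D]) (auto intro!: continuous_intros)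

definition abs_density :: "nat \<Rightarrow> real \<Rightarrow> real" where
  "abs_density n x = (if x < 0 then 0 else 2 * pi * x * crit_D n (x\<^sup>2))"

lemma continuous_on_abs_density: "continuous_on {0..} (abs_density n)"
proof -
  have "continuous_on {0..} (\<lambda>x. 2 * pi * x * crit_D n (x\<^sup>2))"
    by (intro continuous_intros continuous_on_compose2[OF continuous_on_crit_D]) auto
  then show ?thesis by (rule continuous_on_cong[THEN iffD1, rotated -1]) (auto simp: abs_density_def)
qed

section \<open>Densities and limits for independent Gaussian coefficients\<close>

locale gaussian_coefficients =
  fixes M :: "'w measure" and a :: "nat \<Rightarrow> 'w \<Rightarrow> complex"
  assumes prob: "prob_space M"
    and indep: "prob_space.indep_vars M (\<lambda>_. borel) a UNIV"
    and dist: "\<And>j. distributed M lborel (a j) (\<lambda>z. ennreal (exp (- (cmod z)\<^sup>2) / pi))"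
begin

lemma measurable_coefficient [measurable]: "a j \<in> borel_measurable M"
  using dist[of j] by (simp add: distributed_def)

text \<open>The value is finite because a continuous function of bounded support is integrated
  against a continuous density; finiteness turns the nonnegative formula into a Bochner
  integral.\<close>

lemma has_bochner_integral_crit_sum_nonneg:
  fixes \<psi> :: "complex \<Rightarrow> real"
  assumes n: "2 \<le> n" and \<psi>: "continuous_on UNIV \<psi>" "\<And>w. 0 \<le> \<psi> w" and bdd: "bounded {w. \<psi> w \<noteq> 0}"
  shows "has_bochner_integral M (\<lambda>\<omega>. crit_sum \<psi> (SU2_poly a n \<omega>))
      (LINT w|lborel. \<psi> w * crit_D n ((cmod w)\<^sup>2))"
    and "integrable lborel (\<lambda>w. \<psi> w * crit_D n ((cmod w)\<^sup>2))"
proof -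
  obtain c R where R: "{w. \<psi> w \<noteq> 0} \<subseteq> cball c R" using bdd bounded_subset_cball by blast
  have "integrable lborel (\<lambda>w. indicator (cball c R) w *\<^sub>R (\<psi> w * crit_D n ((cmod w)\<^sup>2)))"
    by (intro borel_integrable_compact continuous_on_mult continuous_on_subset[OF \<psi>(1)]
        continuous_on_subset[OF continuous_on_crit_D_cmod]) auto
  then show int: "integrable lborel (\<lambda>w. \<psi> w * crit_D n ((cmod w)\<^sup>2))"
    by (rule Bochner_Integration.integrable_cong[THEN iffD1, rotated -1]) (use R in \<open>auto simp: indicator_def\<close>)
  have D0: "0 \<le> crit_D n ((cmod w)\<^sup>2)" for w :: complex using n by (intro crit_D_nonneg) auto
  have "(\<integral>\<^sup>+\<omega>. ennreal (crit_sum \<psi> (SU2_poly a n \<omega>)) \<partial>M) =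
      (\<integral>\<^sup>+w. ennreal (\<psi> w) * ennreal (crit_D n ((cmod w)\<^sup>2)) \<partial>lborel)"
    unfolding nn_integral_crit_sum[OF prob indep dist n \<psi>] using n by (simp add: nn_integral_crit_kernel)
  also have "\<dots> = (\<integral>\<^sup>+w. ennreal (\<psi> w * crit_D n ((cmod w)\<^sup>2)) \<partial>lborel)"
    using \<psi>(2) D0 by (simp add: ennreal_mult)
  also have "\<dots> = ennreal (LINT w|lborel. \<psi> w * crit_D n ((cmod w)\<^sup>2))"
    using \<psi>(2) D0 by (intro nn_integral_eq_integral int) auto
  finally have eq: "(\<integral>\<^sup>+\<omega>. ennreal (crit_sum \<psi> (SU2_poly a n \<omega>)) \<partial>M) =
      ennreal (LINT w|lborel. \<psi> w * crit_D n ((cmod w)\<^sup>2))" .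
  show "has_bochner_integral M (\<lambda>\<omega>. crit_sum \<psi> (SU2_poly a n \<omega>))
      (LINT w|lborel. \<psi> w * crit_D n ((cmod w)\<^sup>2))"
    by (rule has_bochner_integral_nn_integral[OF measurable_crit_sum[OF measurable_coefficient \<psi>(1)] _ _ eq])
      (auto intro!: sum_nonneg Bochner_Integration.integral_nonneg mult_nonneg_nonneg \<psi>(2) D0)
qed

text \<open>Positive and negative parts are continuous but in general not smooth, so the nonnegative
  case is stated for continuous functions. Continuity is also all that a radial test function
  \<open>\<phi> (cmod w)\<close> is guaranteed to keep at the origin.\<close>

lemma expectation_crit_sum:
  fixes \<psi> :: "complex \<Rightarrow> real"
  assumes n: "2 \<le> n" and \<psi>: "continuous_on UNIV \<psi>" and bdd: "bounded {w. \<psi> w \<noteq> 0}"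
  shows "prob_space.expectation M (\<lambda>\<omega>. crit_sum \<psi> (SU2_poly a n \<omega>)) =
      (LINT w|lborel. \<psi> w * crit_D n ((cmod w)\<^sup>2))"
proof -
  define p where "p w = max (\<psi> w) 0" for w
  define m where "m w = max (- \<psi> w) 0" for w
  have pm: "\<psi> w = p w - m w" for w by (simp add: p_def m_def max_def)
  have p: "continuous_on UNIV p" "\<And>w. 0 \<le> p w" "bounded {w. p w \<noteq> 0}"
    using \<psi> by (auto simp: p_def[abs_def] intro!: continuous_intros intro: bounded_subset[OF bdd])
  have m: "continuous_on UNIV m" "\<And>w. 0 \<le> m w" "bounded {w. m w \<noteq> 0}"
    using \<psi> by (auto simp: m_def[abs_def] intro!: continuous_intros intro: bounded_subset[OF bdd])
  note P = has_bochner_integral_crit_sum_nonneg[OF n p]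
  note N = has_bochner_integral_crit_sum_nonneg[OF n m]
  have "has_bochner_integral M (\<lambda>\<omega>. (crit_sum p (SU2_poly a n \<omega>)) -
      (crit_sum m (SU2_poly a n \<omega>)))
    ((LINT w|lborel. p w * crit_D n ((cmod w)\<^sup>2)) - (LINT w|lborel. m w * crit_D n ((cmod w)\<^sup>2)))"
    by (rule has_bochner_integral_diff[OF P(1) N(1)])
  moreover have "(LINT w|lborel. p w * crit_D n ((cmod w)\<^sup>2)) - (LINT w|lborel. m w * crit_D n ((cmod w)\<^sup>2)) =
      (LINT w|lborel. \<psi> w * crit_D n ((cmod w)\<^sup>2))"
    unfolding Bochner_Integration.integral_diff[OF P(2) N(2), symmetric] pm by (simp add: left_diff_distrib)
  ultimately show ?thesis
    by (simp add: pm sum_subtractf has_bochner_integral_integral_eq)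
qed

lemma is_crit_density_crit_D:
  assumes n: "2 \<le> n"
  shows "is_crit_density M a n (\<lambda>w. crit_D n ((cmod w)\<^sup>2))"
  unfolding is_crit_density_def
proof (intro conjI allI impI continuous_on_crit_D_cmod)
  fix \<phi> :: "complex \<Rightarrow> real" assume "test_fun_on UNIV \<phi>"
  then have "Ck_on 0 UNIV \<phi>" "compact (closure {w. \<phi> w \<noteq> 0})"
    unfolding test_fun_on_def smooth_on_def by auto
  then have "continuous_on UNIV \<phi>" "bounded {w. \<phi> w \<noteq> 0}"
    using compact_imp_bounded bounded_subset closure_subset by auto
  then show "prob_space.expectation M (\<lambda>\<omega>. crit_sum \<phi> (SU2_poly a n \<omega>)) =
      (LINT w|lborel. \<phi> w * crit_D n ((cmod w)\<^sup>2))"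
    by (rule expectation_crit_sum[OF n])
qed

lemma crit_density_eq:
  assumes n: "2 \<le> n"
  shows "crit_density M a n = (\<lambda>w. crit_D n ((cmod w)\<^sup>2))"
  unfolding crit_density_def
proof (rule the_equality)
  show "is_crit_density M a n (\<lambda>w. crit_D n ((cmod w)\<^sup>2))" by (rule is_crit_density_crit_D[OF n])
next
  fix D assume D: "is_crit_density M a n D"
  note D' = is_crit_density_crit_D[OF n]
  have eq: "(LINT x:UNIV|lborel. \<phi> x * D x) = (LINT x:UNIV|lborel. \<phi> x * crit_D n ((cmod x)\<^sup>2))"
    if "test_fun_on UNIV \<phi>" for \<phi>
    using D D' that unfolding is_crit_density_def set_lebesgue_integral_def by simp
  have c: "continuous_on UNIV D" using D by (simp add: is_crit_density_def)
  show "D = (\<lambda>w. crit_D n ((cmod w)\<^sup>2))"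
  proof
    fix w
    show "D w = crit_D n ((cmod w)\<^sup>2)"
      using density_unique_interior[OF accessible_UNIV c continuous_on_crit_D_cmod eq, of w]
        density_unique_interior[OF accessible_UNIV continuous_on_crit_D_cmod c eq[symmetric], of w]
      by simp
  qed
qed

text \<open>A test function of the modulus is continuous with bounded support on the plane, so the
  expectation formula applies to it; polar coordinates bring in \<open>2 * pi * x\<close>.\<close>

lemma is_abs_crit_density_abs_density:
  assumes n: "2 \<le> n"
  shows "is_abs_crit_density M a n (abs_density n)"
  unfolding is_abs_crit_density_def
proof (intro conjI allI impI continuous_on_abs_density)
  fix \<phi> :: "real \<Rightarrow> real" assume "test_fun_on {0..} \<phi>"
  then have "Ck_on 0 {0..} \<phi>" "compact (closure {x \<in> {0..}. \<phi> x \<noteq> 0})"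
    unfolding test_fun_on_def smooth_on_def by auto
  then have \<phi>: "continuous_on {0..} \<phi>" and b: "bounded {x \<in> {0..}. \<phi> x \<noteq> 0}"
    using compact_imp_bounded bounded_subset closure_subset by auto
  have c: "continuous_on UNIV (\<lambda>w::complex. \<phi> (cmod w))"
    by (rule continuous_on_compose2[OF \<phi>]) (auto intro!: continuous_intros)
  obtain R where R: "\<And>x. x \<in> {0..} \<Longrightarrow> \<phi> x \<noteq> 0 \<Longrightarrow> \<bar>x\<bar> \<le> R"
    using b unfolding bounded_iff by auto
  have "{w::complex. \<phi> (cmod w) \<noteq> 0} \<subseteq> cball 0 R" using R by force
  then have bd: "bounded {w::complex. \<phi> (cmod w) \<noteq> 0}" using bounded_subset bounded_cball by blast
  have "(\<lambda>x. indicator {0..} x *\<^sub>R (\<phi> x * crit_D n (x\<^sup>2))) \<in> borel_measurable borel"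
    by (intro borel_measurable_continuous_on_indicator continuous_on_mult \<phi>
        continuous_on_compose2[OF continuous_on_crit_D]) (auto intro!: continuous_intros)
  then have "(LINT w|lborel. \<phi> (cmod w) * crit_D n ((cmod w)\<^sup>2)) = (LINT x:{0..}|lborel. 2 * pi * x * (\<phi> x * crit_D n (x\<^sup>2)))"
    using integral_cmod[of "\<lambda>x. \<phi> x * crit_D n (x\<^sup>2)"] by simp
  also have "\<dots> = (LINT x:{0..}|lborel. \<phi> x * abs_density n x)"
    by (rule set_lebesgue_integral_cong) (auto simp: abs_density_def)
  finally show "prob_space.expectation M (\<lambda>\<omega>. \<Sum>z\<in>crit_points (SU2_poly a n \<omega>). \<phi> (cmod (poly (SU2_poly a n \<omega>) z))) =
      (LINT x:{0..}|lborel. \<phi> x * abs_density n x)"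
    using expectation_crit_sum[OF n c bd] by simp
qed (simp add: abs_density_def)

lemma abs_crit_density_eq:
  assumes n: "2 \<le> n"
  shows "abs_crit_density M a n = abs_density n"
  unfolding abs_crit_density_def
proof (rule the_equality)
  show "is_abs_crit_density M a n (abs_density n)" by (rule is_abs_crit_density_abs_density[OF n])
next
  fix D assume D: "is_abs_crit_density M a n D"
  note D' = is_abs_crit_density_abs_density[OF n]
  have eq: "(LINT x:{0..}|lborel. \<phi> x * D x) = (LINT x:{0..}|lborel. \<phi> x * abs_density n x)"
    if "test_fun_on {0..} \<phi>" for \<phi>
    using D D' that unfolding is_abs_crit_density_def by simp
  have c: "continuous_on {0..} D" using D by (simp add: is_abs_crit_density_def)
  have pos: "D x = abs_density n x" if "x > 0" for x
    using density_unique_interior[OF accessible_atLeast c continuous_on_abs_density eq, of x]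
      density_unique_interior[OF accessible_atLeast continuous_on_abs_density c eq[symmetric], of x] that
    by simp
  \<comment> \<open>The origin is not an interior point of \<open>{0..}\<close>; there the two
    densities agree by continuity from the right.\<close>
  have zero: "D 0 = abs_density n 0"
  proof -
    have lim: "(D \<longlongrightarrow> D 0) (at_right 0)" "(abs_density n \<longlongrightarrow> abs_density n 0) (at_right 0)"
      using c continuous_on_abs_density[of n] by (auto simp: continuous_on_def intro: tendsto_within_subset)
    have "\<forall>\<^sub>F x in at_right 0. D x = abs_density n x"
      by (intro eventually_at_rightI[of 0 1]) (auto simp: pos)
    then have "(D \<longlongrightarrow> abs_density n 0) (at_right 0)"
      using lim(2) by (rule tendsto_cong[THEN iffD2])
    with lim(1) show ?thesis by (rule tendsto_unique[OF trivial_limit_at_right_real])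
  qed
  show "D = abs_density n"
  proof
    fix x :: real
    consider "x < 0" | "x = 0" | "x > 0" by linarith
    then show "D x = abs_density n x"
      using D D' pos zero by cases (auto simp: is_abs_crit_density_def)
  qed
qed

text \<open>By the chain rule the density \<open>2 pi y D(y^2)\<close> at
  \<open>y = exp (n x / 2)\<close> is multiplied by the derivative \<open>n y / 2\<close>; the
  result depends on \<open>y\<close> only through \<open>y^2 = exp (n x)\<close>.\<close>

lemma rescaled_density_eq:
  assumes n: "2 \<le> n"
  shows "rescaled_density M a n x = scaled_density n (exp (real n * x))"
proof -
  define y where "y t = exp (real n * t / 2)" for t
  have yd: "DERIV y t :> y t * (real n / 2)" for t
    unfolding y_def[abs_def] by (auto intro!: derivative_eq_intros)
  have y0: "y t > 0" for t by (simp add: y_def)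
  have "DERIV (\<lambda>s. LINT u:{0..s}|lborel. abs_density n u) (y x) :> abs_density n (y x)"
  proof -
    \<comment> \<open>The right end \<open>y x + 1\<close> makes \<open>y x\<close> an interior
      point, so the derivative within the interval is a full one.\<close>
    have cont: "continuous_on {0..y x + 1} (abs_density n)"
      by (rule continuous_on_subset[OF continuous_on_abs_density]) auto
    have "((\<lambda>s. integral {0..s} (abs_density n)) has_real_derivative abs_density n (y x)) (at (y x) within {0..y x + 1})"
      by (rule integral_has_real_derivative[OF cont]) (use y0[of x] in auto)
    then have "DERIV (\<lambda>s. integral {0..s} (abs_density n)) (y x) :> abs_density n (y x)"
      by (subst (asm) at_within_Icc_at) (use y0[of x] in auto)
    then show ?thesis
    proof (rule DERIV_cong_ev[THEN iffD1, rotated -1, OF _ refl _ refl])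
      have "integral {0..s} (abs_density n) = (LINT u:{0..s}|lborel. abs_density n u)" for s
        by (rule set_borel_integral_eq_integral(2)[symmetric])
          (auto intro!: borel_integrable_atLeastAtMost' continuous_on_subset[OF continuous_on_abs_density])
      then show "\<forall>\<^sub>F s in nhds (y x). integral {0..s} (abs_density n) = (LINT u:{0..s}|lborel. abs_density n u)" by simp
    qed
  qed
  from DERIV_chain2[OF this yd]
  have "DERIV (\<lambda>t. LINT u:{0..y t}|lborel. abs_density n u) x :> abs_density n (y x) * (y x * (real n / 2))" .
  then have "DERIV (\<lambda>t. 1 / (real n - 1) * (LINT u:{0..y t}|lborel. abs_density n u)) x :>
      1 / (real n - 1) * (abs_density n (y x) * (y x * (real n / 2)))"
    by (rule DERIV_cmult)
  then have "rescaled_density M a n x = 1 / (real n - 1) * (abs_density n (y x) * (y x * (real n / 2)))"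
    unfolding rescaled_density_def abs_crit_cdf_def abs_crit_density_eq[OF n] y_def[symmetric] by (rule DERIV_imp_deriv)
  also have "abs_density n (y x) * (y x * (real n / 2)) = real n * pi * (y x)\<^sup>2 * crit_D n ((y x)\<^sup>2)"
    using y0[of x] by (simp add: abs_density_def power2_eq_square)
  also have "(y x)\<^sup>2 = exp (real n * x)"
    by (simp add: y_def exp_double[symmetric])
  finally show ?thesis using scaled_density_eq[OF n] by simp
qed

lemma crit_density_1_tendsto:
  "(\<lambda>n. crit_density M a n 1) \<longlonglongrightarrow> (1 - exp (- 1)) / pi + 1 / pi * (LINT s:{0..1}|lborel. exp (- (s - s * ln s)))"
proof -
  have "\<forall>\<^sub>F n in sequentially. crit_D n 1 = crit_density M a n 1"
    using eventually_ge_at_top[of 2] by eventually_elim (simp add: crit_density_eq)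
  then show ?thesis by (rule Lim_transform_eventually[OF crit_D_1_limit])
qed

lemma rescaled_density_tendsto:
  "(\<lambda>n. rescaled_density M a n x) \<longlonglongrightarrow>
    (if x > 0 then exp (- x) else if x = 0 then pi * lim (\<lambda>n. crit_density M a n 1) else 0)"
proof -
  have ev: "\<forall>\<^sub>F n in sequentially. scaled_density n (exp (real n * x)) = rescaled_density M a n x"
    using eventually_ge_at_top[of 2] by eventually_elim (simp add: rescaled_density_eq)
  consider "x > 0" | "x < 0" | "x = 0" by linarith
  then have "(\<lambda>n. scaled_density n (exp (real n * x))) \<longlonglongrightarrow>
    (if x > 0 then exp (- x) else if x = 0 then pi * lim (\<lambda>n. crit_density M a n 1) else 0)"
  proof cases
    \<comment> \<open>At \<open>x = 0\<close> the argument is \<open>X = 1\<close> for every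
      \<open>n\<close>, and only the factor \<open>n / (n - 1)\<close> separates the rescaled
      density from \<open>pi\<close> times \<open>crit_D n 1\<close>.\<close>
    case 3
    have "(\<lambda>n. real n / (real n - 1)) \<longlonglongrightarrow> 1" by real_asymp
    then have "(\<lambda>n. real n / (real n - 1) * pi * 1 * crit_D n 1) \<longlonglongrightarrow>
        1 * pi * 1 * lim (\<lambda>n. crit_density M a n 1)"
      using crit_D_1_limit unfolding limI[OF crit_density_1_tendsto]
      by (intro tendsto_mult tendsto_const) auto
    moreover have "\<forall>\<^sub>F n in sequentially. real n / (real n - 1) * pi * 1 * crit_D n 1 = scaled_density n (exp (real n * x))"
      using eventually_ge_at_top[of 2] by eventually_elim (simp add: 3 scaled_density_eq)
    ultimately have "(\<lambda>n. scaled_density n (exp (real n * x))) \<longlonglongrightarrow> 1 * pi * 1 * lim (\<lambda>n. crit_density M a n 1)"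
      by (rule Lim_transform_eventually)
    then show ?thesis using 3 by simp
  qed (auto simp: scaled_density_tendsto_pos scaled_density_tendsto_neg)
  then show ?thesis using ev by (rule Lim_transform_eventually)
qed

end

theorem theorem4:
  fixes M :: "'w measure" and a :: "nat \<Rightarrow> 'w \<Rightarrow> complex"
  assumes "prob_space M"
    and "prob_space.indep_vars M (\<lambda>_. borel) a UNIV"
    and "\<And>j. distributed M lborel (a j) (\<lambda>z. ennreal (exp (- (cmod z)\<^sup>2) / pi))"
  shows "(\<forall>x::real. (\<lambda>n. rescaled_density M a n x) \<longlonglongrightarrow>
            (if x > 0 then exp (- x)
             else if x = 0 then pi * lim (\<lambda>n. crit_density M a n 1)
             else 0))
       \<and> (\<lambda>n. crit_density M a n 1) \<longlonglongrightarrow>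
            (1 - exp (- 1)) / pi + 1 / pi * (LINT s:{0..1}|lborel. exp (- (s - s * ln s)))"
proof -
  interpret gaussian_coefficients M a by (rule gaussian_coefficients.intro[OF assms])
  show ?thesis using rescaled_density_tendsto crit_density_1_tendsto by blast
qed

end
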